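(* Let $k$ be a $\sigma$-field, $R$ a $k$-$\sigma$-algebra and $K$ a $\sigma$-field extension of $k$. Then, as subsets of $R\otimes_k K$, $$\pi_0^\sigma(R\otimes_k K|K)=\pi_0^\sigma(R|k)\otimes_k K.$$
   Context: All rings are commutative. A $\sigma$-ring is a ring $R$ with a ring endomorphism $\sigma\colon R\to R$ (not assumed injective); a $\sigma$-field is a $\sigma$-ring whose underlying ring is a field. A $\sigma$-field extension $K|k$ is a field extension of $\sigma$-fields such that $\sigma$ on $K$ restricts to $\sigma$ on $k$. For a $\sigma$-field $k$, a $k$-$\sigma$-algebra is a $\sigma$-ring $R$ with a $\sigma$-equivariant ring morphism $k\to R$; a $k$-$\sigma$-subalgebra is a $k$-subalgebra stable under $\sigma$. Tensor products of $k$-$\sigma$-algebras carry $\sigma(r\otimes s)=\sigma(r)\otimes\sigma(s)$. $R$ is $\sigma$-separable over $k$ if $\sigma$ is injective on $R\otimes_k K$ for every $\sigma$-field extension $K|k$. $R$ is strongly $\sigma$-étale over $k$ if it is $\sigma$-separable over $k$ and étale as a $k$-algebra (i.e. $R\otimes_k\overline{k}$ is isomorphic to a finite product of copies of $\overline{k}$). The strong core $\pi_0^\sigma(R|k)$ is the union of all strongly $\sigma$-étale $k$-$\sigma$-subalgebras of $R$ (it is a $k$-$\sigma$-subalgebra of $R$). *)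

theory Defs
  imports "HOL-Algebra.Algebra"
begin

section \<open>Difference rings, difference fields and difference algebras\<close>

record 'a difference_ring = "'a ring" +
  sig :: "'a \<Rightarrow> 'a"

locale difference_ring = cring R for R :: "('a, 'm) difference_ring_scheme" (structure) +
  assumes sig_hom: "sig R \<in> ring_hom R R"

locale difference_field = difference_ring R + field R for R (structure)

text \<open>A \<open>k\<close>-\<open>\<sigma>\<close>-algebra is \<open>R\<close> together with its structure morphism \<open>\<phi>\<close> from \<open>k\<close>.
  Only the values of \<open>\<phi>\<close> and \<open>sig\<close> on the carriers matter.\<close>

definition difference_algebra ::
    "('k, 'm) difference_ring_scheme \<Rightarrow> ('k \<Rightarrow> 'a) \<Rightarrow> ('a, 'n) difference_ring_scheme \<Rightarrow> bool"
  where "difference_algebra k \<phi> R \<longleftrightarrow>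
    difference_field k \<and> difference_ring R \<and> \<phi> \<in> ring_hom k R \<and>
    (\<forall>c\<in>carrier k. \<phi> (sig k c) = sig R (\<phi> c))"

definition difference_field_extension ::
    "('k, 'm) difference_ring_scheme \<Rightarrow> ('k \<Rightarrow> 'a) \<Rightarrow> ('a, 'n) difference_ring_scheme \<Rightarrow> bool"
  where "difference_field_extension k \<iota> K \<longleftrightarrow>
    difference_algebra k \<iota> K \<and> difference_field K"

definition difference_subalgebra ::
    "'a set \<Rightarrow> ('k, 'm) difference_ring_scheme \<Rightarrow> ('k \<Rightarrow> 'a) \<Rightarrow> ('a, 'n) difference_ring_scheme \<Rightarrow> bool"
  where "difference_subalgebra A k \<phi> R \<longleftrightarrow>
    subring A R \<and> \<phi> ` carrier k \<subseteq> A \<and> sig R ` A \<subseteq> A"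


section \<open>Tensor products\<close>

text \<open>The integral monoid ring \<open>\<int>[M]\<close>.\<close>

definition monoid_ring :: "('a, 'm) monoid_scheme \<Rightarrow> ('a \<Rightarrow>\<^sub>0 int) ring"
  where "monoid_ring M =
    \<lparr>carrier = {p. Poly_Mapping.keys p \<subseteq> carrier M},
     monoid.mult = (\<lambda>p q. frag_extend (\<lambda>x. frag_extend (\<lambda>y. frag_of (x \<otimes>\<^bsub>M\<^esub> y)) q) p),
     one = frag_of \<one>\<^bsub>M\<^esub>,
     ring.zero = 0,
     add = (+)\<rparr>"

text \<open>The tensor product of two algebras over \<open>k\<close> with structure maps \<open>\<phi>\<close> into \<open>R\<close> and
  \<open>\<psi>\<close> into \<open>S\<close> is the free abelian group on \<open>R \<times> S\<close> modulo the bilinearity relations. The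
  monoid ring of \<open>R \<times> S\<close> puts the product \<open>(r, s) (r', s') = (r r', s s')\<close> on that free
  abelian group; the subgroup generated by the relations is then an ideal.\<close>

definition tensor_relations ::
    "('k, 'l) ring_scheme \<Rightarrow> ('k \<Rightarrow> 'a) \<Rightarrow> ('a, 'm) ring_scheme \<Rightarrow>
     ('k \<Rightarrow> 'b) \<Rightarrow> ('b, 'n) ring_scheme \<Rightarrow> ('a \<times> 'b \<Rightarrow>\<^sub>0 int) set"
  where "tensor_relations k \<phi> R \<psi> S =
    {frag_of (r \<oplus>\<^bsub>R\<^esub> r', s) - frag_of (r, s) - frag_of (r', s) | r r' s.
       r \<in> carrier R \<and> r' \<in> carrier R \<and> s \<in> carrier S} \<union>
    {frag_of (r, s \<oplus>\<^bsub>S\<^esub> s') - frag_of (r, s) - frag_of (r, s') | r s s'.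
       r \<in> carrier R \<and> s \<in> carrier S \<and> s' \<in> carrier S} \<union>
    {frag_of (\<phi> c \<otimes>\<^bsub>R\<^esub> r, s) - frag_of (r, \<psi> c \<otimes>\<^bsub>S\<^esub> s) | c r s.
       c \<in> carrier k \<and> r \<in> carrier R \<and> s \<in> carrier S}"

definition tensor_ideal ::
    "('k, 'l) ring_scheme \<Rightarrow> ('k \<Rightarrow> 'a) \<Rightarrow> ('a, 'm) ring_scheme \<Rightarrow>
     ('k \<Rightarrow> 'b) \<Rightarrow> ('b, 'n) ring_scheme \<Rightarrow> ('a \<times> 'b \<Rightarrow>\<^sub>0 int) set"
  where "tensor_ideal k \<phi> R \<psi> S =
    Idl\<^bsub>monoid_ring (R \<times>\<times> S)\<^esub> (tensor_relations k \<phi> R \<psi> S)"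

definition tensor_class ::
    "('k, 'l) ring_scheme \<Rightarrow> ('k \<Rightarrow> 'a) \<Rightarrow> ('a, 'm) ring_scheme \<Rightarrow>
     ('k \<Rightarrow> 'b) \<Rightarrow> ('b, 'n) ring_scheme \<Rightarrow> ('a \<times> 'b \<Rightarrow>\<^sub>0 int) \<Rightarrow> ('a \<times> 'b \<Rightarrow>\<^sub>0 int) set"
  where "tensor_class k \<phi> R \<psi> S p =
    tensor_ideal k \<phi> R \<psi> S +>\<^bsub>monoid_ring (R \<times>\<times> S)\<^esub> p"

definition tensor_ring ::
    "('k, 'l) ring_scheme \<Rightarrow> ('k \<Rightarrow> 'a) \<Rightarrow> ('a, 'm) ring_scheme \<Rightarrow>
     ('k \<Rightarrow> 'b) \<Rightarrow> ('b, 'n) ring_scheme \<Rightarrow> ('a \<times> 'b \<Rightarrow>\<^sub>0 int) set ring"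
  where "tensor_ring k \<phi> R \<psi> S =
    monoid_ring (R \<times>\<times> S) Quot tensor_ideal k \<phi> R \<psi> S"

definition pure_tensor ::
    "('k, 'l) ring_scheme \<Rightarrow> ('k \<Rightarrow> 'a) \<Rightarrow> ('a, 'm) ring_scheme \<Rightarrow>
     ('k \<Rightarrow> 'b) \<Rightarrow> ('b, 'n) ring_scheme \<Rightarrow> 'a \<Rightarrow> 'b \<Rightarrow> ('a \<times> 'b \<Rightarrow>\<^sub>0 int) set"
  where "pure_tensor k \<phi> R \<psi> S r s = tensor_class k \<phi> R \<psi> S (frag_of (r, s))"

text \<open>The map \<open>r \<otimes> s \<mapsto> f r \<otimes> g s\<close>; the algebras \<open>R\<close>, \<open>S\<close> given here are those of the
  target. All representatives of a class in the source have the same image, so that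
  \<open>the_elem\<close> is applied to a singleton.\<close>

definition free_map :: "('a \<Rightarrow> 'c) \<Rightarrow> ('b \<Rightarrow> 'd) \<Rightarrow> ('a \<times> 'b \<Rightarrow>\<^sub>0 int) \<Rightarrow> ('c \<times> 'd \<Rightarrow>\<^sub>0 int)"
  where "free_map f g = frag_extend (\<lambda>(r, s). frag_of (f r, g s))"

definition tensor_map ::
    "('k, 'l) ring_scheme \<Rightarrow> ('k \<Rightarrow> 'c) \<Rightarrow> ('c, 'm) ring_scheme \<Rightarrow>
     ('k \<Rightarrow> 'd) \<Rightarrow> ('d, 'n) ring_scheme \<Rightarrow> ('a \<Rightarrow> 'c) \<Rightarrow> ('b \<Rightarrow> 'd) \<Rightarrow>
     ('a \<times> 'b \<Rightarrow>\<^sub>0 int) set \<Rightarrow> ('c \<times> 'd \<Rightarrow>\<^sub>0 int) set"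
  where "tensor_map k \<phi> R \<psi> S f g Z =
    the_elem ((\<lambda>p. tensor_class k \<phi> R \<psi> S (free_map f g p)) ` Z)"

definition tensor ::
    "('k, 'l) ring_scheme \<Rightarrow> ('k \<Rightarrow> 'a) \<Rightarrow> ('a, 'm) difference_ring_scheme \<Rightarrow>
     ('k \<Rightarrow> 'b) \<Rightarrow> ('b, 'n) difference_ring_scheme \<Rightarrow> ('a \<times> 'b \<Rightarrow>\<^sub>0 int) set difference_ring"
  where "tensor k \<phi> R \<psi> S =
    ring.extend (tensor_ring k \<phi> R \<psi> S)
      \<lparr>sig = tensor_map k \<phi> R \<psi> S (sig R) (sig S)\<rparr>"


section \<open>Strongly \<open>\<sigma>\<close>-etale algebras and the strong core\<close>

text \<open>HOL cannot quantify over the difference fields of all types. The type \<open>'k list\<close> is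
  infinite and at least as large as \<open>'k\<close>, so it has room for every extension of \<open>k\<close>
  generated by \<open>k\<close> and finitely many elements, which is all that matters:
  theorem \<open>difference_separable_extension\<close> below proves injectivity of \<open>\<sigma>\<close> for extensions of an
  arbitrary type.\<close>

definition difference_separable ::
    "('k, 'm) difference_ring_scheme \<Rightarrow> ('k \<Rightarrow> 'a) \<Rightarrow> ('a, 'n) difference_ring_scheme \<Rightarrow> bool"
  where "difference_separable k \<phi> R \<longleftrightarrow>
    (\<forall>(K :: 'k list difference_ring) \<iota>. difference_field_extension k \<iota> K \<longrightarrow>
       inj_on (sig (tensor k \<phi> R \<iota> K)) (carrier (tensor k \<phi> R \<iota> K)))"

text \<open>The algebraic closure of the library comes with the embedding \<open>indexed_const\<close> of \<open>k\<close>.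
  The isomorphism is one of algebras over the algebraic closure.\<close>

definition etale_algebra :: "('k, 'm) ring_scheme \<Rightarrow> ('k \<Rightarrow> 'a) \<Rightarrow> ('a, 'n) ring_scheme \<Rightarrow> bool"
  where "etale_algebra k \<phi> R \<longleftrightarrow>
    (let L = field.alg_closure k; \<epsilon> = ring.indexed_const k in
     \<exists>n h. h \<in> ring_iso (tensor_ring k \<phi> R \<epsilon> L) (RDirProd_list (replicate n L)) \<and>
       (\<forall>a\<in>carrier L. h (pure_tensor k \<phi> R \<epsilon> L \<one>\<^bsub>R\<^esub> a) = replicate n a))"

definition strongly_etale ::
    "('k, 'm) difference_ring_scheme \<Rightarrow> ('k \<Rightarrow> 'a) \<Rightarrow> ('a, 'n) difference_ring_scheme \<Rightarrow> bool"
  where "strongly_etale k \<phi> R \<longleftrightarrow> difference_separable k \<phi> R \<and> etale_algebra k \<phi> R"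

definition strong_core ::
    "('k, 'm) difference_ring_scheme \<Rightarrow> ('k \<Rightarrow> 'a) \<Rightarrow> ('a, 'n) difference_ring_scheme \<Rightarrow> 'a set"
  where "strong_core k \<phi> R =
    \<Union>{A. difference_subalgebra A k \<phi> R \<and> strongly_etale k \<phi> (R\<lparr>carrier := A\<rparr>)}"


section \<open>The tensor product as a quotient ring\<close>

lemma monoid_ring_simps [simp]:
  "carrier (monoid_ring M) = {p. Poly_Mapping.keys p \<subseteq> carrier M}"
  "\<zero>\<^bsub>monoid_ring M\<^esub> = 0"
  "\<one>\<^bsub>monoid_ring M\<^esub> = frag_of \<one>\<^bsub>M\<^esub>"
  "p \<oplus>\<^bsub>monoid_ring M\<^esub> q = p + q"
  "p \<otimes>\<^bsub>monoid_ring M\<^esub> q = frag_extend (\<lambda>x. frag_extend (\<lambda>y. frag_of (x \<otimes>\<^bsub>M\<^esub> y)) q) p"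
  by (simp_all add: monoid_ring_def)

lemma frag_extend_plus_fun:
  "frag_extend (\<lambda>x. f x + g x) p = frag_extend f p + frag_extend g p"
  by (simp add: frag_extend_def frag_cmul_distrib2 sum.distrib)

lemma frag_cmul_diff_distrib2: "frag_cmul c (a - b) = frag_cmul c a - frag_cmul c b"
  by (rule poly_mapping_eqI) (simp add: lookup_minus algebra_simps)

lemma frag_extend_minus_fun:
  "frag_extend (\<lambda>x. f x - g x) p = frag_extend f p - frag_extend g p"
  by (simp add: frag_extend_def frag_cmul_diff_distrib2 sum_subtractf)

lemma monoid_ring_mult_closed:
  assumes "monoid M" "Poly_Mapping.keys p \<subseteq> carrier M" "Poly_Mapping.keys q \<subseteq> carrier M"
  shows "Poly_Mapping.keys (p \<otimes>\<^bsub>monoid_ring M\<^esub> q) \<subseteq> carrier M"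
proof -
  interpret monoid M by fact
  have "Poly_Mapping.keys (frag_extend (\<lambda>y. frag_of (x \<otimes>\<^bsub>M\<^esub> y)) q) \<subseteq> carrier M" if "x \<in> carrier M" for x
    using keys_frag_extend[of "\<lambda>y. frag_of (x \<otimes>\<^bsub>M\<^esub> y)" q] that assms(3) by (force simp: keys_frag_of)
  then show ?thesis
    using keys_frag_extend[of "\<lambda>x. frag_extend (\<lambda>y. frag_of (x \<otimes>\<^bsub>M\<^esub> y)) q" p] assms(2) by (simp) blast
qed

lemma monoid_ring_cring:
  fixes M (structure)
  assumes "comm_monoid M"
  shows "cring (monoid_ring M)"
proof -
  interpret comm_monoid M by fact
  let ?Z = "monoid_ring M"
  have mm: "monoid M" by unfold_locales
  have ld: "(a + b) \<otimes>\<^bsub>?Z\<^esub> c = a \<otimes>\<^bsub>?Z\<^esub> c + b \<otimes>\<^bsub>?Z\<^esub> c" 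
       "(a - b) \<otimes>\<^bsub>?Z\<^esub> c = a \<otimes>\<^bsub>?Z\<^esub> c - b \<otimes>\<^bsub>?Z\<^esub> c"
       "c \<otimes>\<^bsub>?Z\<^esub> (a - b) = c \<otimes>\<^bsub>?Z\<^esub> a - c \<otimes>\<^bsub>?Z\<^esub> b"
       "0 \<otimes>\<^bsub>?Z\<^esub> c = 0" "c \<otimes>\<^bsub>?Z\<^esub> 0 = 0" for a b c
    by (simp_all add: frag_extend_add frag_extend_diff frag_extend_minus_fun frag_extend_eq_0)
  have of: "frag_of a \<otimes>\<^bsub>?Z\<^esub> frag_of b = frag_of (a \<otimes> b)" for a b by simp
  have comm: "a \<otimes>\<^bsub>?Z\<^esub> b = b \<otimes>\<^bsub>?Z\<^esub> a" if "Poly_Mapping.keys a \<subseteq> carrier M" "Poly_Mapping.keys b \<subseteq> carrier M" for a b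
    using that(1)
  proof (induction a rule: frag_induction)
    case (one x)
    show ?case using that(2)
      by (induction b rule: frag_induction) (use one in \<open>simp_all only: ld of m_comm\<close>)
  qed (simp_all only: ld)
  have assoc1: "(a \<otimes>\<^bsub>?Z\<^esub> b) \<otimes>\<^bsub>?Z\<^esub> c = a \<otimes>\<^bsub>?Z\<^esub> (b \<otimes>\<^bsub>?Z\<^esub> c)"
    if "Poly_Mapping.keys a \<subseteq> carrier M" "Poly_Mapping.keys b \<subseteq> carrier M" "Poly_Mapping.keys c \<subseteq> carrier M" for a b c
    using that(1)
  proof (induction a rule: frag_induction)
    case (one x)
    show ?case using that(2)
    proof (induction b rule: frag_induction)
      case (one y)
      show ?case using that(3)
        by (induction c rule: frag_induction) (use one \<open>x \<in> carrier M\<close> in \<open>simp_all only: ld of m_assoc\<close>)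
    qed (simp_all only: ld)
  qed (simp_all only: ld)
  have one: "frag_of \<one> \<otimes>\<^bsub>?Z\<^esub> a = a" if "Poly_Mapping.keys a \<subseteq> carrier M" for a
    using that by (induction a rule: frag_induction) (simp_all only: ld of l_one)
  show ?thesis
  proof (rule cringI)
    show "abelian_group ?Z"
    proof (rule abelian_groupI)
      fix x assume "x \<in> carrier ?Z"
      then show "\<exists>y\<in>carrier ?Z. y \<oplus>\<^bsub>?Z\<^esub> x = \<zero>\<^bsub>?Z\<^esub>"
        by (intro bexI[of _ "- x"]) auto
    next
      fix x y assume "x \<in> carrier ?Z" "y \<in> carrier ?Z"
      then show "x \<oplus>\<^bsub>?Z\<^esub> y \<in> carrier ?Z" using Poly_Mapping.keys_add[of x y] by auto
    qed (auto simp: add_ac)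
    show "comm_monoid ?Z"
    proof (rule comm_monoidI)
      fix x y assume "x \<in> carrier ?Z" "y \<in> carrier ?Z"
      then show "x \<otimes>\<^bsub>?Z\<^esub> y \<in> carrier ?Z" using monoid_ring_mult_closed[OF mm, of x y] by simp
    next
      show "\<one>\<^bsub>?Z\<^esub> \<in> carrier ?Z" by (simp add: keys_frag_of)
    next
      fix x y z assume "x \<in> carrier ?Z" "y \<in> carrier ?Z" "z \<in> carrier ?Z"
      then show "x \<otimes>\<^bsub>?Z\<^esub> y \<otimes>\<^bsub>?Z\<^esub> z = x \<otimes>\<^bsub>?Z\<^esub> (y \<otimes>\<^bsub>?Z\<^esub> z)" using assoc1[of x y z] by simp
    next
      fix x assume "x \<in> carrier ?Z"
      then show "\<one>\<^bsub>?Z\<^esub> \<otimes>\<^bsub>?Z\<^esub> x = x" using one[of x] by simp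
    next
      fix x y assume "x \<in> carrier ?Z" "y \<in> carrier ?Z"
      then show "x \<otimes>\<^bsub>?Z\<^esub> y = y \<otimes>\<^bsub>?Z\<^esub> x" using comm[of x y] by simp
    qed
    fix x y z
    show "(x \<oplus>\<^bsub>?Z\<^esub> y) \<otimes>\<^bsub>?Z\<^esub> z = x \<otimes>\<^bsub>?Z\<^esub> z \<oplus>\<^bsub>?Z\<^esub> y \<otimes>\<^bsub>?Z\<^esub> z"
      using ld(1)[of x y z] by simp
  qed
qed

lemma DirProd_comm_monoid:
  assumes "cring R" "cring S"
  shows "comm_monoid (R \<times>\<times> S)"
proof -
  interpret R: cring R by fact
  interpret S: cring S by fact
  show ?thesis
    by (rule comm_monoidI) (auto simp: R.m_ac S.m_ac)
qed

lemma free_cring: "cring R \<Longrightarrow> cring S \<Longrightarrow> cring (monoid_ring (R \<times>\<times> S))"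
  by (intro monoid_ring_cring DirProd_comm_monoid)

lemma tensor_relationsI:
  "r \<in> carrier R \<Longrightarrow> r' \<in> carrier R \<Longrightarrow> s \<in> carrier S \<Longrightarrow>
    frag_of (r \<oplus>\<^bsub>R\<^esub> r', s) - frag_of (r, s) - frag_of (r', s) \<in> tensor_relations k \<phi> R \<psi> S"
  "r \<in> carrier R \<Longrightarrow> s \<in> carrier S \<Longrightarrow> s' \<in> carrier S \<Longrightarrow>
    frag_of (r, s \<oplus>\<^bsub>S\<^esub> s') - frag_of (r, s) - frag_of (r, s') \<in> tensor_relations k \<phi> R \<psi> S"
  "c \<in> carrier k \<Longrightarrow> r \<in> carrier R \<Longrightarrow> s \<in> carrier S \<Longrightarrow>
    frag_of (\<phi> c \<otimes>\<^bsub>R\<^esub> r, s) - frag_of (r, \<psi> c \<otimes>\<^bsub>S\<^esub> s) \<in> tensor_relations k \<phi> R \<psi> S"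
  unfolding tensor_relations_def by (rule UnI1, rule UnI1, blast, rule UnI1, rule UnI2, blast, rule UnI2, blast)

lemma tensor_relations_carrier:
  assumes "cring R" "cring S" "\<phi> \<in> ring_hom k R" "\<psi> \<in> ring_hom k S"
  shows "tensor_relations k \<phi> R \<psi> S \<subseteq> carrier (monoid_ring (R \<times>\<times> S))"
proof -
  interpret R: cring R by fact
  interpret S: cring S by fact
  show ?thesis
    using ring_hom_closed[OF assms(3)] ring_hom_closed[OF assms(4)]
    unfolding tensor_relations_def
    by (auto dest!: subsetD[OF keys_diff] simp: keys_frag_of)
qed

lemma tensor_ideal_ideal:
  assumes "cring R" "cring S" "\<phi> \<in> ring_hom k R" "\<psi> \<in> ring_hom k S"
  shows "ideal (tensor_ideal k \<phi> R \<psi> S) (monoid_ring (R \<times>\<times> S))"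
proof -
  interpret Z: cring "monoid_ring (R \<times>\<times> S)" using free_cring assms by blast
  show ?thesis
    unfolding tensor_ideal_def using Z.genideal_ideal tensor_relations_carrier[OF assms] by blast
qed

lemma tensor_relations_ideal:
  assumes "cring R" "cring S" "\<phi> \<in> ring_hom k R" "\<psi> \<in> ring_hom k S"
  shows "tensor_relations k \<phi> R \<psi> S \<subseteq> tensor_ideal k \<phi> R \<psi> S"
proof -
  interpret Z: cring "monoid_ring (R \<times>\<times> S)" using free_cring assms by blast
  show ?thesis
    unfolding tensor_ideal_def using Z.genideal_self tensor_relations_carrier[OF assms] by blast
qed

lemma tensor_ring_cring:
  assumes "cring R" "cring S" "\<phi> \<in> ring_hom k R" "\<psi> \<in> ring_hom k S"
  shows "cring (tensor_ring k \<phi> R \<psi> S)"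
  unfolding tensor_ring_def
  using ideal.quotient_is_cring[OF tensor_ideal_ideal[OF assms]] free_cring assms by blast

lemma free_map_simps [simp]:
  "free_map f g (frag_of (r, s)) = frag_of (f r, g s)"
  "free_map f g (p + q) = free_map f g p + free_map f g q"
  "free_map f g (p - q) = free_map f g p - free_map f g q"
  "free_map f g 0 = 0"
  by (simp_all add: free_map_def frag_extend_add frag_extend_diff)

lemma free_map_keys:
  "Poly_Mapping.keys (free_map f g p) \<subseteq> (\<lambda>(r, s). (f r, g s)) ` Poly_Mapping.keys p"
  unfolding free_map_def
  by (rule order_trans[OF keys_frag_extend]) (auto simp: keys_frag_of)

lemma free_map_hom:
  assumes "cring R" "cring S" "f \<in> ring_hom R R'" "g \<in> ring_hom S S'"
  shows "free_map f g \<in> ring_hom (monoid_ring (R \<times>\<times> S)) (monoid_ring (R' \<times>\<times> S'))"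
proof -
  interpret Z: cring "monoid_ring (R \<times>\<times> S)" using free_cring assms by blast
  show ?thesis
  proof (rule ring_hom_memI)
    fix x assume "x \<in> carrier (monoid_ring (R \<times>\<times> S))"
    then show "free_map f g x \<in> carrier (monoid_ring (R' \<times>\<times> S'))"
      using free_map_keys[of f g x] ring_hom_closed[OF assms(3)] ring_hom_closed[OF assms(4)] by (force)
  next
    fix x y assume x: "x \<in> carrier (monoid_ring (R \<times>\<times> S))" and y: "y \<in> carrier (monoid_ring (R \<times>\<times> S))"
    let ?m = "\<lambda>x y. x \<otimes>\<^bsub>monoid_ring (R \<times>\<times> S)\<^esub> y"
    let ?m' = "\<lambda>x y. x \<otimes>\<^bsub>monoid_ring (R' \<times>\<times> S')\<^esub> y"
    have ld: "?m (a - b) c = ?m a c - ?m b c" "?m c (a - b) = ?m c a - ?m c b"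
       "?m 0 c = 0" "?m c 0 = 0" for a b c
      by (simp_all add: frag_extend_add frag_extend_diff frag_extend_minus_fun frag_extend_eq_0)
    have ld': "?m' (a - b) c = ?m' a c - ?m' b c" "?m' c (a - b) = ?m' c a - ?m' c b"
       "?m' 0 c = 0" "?m' c 0 = 0" for a b c
      by (simp_all add: frag_extend_add frag_extend_diff frag_extend_minus_fun frag_extend_eq_0)
    have y': "Poly_Mapping.keys y \<subseteq> carrier R \<times> carrier S" using y by simp
    have "Poly_Mapping.keys x \<subseteq> carrier R \<times> carrier S" using x by simp
    then show "free_map f g (?m x y) = ?m' (free_map f g x) (free_map f g y)"
    proof (induction x rule: frag_induction)
      case (one a)
      show ?case using y'
      proof (induction y rule: frag_induction)
        case (one b)
        then show ?case using \<open>a \<in> _\<close>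
          by (cases a; cases b) (simp add: ring_hom_mult[OF assms(3)] ring_hom_mult[OF assms(4)])
      qed (simp_all only: ld ld' free_map_simps)
    qed (simp_all only: ld ld' free_map_simps)
  next
    show "free_map f g \<one>\<^bsub>monoid_ring (R \<times>\<times> S)\<^esub> = \<one>\<^bsub>monoid_ring (R' \<times>\<times> S')\<^esub>"
      using ring_hom_one[OF assms(3)] ring_hom_one[OF assms(4)] by simp
  qed simp
qed

text \<open>\<open>f\<close> and \<open>g\<close> are semilinear over \<open>\<tau>\<close>.\<close>

lemma free_map_ideal:
  assumes "cring R" "cring S" "\<phi> \<in> ring_hom k R" "\<psi> \<in> ring_hom k S"
    and "cring R'" "cring S'" "\<phi>' \<in> ring_hom k' R'" "\<psi>' \<in> ring_hom k' S'"
    and f: "f \<in> ring_hom R R'" and g: "g \<in> ring_hom S S'"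
    and t: "\<And>c. c \<in> carrier k \<Longrightarrow> \<tau> c \<in> carrier k'"
      "\<And>c. c \<in> carrier k \<Longrightarrow> f (\<phi> c) = \<phi>' (\<tau> c)"
      "\<And>c. c \<in> carrier k \<Longrightarrow> g (\<psi> c) = \<psi>' (\<tau> c)"
    and p: "p \<in> tensor_ideal k \<phi> R \<psi> S"
  shows "free_map f g p \<in> tensor_ideal k' \<phi>' R' \<psi>' S'"
proof -
  let ?Z = "monoid_ring (R \<times>\<times> S)" and ?Z' = "monoid_ring (R' \<times>\<times> S')"
  interpret Z: cring ?Z using free_cring assms by blast
  interpret Z': cring ?Z' using free_cring assms by blast
  interpret h: ring_hom_ring ?Z ?Z' "free_map f g"
    using free_map_hom[OF assms(1,2) f g] by (intro ring_hom_ringI2) unfold_locales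
  let ?I' = "tensor_ideal k' \<phi>' R' \<psi>' S'"
  have I': "ideal ?I' ?Z'" using tensor_ideal_ideal assms by blast
  have rel: "tensor_relations k' \<phi>' R' \<psi>' S' \<subseteq> ?I'" using tensor_relations_ideal assms by blast
  let ?J = "{r \<in> carrier ?Z. free_map f g r \<in> ?I'}"
  have "ideal ?J ?Z" by (rule h.ideal_vimage[OF I'])
  moreover have "free_map f g x \<in> tensor_relations k' \<phi>' R' \<psi>' S'"
    if "x \<in> tensor_relations k \<phi> R \<psi> S" for x
  proof -
    from that consider
      r r' s where "x = frag_of (r \<oplus>\<^bsub>R\<^esub> r', s) - frag_of (r, s) - frag_of (r', s)" 
        "r \<in> carrier R" "r' \<in> carrier R" "s \<in> carrier S"
    | r s s' where "x = frag_of (r, s \<oplus>\<^bsub>S\<^esub> s') - frag_of (r, s) - frag_of (r, s')" 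
        "r \<in> carrier R" "s \<in> carrier S" "s' \<in> carrier S"
    | c r s where "x = frag_of (\<phi> c \<otimes>\<^bsub>R\<^esub> r, s) - frag_of (r, \<psi> c \<otimes>\<^bsub>S\<^esub> s)"
        "c \<in> carrier k" "r \<in> carrier R" "s \<in> carrier S"
      unfolding tensor_relations_def by blast
    then show ?thesis
    proof cases
      case 1
      then have "free_map f g x = frag_of (f r \<oplus>\<^bsub>R'\<^esub> f r', g s) - frag_of (f r, g s) - frag_of (f r', g s)"
        by (simp add: ring_hom_add[OF f])
      then show ?thesis
        using tensor_relationsI(1)[OF ring_hom_closed[OF f 1(2)] ring_hom_closed[OF f 1(3)]
            ring_hom_closed[OF g 1(4)]] by (simp only:)
    next
      case 2
      then have "free_map f g x = frag_of (f r, g s \<oplus>\<^bsub>S'\<^esub> g s') - frag_of (f r, g s) - frag_of (f r, g s')"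
        by (simp add: ring_hom_add[OF g])
      then show ?thesis
        using tensor_relationsI(2)[OF ring_hom_closed[OF f 2(2)] ring_hom_closed[OF g 2(3)]
            ring_hom_closed[OF g 2(4)]] by (simp only:)
    next
      case 3
      then have "free_map f g x =
          frag_of (\<phi>' (\<tau> c) \<otimes>\<^bsub>R'\<^esub> f r, g s) - frag_of (f r, \<psi>' (\<tau> c) \<otimes>\<^bsub>S'\<^esub> g s)"
        using ring_hom_mult[OF f ring_hom_closed[OF assms(3)], of c r]
          ring_hom_mult[OF g ring_hom_closed[OF assms(4)], of c s] t(2,3)[of c] by simp
      then show ?thesis
        using tensor_relationsI(3)[OF t(1)[OF 3(2)] ring_hom_closed[OF f 3(3)]
            ring_hom_closed[OF g 3(4)]] by (simp only:)
    qed
  qed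
  ultimately have "tensor_ideal k \<phi> R \<psi> S \<subseteq> ?J"
    unfolding tensor_ideal_def[of k \<phi> R]
    using Z.genideal_minimal[of ?J "tensor_relations k \<phi> R \<psi> S"] rel
      tensor_relations_carrier[OF assms(1-4)] by blast
  then show ?thesis using p by blast
qed

lemma tensor_class_eq_iff:
  assumes "cring R" "cring S" "\<phi> \<in> ring_hom k R" "\<psi> \<in> ring_hom k S"
    and "Poly_Mapping.keys p \<subseteq> carrier R \<times> carrier S" "Poly_Mapping.keys q \<subseteq> carrier R \<times> carrier S"
  shows "tensor_class k \<phi> R \<psi> S p = tensor_class k \<phi> R \<psi> S q \<longleftrightarrow> p - q \<in> tensor_ideal k \<phi> R \<psi> S"
proof -
  interpret Z: cring "monoid_ring (R \<times>\<times> S)" using free_cring assms by blast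
  interpret I: ideal "tensor_ideal k \<phi> R \<psi> S" "monoid_ring (R \<times>\<times> S)"
    using tensor_ideal_ideal assms by blast
  have carr: "p \<in> carrier (monoid_ring (R \<times>\<times> S))" "q \<in> carrier (monoid_ring (R \<times>\<times> S))"
    using assms by auto
  have m: "p \<ominus>\<^bsub>monoid_ring (R \<times>\<times> S)\<^esub> q = p - q"
  proof -
    have "\<ominus>\<^bsub>monoid_ring (R \<times>\<times> S)\<^esub> q = - q"
      using carr(2) by (intro Z.minus_equality) auto
    then show ?thesis by (simp add: a_minus_def)
  qed
  show ?thesis unfolding tensor_class_def m[symmetric]
    using Z.quotient_eq_iff_same_a_r_cos[OF I.ideal_axioms carr] by blast
qed

lemma tensor_carrier:
  "carrier (tensor_ring k \<phi> R \<psi> S) = tensor_class k \<phi> R \<psi> S ` {p. Poly_Mapping.keys p \<subseteq> carrier R \<times> carrier S}"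
  "carrier (tensor k \<phi> R' \<psi> S') = carrier (tensor_ring k \<phi> R' \<psi> S')"
  by (auto simp: tensor_def ring.defs tensor_ring_def FactRing_def A_RCOSETS_def' tensor_class_def)

lemma tensor_class_elem:
  assumes "cring R" "cring S" "\<phi> \<in> ring_hom k R" "\<psi> \<in> ring_hom k S"
    and "Poly_Mapping.keys p \<subseteq> carrier R \<times> carrier S"
  shows "q \<in> tensor_class k \<phi> R \<psi> S p \<longleftrightarrow>
    Poly_Mapping.keys q \<subseteq> carrier R \<times> carrier S \<and> q - p \<in> tensor_ideal k \<phi> R \<psi> S"
proof -
  interpret Z: cring "monoid_ring (R \<times>\<times> S)" using free_cring assms by blast
  interpret I: ideal "tensor_ideal k \<phi> R \<psi> S" "monoid_ring (R \<times>\<times> S)"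
    using tensor_ideal_ideal assms by blast
  have p: "p \<in> carrier (monoid_ring (R \<times>\<times> S))" using assms by simp
  show ?thesis
  proof
    assume "q \<in> tensor_class k \<phi> R \<psi> S p"
    then obtain i where i: "i \<in> tensor_ideal k \<phi> R \<psi> S" "q = i + p"
      unfolding tensor_class_def a_r_coset_def' by auto
    moreover have "i \<in> carrier (monoid_ring (R \<times>\<times> S))" using i I.Icarr by blast
    ultimately show "Poly_Mapping.keys q \<subseteq> carrier R \<times> carrier S \<and> q - p \<in> tensor_ideal k \<phi> R \<psi> S"
      using Z.a_closed[of i p] p by simp
  next
    assume a: "Poly_Mapping.keys q \<subseteq> carrier R \<times> carrier S \<and> q - p \<in> tensor_ideal k \<phi> R \<psi> S"
    then show "q \<in> tensor_class k \<phi> R \<psi> S p"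
      unfolding tensor_class_def a_r_coset_def' by (auto intro!: bexI[of _ "q - p"])
  qed
qed

lemma tensor_map_class:
  assumes "cring R" "cring S" "\<phi> \<in> ring_hom k R" "\<psi> \<in> ring_hom k S"
    and "cring R'" "cring S'" "\<phi>' \<in> ring_hom k' R'" "\<psi>' \<in> ring_hom k' S'"
    and f: "f \<in> ring_hom R R'" and g: "g \<in> ring_hom S S'"
    and t: "\<And>c. c \<in> carrier k \<Longrightarrow> \<tau> c \<in> carrier k'"
      "\<And>c. c \<in> carrier k \<Longrightarrow> f (\<phi> c) = \<phi>' (\<tau> c)"
      "\<And>c. c \<in> carrier k \<Longrightarrow> g (\<psi> c) = \<psi>' (\<tau> c)"
    and p: "Poly_Mapping.keys p \<subseteq> carrier R \<times> carrier S"
  shows "tensor_map k' \<phi>' R' \<psi>' S' f g (tensor_class k \<phi> R \<psi> S p) =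
    tensor_class k' \<phi>' R' \<psi>' S' (free_map f g p)"
proof -
  have carr: "Poly_Mapping.keys (free_map f g q) \<subseteq> carrier R' \<times> carrier S'" if "Poly_Mapping.keys q \<subseteq> carrier R \<times> carrier S" for q
    using ring_hom_closed[OF free_map_hom[OF assms(1,2) f g], of q] that by simp
  have "tensor_class k' \<phi>' R' \<psi>' S' (free_map f g q) = tensor_class k' \<phi>' R' \<psi>' S' (free_map f g p)"
    if "q \<in> tensor_class k \<phi> R \<psi> S p" for q
  proof -
    have q: "Poly_Mapping.keys q \<subseteq> carrier R \<times> carrier S" "q - p \<in> tensor_ideal k \<phi> R \<psi> S"
      using that tensor_class_elem[OF assms(1-4) p] by auto
    have "free_map f g (q - p) \<in> tensor_ideal k' \<phi>' R' \<psi>' S'"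
      using free_map_ideal[OF assms(1-10) t q(2)] .
    then show ?thesis
      using tensor_class_eq_iff[OF assms(5-8) carr[OF q(1)] carr[OF p]] by simp
  qed
  moreover have "p \<in> tensor_class k \<phi> R \<psi> S p"
  proof -
    interpret I: ideal "tensor_ideal k \<phi> R \<psi> S" "monoid_ring (R \<times>\<times> S)"
      using tensor_ideal_ideal assms by blast
    show ?thesis using tensor_class_elem[OF assms(1-4) p] p additive_subgroup.zero_closed[OF I.additive_subgroup_axioms] by simp
  qed
  ultimately have "(\<lambda>q. tensor_class k' \<phi>' R' \<psi>' S' (free_map f g q)) ` tensor_class k \<phi> R \<psi> S p
      = {tensor_class k' \<phi>' R' \<psi>' S' (free_map f g p)}"
    by blast
  then show ?thesis unfolding tensor_map_def by simp
qed

lemma difference_algebraD: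
  assumes "difference_algebra k \<phi> R"
  shows "cring k" "cring R" "\<phi> \<in> ring_hom k R" "sig R \<in> ring_hom R R"
    "\<And>c. c \<in> carrier k \<Longrightarrow> sig R (\<phi> c) = \<phi> (sig k c)"
    "\<And>c. c \<in> carrier k \<Longrightarrow> sig k c \<in> carrier k"
  using assms unfolding difference_algebra_def difference_field_def difference_ring_def
    difference_ring_axioms_def
  by (auto intro: ring_hom_closed)

lemma sig_tensor:
  assumes R: "difference_algebra k \<phi> R" and S: "difference_algebra k \<psi> S"
    and "Poly_Mapping.keys p \<subseteq> carrier R \<times> carrier S"
  shows "sig (tensor k \<phi> R \<psi> S) (tensor_class k \<phi> R \<psi> S p) =
    tensor_class k \<phi> R \<psi> S (free_map (sig R) (sig S) p)"
proof -
  note * = difference_algebraD[OF R] difference_algebraD[OF S]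
  show ?thesis
    unfolding tensor_def ring.defs
    using tensor_map_class[OF *(2,8,3,9) *(2,8,3,9) *(4,10) *(6,5,11) assms(3)] by simp
qed

lemma inj_sig_tensor_iff:
  assumes R: "difference_algebra k \<phi> R" and S: "difference_algebra k \<psi> S"
  shows "inj_on (sig (tensor k \<phi> R \<psi> S)) (carrier (tensor k \<phi> R \<psi> S)) \<longleftrightarrow>
    (\<forall>p. Poly_Mapping.keys p \<subseteq> carrier R \<times> carrier S \<longrightarrow>
       free_map (sig R) (sig S) p \<in> tensor_ideal k \<phi> R \<psi> S \<longrightarrow> p \<in> tensor_ideal k \<phi> R \<psi> S)"
    (is "?L \<longleftrightarrow> ?Q")
proof -
  note * = difference_algebraD[OF R] difference_algebraD[OF S]
  note hyps = *(2,8,3,9)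
  let ?C = "carrier R \<times> carrier S"
  have carr: "Poly_Mapping.keys (free_map (sig R) (sig S) q) \<subseteq> ?C" if "Poly_Mapping.keys q \<subseteq> ?C" for q
    using ring_hom_closed[OF free_map_hom[OF *(2,8) *(4,10)], of q] that by simp
  note eq = tensor_class_eq_iff[OF hyps]
  show ?thesis
  proof
    assume L: ?L
    show ?Q
    proof (intro allI impI)
      fix p assume p: "Poly_Mapping.keys p \<subseteq> ?C" and fp: "free_map (sig R) (sig S) p \<in> tensor_ideal k \<phi> R \<psi> S"
      have z: "Poly_Mapping.keys 0 \<subseteq> ?C" by simp
      have "tensor_class k \<phi> R \<psi> S p = tensor_class k \<phi> R \<psi> S 0"
      proof (rule inj_onD[OF L])
        show "sig (tensor k \<phi> R \<psi> S) (tensor_class k \<phi> R \<psi> S p) =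
          sig (tensor k \<phi> R \<psi> S) (tensor_class k \<phi> R \<psi> S 0)"
          unfolding sig_tensor[OF R S p] sig_tensor[OF R S z] eq[OF carr[OF p] carr[OF z]]
          using fp by simp
      qed (use p in \<open>auto simp: tensor_carrier\<close>)
      then show "p \<in> tensor_ideal k \<phi> R \<psi> S" using eq[OF p z] by simp
    qed
  next
    assume Q: ?Q
    show ?L
    proof (rule inj_onI)
      fix x y assume "x \<in> carrier (tensor k \<phi> R \<psi> S)" "y \<in> carrier (tensor k \<phi> R \<psi> S)"
        and xy: "sig (tensor k \<phi> R \<psi> S) x = sig (tensor k \<phi> R \<psi> S) y"
      then obtain p q where p: "Poly_Mapping.keys p \<subseteq> ?C" "x = tensor_class k \<phi> R \<psi> S p"
        and q: "Poly_Mapping.keys q \<subseteq> ?C" "y = tensor_class k \<phi> R \<psi> S q"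
        by (auto simp: tensor_carrier)
      have "Poly_Mapping.keys (p - q) \<subseteq> ?C" using p q keys_diff[of p q] by blast
      moreover have "free_map (sig R) (sig S) (p - q) \<in> tensor_ideal k \<phi> R \<psi> S"
        using xy unfolding p(2) q(2) sig_tensor[OF R S p(1)] sig_tensor[OF R S q(1)]
          eq[OF carr[OF p(1)] carr[OF q(1)]] by simp
      ultimately show "x = y" using Q eq[OF p(1) q(1)] p(2) q(2) by blast
    qed
  qed
qed


section \<open>Separability is independent of the type of the extension\<close>

lemma monoid_ring_carrier_update:
  "monoid_ring (R \<times>\<times> (K\<lparr>carrier := T\<rparr>)) = (monoid_ring (R \<times>\<times> K))\<lparr>carrier := {p. Poly_Mapping.keys p \<subseteq> carrier R \<times> T}\<rparr>"
  by (simp add: monoid_ring_def DirProd_def)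

text \<open>Membership in the ideal of relations involves only finitely many elements of \<open>K\<close>.\<close>

lemma tensor_ideal_finitary:
  assumes R: "cring R" and K: "cring K" and \<phi>: "\<phi> \<in> ring_hom k R" and \<iota>: "\<iota> \<in> ring_hom k K"
    and p: "p \<in> tensor_ideal k \<phi> R \<iota> K"
  shows "\<exists>F. finite F \<and> F \<subseteq> carrier K \<and>
    (\<forall>T. subring T K \<longrightarrow> \<iota> ` carrier k \<subseteq> T \<longrightarrow> F \<subseteq> T \<longrightarrow> p \<in> tensor_ideal k \<phi> R \<iota> (K\<lparr>carrier := T\<rparr>))"
proof -
  interpret R: cring R by fact
  interpret K: cring K by fact
  let ?Z = "monoid_ring (R \<times>\<times> K)"
  interpret Z: cring ?Z using free_cring assms by blast
  define D where "D F p \<longleftrightarrow> (\<forall>T. subring T K \<longrightarrow> \<iota> ` carrier k \<subseteq> T \<longrightarrow> F \<subseteq> T \<longrightarrow>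
      p \<in> tensor_ideal k \<phi> R \<iota> (K\<lparr>carrier := T\<rparr>))" for F p
  have ID: "ideal (tensor_ideal k \<phi> R \<iota> (K\<lparr>carrier := T\<rparr>)) (monoid_ring (R \<times>\<times> K\<lparr>carrier := T\<rparr>))"
      "tensor_relations k \<phi> R \<iota> (K\<lparr>carrier := T\<rparr>) \<subseteq> tensor_ideal k \<phi> R \<iota> (K\<lparr>carrier := T\<rparr>)"
    if "subring T K" "\<iota> ` carrier k \<subseteq> T" for T
  proof -
    have "cring (K\<lparr>carrier := T\<rparr>)"
      using K.subcringI'[OF that(1)] K.subcring_iff subringE(1)[OF that(1)] by blast
    moreover have "\<iota> \<in> ring_hom k (K\<lparr>carrier := T\<rparr>)"
      using \<iota> that(2) by (auto simp: ring_hom_def)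
    ultimately show "ideal (tensor_ideal k \<phi> R \<iota> (K\<lparr>carrier := T\<rparr>)) (monoid_ring (R \<times>\<times> K\<lparr>carrier := T\<rparr>))"
      "tensor_relations k \<phi> R \<iota> (K\<lparr>carrier := T\<rparr>) \<subseteq> tensor_ideal k \<phi> R \<iota> (K\<lparr>carrier := T\<rparr>)"
      using tensor_ideal_ideal tensor_relations_ideal R \<phi> by blast+
  qed
  have D_mono: "D F p \<Longrightarrow> F \<subseteq> F' \<Longrightarrow> D F' p" for F F' p unfolding D_def by blast
  have D0: "D {} 0"
    unfolding D_def using additive_subgroup.zero_closed[OF ideal.axioms(1)[OF ID(1)]] by simp
  have Dadd: "D F (p + q)" if "D F p" "D F q" for F p q
    unfolding D_def
  proof (intro allI impI)
    fix T assume T: "subring T K" "\<iota> ` carrier k \<subseteq> T" "F \<subseteq> T"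
    show "p + q \<in> tensor_ideal k \<phi> R \<iota> (K\<lparr>carrier := T\<rparr>)"
      using additive_subgroup.a_closed[OF ideal.axioms(1)[OF ID(1)[OF T(1,2)]], of p q] that T
      unfolding D_def by simp
  qed
  have Dmult: "D (F \<union> snd ` Poly_Mapping.keys x) (x \<otimes>\<^bsub>?Z\<^esub> p)" if "D F p" "x \<in> carrier ?Z" for F x p
    unfolding D_def
  proof (intro allI impI)
    fix T assume T: "subring T K" "\<iota> ` carrier k \<subseteq> T" "F \<union> snd ` Poly_Mapping.keys x \<subseteq> T"
    have "x \<in> carrier (monoid_ring (R \<times>\<times> K\<lparr>carrier := T\<rparr>))"
      using that(2) T(3) by (force)
    moreover have "p \<in> tensor_ideal k \<phi> R \<iota> (K\<lparr>carrier := T\<rparr>)" using that(1) T unfolding D_def by blast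
    ultimately have "x \<otimes>\<^bsub>monoid_ring (R \<times>\<times> K\<lparr>carrier := T\<rparr>)\<^esub> p \<in> tensor_ideal k \<phi> R \<iota> (K\<lparr>carrier := T\<rparr>)"
      using ideal.I_l_closed[OF ID(1)[OF T(1,2)]] by blast
    then show "x \<otimes>\<^bsub>?Z\<^esub> p \<in> tensor_ideal k \<phi> R \<iota> (K\<lparr>carrier := T\<rparr>)"
      unfolding monoid_ring_carrier_update by simp
  qed
  have m1: "\<ominus>\<^bsub>?Z\<^esub> p = (\<ominus>\<^bsub>?Z\<^esub> \<one>\<^bsub>?Z\<^esub>) \<otimes>\<^bsub>?Z\<^esub> p" if "p \<in> carrier ?Z" for p
    using that by (metis Z.l_minus Z.l_one Z.one_closed)
  define J where "J = {p \<in> carrier ?Z. \<exists>F. finite F \<and> F \<subseteq> carrier K \<and> D F p}"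
  have JI: "p \<in> J" if "p \<in> carrier ?Z" "finite F" "F \<subseteq> carrier K" "D F p" for p F
    using that unfolding J_def by blast
  have JE: "p \<in> carrier ?Z" "\<exists>F. finite F \<and> F \<subseteq> carrier K \<and> D F p" if "p \<in> J" for p
    using that unfolding J_def by blast+
  have Jmult: "x \<otimes>\<^bsub>?Z\<^esub> p \<in> J" if pJ: "p \<in> J" and x: "x \<in> carrier ?Z" for p x
  proof -
    obtain F where F: "finite F" "F \<subseteq> carrier K" "D F p" using JE(2)[OF pJ] by blast
    have "Poly_Mapping.keys x \<subseteq> carrier R \<times> carrier K" using x by simp
    then have sub: "F \<union> snd ` Poly_Mapping.keys x \<subseteq> carrier K" using F(2) by fastforce
    have fin: "finite (F \<union> snd ` Poly_Mapping.keys x)" using F(1) by simp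
    show ?thesis
      by (rule JI[OF Z.m_closed[OF x JE(1)[OF pJ]] fin sub Dmult[OF F(3) x]])
  qed
  have "ideal J ?Z"
  proof (rule idealI)
    show "subgroup J (add_monoid ?Z)"
    proof (rule subgroup.intro)
      show "J \<subseteq> carrier (add_monoid ?Z)" unfolding J_def by auto
    next
      fix p q assume "p \<in> J" "q \<in> J"
      note pq = JE(1)[OF \<open>p \<in> J\<close>] JE(1)[OF \<open>q \<in> J\<close>]
      obtain F G where F: "finite F" "F \<subseteq> carrier K" "D F p" and G: "finite G" "G \<subseteq> carrier K" "D G q"
        using JE(2)[OF \<open>p \<in> J\<close>] JE(2)[OF \<open>q \<in> J\<close>] by blast
      have "D (F \<union> G) (p + q)" by (intro Dadd D_mono[OF F(3)] D_mono[OF G(3)]) auto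
      then have "p \<oplus>\<^bsub>?Z\<^esub> q \<in> J"
        using JI[OF Z.a_closed[OF pq], of "F \<union> G"] F G by simp
      then show "p \<otimes>\<^bsub>add_monoid ?Z\<^esub> q \<in> J" by simp
    next
      show "\<one>\<^bsub>add_monoid ?Z\<^esub> \<in> J" using JI[of 0 "{}"] D0 by simp
    next
      fix p assume p: "p \<in> J"
      from m1[OF JE(1)[OF p]] have "\<ominus>\<^bsub>?Z\<^esub> p \<in> J"
        using Jmult[OF p Z.a_inv_closed[OF Z.one_closed]] by (simp only:)
      then show "inv\<^bsub>add_monoid ?Z\<^esub> p \<in> J" by (simp add: a_inv_def)
    qed
  next
    fix p x assume px: "p \<in> J" "x \<in> carrier ?Z"
    then show "x \<otimes>\<^bsub>?Z\<^esub> p \<in> J" using Jmult by blast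
    moreover have "p \<otimes>\<^bsub>?Z\<^esub> x = x \<otimes>\<^bsub>?Z\<^esub> p" using Z.m_comm[OF JE(1)[OF px(1)] px(2)] .
    ultimately show "p \<otimes>\<^bsub>?Z\<^esub> x \<in> J" by (simp only:)
  qed (rule Z.ring_axioms)
  moreover have "tensor_relations k \<phi> R \<iota> K \<subseteq> J"
  proof
    fix x assume x: "x \<in> tensor_relations k \<phi> R \<iota> K"
    have "\<exists>F. finite F \<and> F \<subseteq> carrier K \<and> D F x"
    proof -
      from x consider
        r r' s where "x = frag_of (r \<oplus>\<^bsub>R\<^esub> r', s) - frag_of (r, s) - frag_of (r', s)" 
          "r \<in> carrier R" "r' \<in> carrier R" "s \<in> carrier K"
      | r s s' where "x = frag_of (r, s \<oplus>\<^bsub>K\<^esub> s') - frag_of (r, s) - frag_of (r, s')" 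
          "r \<in> carrier R" "s \<in> carrier K" "s' \<in> carrier K"
      | c r s where "x = frag_of (\<phi> c \<otimes>\<^bsub>R\<^esub> r, s) - frag_of (r, \<iota> c \<otimes>\<^bsub>K\<^esub> s)"
          "c \<in> carrier k" "r \<in> carrier R" "s \<in> carrier K"
        unfolding tensor_relations_def by blast
      then show ?thesis
      proof cases
        case 1
        then have "x \<in> tensor_relations k \<phi> R \<iota> (K\<lparr>carrier := T\<rparr>)" if "{s} \<subseteq> T" for T
          using that unfolding tensor_relations_def by simp blast
        then have "D {s} x" unfolding D_def using ID(2) by blast
        then show ?thesis using 1(4) by (intro exI[of _ "{s}"] conjI) simp_all
      next
        case 2
        then have "x \<in> tensor_relations k \<phi> R \<iota> (K\<lparr>carrier := T\<rparr>)" if "{s, s'} \<subseteq> T" for T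
          using that unfolding tensor_relations_def by simp blast
        then have "D {s, s'} x" unfolding D_def using ID(2) by blast
        then show ?thesis using 2(3,4) by (intro exI[of _ "{s, s'}"] conjI) simp_all
      next
        case 3
        then have "x \<in> tensor_relations k \<phi> R \<iota> (K\<lparr>carrier := T\<rparr>)" if "{s} \<subseteq> T" for T
          using that unfolding tensor_relations_def by simp blast
        then have "D {s} x" unfolding D_def using ID(2) by blast
        then show ?thesis using 3(4) by (intro exI[of _ "{s}"] conjI) simp_all
      qed
    qed
    moreover have "x \<in> carrier ?Z" using x tensor_relations_carrier[OF R K \<phi> \<iota>] by blast
    ultimately show "x \<in> J" using JI by blast
  qed
  ultimately have "tensor_ideal k \<phi> R \<iota> K \<subseteq> J"
    unfolding tensor_ideal_def using Z.genideal_minimal by blast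
  then have "p \<in> J" using p by blast
  from JE(2)[OF this] show ?thesis unfolding D_def .
qed

lemma small_difference_subfield:
  fixes k :: "('k, 'm) difference_ring_scheme" and K :: "('l, 'n) difference_ring_scheme"
  assumes K: "difference_field_extension k \<iota> K" and F: "finite F" "F \<subseteq> carrier K"
  shows "\<exists>T (e :: 'l \<Rightarrow> 'k list). subfield T K \<and> sig K ` T \<subseteq> T \<and> \<iota> ` carrier k \<subseteq> T \<and> F \<subseteq> T \<and> inj_on e T"
proof -
  interpret K: difference_field K using K unfolding difference_field_extension_def by blast
  have \<iota>: "\<iota> \<in> ring_hom k K"
    using K unfolding difference_field_extension_def difference_algebra_def by blast
  define B where "B = insert \<one>\<^bsub>K\<^esub> (\<iota> ` carrier k \<union> F)"
  define step where "step A = A \<union> (\<lambda>(x, y). x \<oplus>\<^bsub>K\<^esub> y) ` (A \<times> A) \<union> (\<lambda>(x, y). x \<otimes>\<^bsub>K\<^esub> y) ` (A \<times> A)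
      \<union> a_inv K ` A \<union> m_inv K ` (A - {\<zero>\<^bsub>K\<^esub>}) \<union> sig K ` A" for A
  define T where "T = (\<Union>n. (step ^^ n) B)"
  let ?U = "UNIV :: 'k list set"
  have inf: "infinite ?U" by (rule infinite_UNIV_listI)
  have U2: "|A \<union> A'| \<le>o |?U|" if "|A| \<le>o |?U|" "|A'| \<le>o |?U|" for A A' :: "'l set"
    using card_of_Un_ordLeq_infinite[OF inf] that by blast
  have im: "|f ` A| \<le>o |?U|" if "|A| \<le>o |?U|" for f :: "'x \<Rightarrow> 'l" and A
    using card_of_image ordLeq_transitive that by blast
  have sq: "|A \<times> A| \<le>o |?U|" if "|A| \<le>o |?U|" for A :: "'l set"
    by (rule card_of_Sigma_ordLeq_infinite[OF inf that]) (use that in blast)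
  have sub: "|A| \<le>o |?U|" if "A \<subseteq> A'" "|A'| \<le>o |?U|" for A A' :: "'l set"
    using card_of_mono1[OF that(1)] ordLeq_transitive that(2) by blast
  have "|carrier k| \<le>o |?U|"
  proof -
    have "inj_on (\<lambda>x. [x]) (carrier k)" by (auto intro: inj_onI)
    then show ?thesis using card_of_ordLeq by blast
  qed
  moreover have fin: "|A| \<le>o |?U|" if "finite A" for A :: "'l set"
    using that inf by (meson card_of_Well_order card_of_ordLeq_infinite ordLeq_total)
  ultimately have "|B| \<le>o |?U|"
    unfolding B_def by (subst insert_is_Un) (intro U2 im fin F(1), simp_all)
  moreover have "|step A| \<le>o |?U|" if "|A| \<le>o |?U|" for A
  proof -
    have "|A - {\<zero>\<^bsub>K\<^esub>}| \<le>o |?U|" using sub[OF _ that] by blast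
    then show ?thesis unfolding step_def by (intro U2 im sq that)
  qed
  ultimately have "|(step ^^ n) B| \<le>o |?U|" for n by (induction n) auto
  moreover have "|UNIV :: nat set| \<le>o |?U|" using inf infinite_iff_card_of_nat by blast
  ultimately have "|T| \<le>o |?U|"
    unfolding T_def by (intro card_of_UNION_ordLeq_infinite[OF inf]) auto
  then obtain e :: "'l \<Rightarrow> 'k list" where e: "inj_on e T" unfolding card_of_ordLeq[symmetric] by blast
  have sc: "sig K x \<in> carrier K" if "x \<in> carrier K" for x
    using ring_hom_closed[OF K.sig_hom that] .
  have ic: "inv\<^bsub>K\<^esub> x \<in> carrier K" if "x \<in> carrier K" "x \<noteq> \<zero>\<^bsub>K\<^esub>" for x
    using that K.Units_inv_closed[of x] K.field_Units by simp
  have "B \<subseteq> carrier K" unfolding B_def using F ring_hom_closed[OF \<iota>] by auto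
  moreover have "step A \<subseteq> carrier K" if "A \<subseteq> carrier K" for A
    unfolding step_def using that sc ic by auto
  ultimately have "(step ^^ n) B \<subseteq> carrier K" for n by (induction n) auto
  then have TK: "T \<subseteq> carrier K" unfolding T_def by blast
  have stepT: "x \<in> step ((step ^^ n) B) \<Longrightarrow> x \<in> T" for x n
    unfolding T_def by (rule UN_I[of "Suc n"]) auto
  have mono: "(step ^^ n) B \<subseteq> (step ^^ m) B" if "n \<le> m" for n m
    using that by (induction rule: dec_induct) (auto simp: step_def)
  have BT: "B \<subseteq> T" unfolding T_def by (rule subsetI, rule UN_I[of 0]) auto
  have T2: "\<exists>n. x \<in> (step ^^ n) B \<and> y \<in> (step ^^ n) B" if xy: "x \<in> T" "y \<in> T" for x y
  proof -
    obtain n m where "x \<in> (step ^^ n) B" "y \<in> (step ^^ m) B" using xy unfolding T_def by blast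
    then show ?thesis using mono[of n "max n m"] mono[of m "max n m"] by auto
  qed
  have cl: "x \<oplus>\<^bsub>K\<^esub> y \<in> T" "x \<otimes>\<^bsub>K\<^esub> y \<in> T" "\<ominus>\<^bsub>K\<^esub> x \<in> T" "sig K x \<in> T" "x \<noteq> \<zero>\<^bsub>K\<^esub> \<Longrightarrow> inv\<^bsub>K\<^esub> x \<in> T"
    if xy: "x \<in> T" "y \<in> T" for x y
  proof -
    obtain n where n: "x \<in> (step ^^ n) B" "y \<in> (step ^^ n) B" using T2[OF xy] by blast
    show "x \<oplus>\<^bsub>K\<^esub> y \<in> T" "x \<otimes>\<^bsub>K\<^esub> y \<in> T" "\<ominus>\<^bsub>K\<^esub> x \<in> T" "sig K x \<in> T" "x \<noteq> \<zero>\<^bsub>K\<^esub> \<Longrightarrow> inv\<^bsub>K\<^esub> x \<in> T"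
      by (rule stepT[of _ n], use n in \<open>force simp: step_def\<close>)+
  qed
  have cl1: "\<ominus>\<^bsub>K\<^esub> x \<in> T" "sig K x \<in> T" "x \<noteq> \<zero>\<^bsub>K\<^esub> \<Longrightarrow> inv\<^bsub>K\<^esub> x \<in> T" if "x \<in> T" for x
    using cl(3-5)[OF that that] by simp_all
  have "\<one>\<^bsub>K\<^esub> \<in> T" using BT unfolding B_def by blast
  then have "subring T K" by (rule K.subringI[OF TK _ cl1(1) cl(2) cl(1)])
  then have T: "subfield T K" by (rule K.subfieldI') (simp add: cl1(3))
  have "sig K ` T \<subseteq> T" using cl1(2) by (rule image_subsetI)
  moreover have "\<iota> ` carrier k \<subseteq> T" "F \<subseteq> T" using BT unfolding B_def by simp_all
  ultimately have "subfield T K \<and> sig K ` T \<subseteq> T \<and> \<iota> ` carrier k \<subseteq> T \<and> F \<subseteq> T \<and> inj_on e T"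
    using T e by simp
  then show ?thesis by (intro exI)
qed

theorem difference_separable_extension:
  fixes k :: "('k, 'm) difference_ring_scheme" and K :: "('l, 'n) difference_ring_scheme"
  assumes R: "difference_algebra k \<phi> R" and sep: "difference_separable k \<phi> R"
    and ext: "difference_field_extension k \<iota> K"
  shows "inj_on (sig (tensor k \<phi> R \<iota> K)) (carrier (tensor k \<phi> R \<iota> K))"
proof -
  have K: "difference_algebra k \<iota> K" and fK: "difference_field K" and fk: "difference_field k"
    using ext unfolding difference_field_extension_def difference_algebra_def by auto
  interpret K: difference_field K by fact
  note r = difference_algebraD[OF R] and h = difference_algebraD[OF K]
  show ?thesis
    unfolding inj_sig_tensor_iff[OF R K]
  proof (intro allI impI)
    fix p assume p: "Poly_Mapping.keys p \<subseteq> carrier R \<times> carrier K"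
      and sp: "free_map (sig R) (sig K) p \<in> tensor_ideal k \<phi> R \<iota> K"
    let ?sp = "free_map (sig R) (sig K) p"
    obtain F where F: "finite F" "F \<subseteq> carrier K" and
      FT: "\<And>T. subring T K \<Longrightarrow> \<iota> ` carrier k \<subseteq> T \<Longrightarrow> F \<subseteq> T \<Longrightarrow> ?sp \<in> tensor_ideal k \<phi> R \<iota> (K\<lparr>carrier := T\<rparr>)"
      using tensor_ideal_finitary[OF r(2) h(2) r(3) h(3) sp] by blast
    have "finite (F \<union> snd ` Poly_Mapping.keys p)" "F \<union> snd ` Poly_Mapping.keys p \<subseteq> carrier K" using F p by force+
    from small_difference_subfield[OF ext this] obtain T and e :: "'l \<Rightarrow> 'k list"
      where T: "subfield T K" "sig K ` T \<subseteq> T" "\<iota> ` carrier k \<subseteq> T" "F \<union> snd ` Poly_Mapping.keys p \<subseteq> T"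
        and e: "inj_on e T"
      by (elim exE conjE) (rule that)
    then have FT': "F \<subseteq> T" "snd ` Poly_Mapping.keys p \<subseteq> T" by simp_all
    let ?T = "K\<lparr>carrier := T\<rparr>"
    have TK: "T \<subseteq> carrier K" using subfieldE(3)[OF T(1)] .
    have fT: "field ?T" using K.subfield_iff(2)[OF T(1)] .
    interpret T: field ?T by fact
    let ?L0 = "image_ring e ?T"
    have eT: "inj_on e (carrier ?T)" using e by simp
    have fL0: "field ?L0" using T.inj_imp_image_ring_is_field[OF eT] .
    have iso: "e \<in> ring_iso ?T ?L0" using inj_imp_image_ring_iso[OF eT] .
    define j where "j = inv_into T e"
    have je: "j (e x) = x" if "x \<in> T" for x using that e unfolding j_def by simp
    define L :: "'k list difference_ring" where
      "L = ring.extend ?L0 \<lparr>sig = (\<lambda>a. e (sig K (j a)))\<rparr>"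
    have L_simps: "carrier L = e ` T" "\<one>\<^bsub>L\<^esub> = \<one>\<^bsub>?L0\<^esub>" "\<zero>\<^bsub>L\<^esub> = \<zero>\<^bsub>?L0\<^esub>"
      "\<And>x y. x \<otimes>\<^bsub>L\<^esub> y = x \<otimes>\<^bsub>?L0\<^esub> y" "\<And>x y. x \<oplus>\<^bsub>L\<^esub> y = x \<oplus>\<^bsub>?L0\<^esub> y"
      "\<And>x. sig L x = e (sig K (j x))"
      by (simp_all add: L_def ring.defs image_ring_carrier)
    have trunc: "ring.truncate L = ?L0" by (simp add: L_def ring.defs)
    have "e \<in> ring_iso ?T L"
      using iso unfolding ring_iso_def ring_hom_def by (auto simp: L_simps image_ring_carrier)
    from T.ring_iso_imp_img_field[OF this] have fL: "field L"
      by (simp add: L_def ring.defs image_ring_zero)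
    have eh: "e \<in> ring_hom ?T L" "e \<in> ring_hom ?T L"
      using iso unfolding ring_iso_def ring_hom_def by (auto simp: L_simps image_ring_carrier)
    have jh: "j \<in> ring_hom L K"
    proof (rule ring_hom_memI)
      fix x assume "x \<in> carrier L" then show "j x \<in> carrier K" using je TK by (auto simp: L_simps)
    next
      fix x y assume "x \<in> carrier L" "y \<in> carrier L"
      then obtain a b where ab: "a \<in> T" "x = e a" "b \<in> T" "y = e b" by (auto simp: L_simps)
      show "j (x \<otimes>\<^bsub>L\<^esub> y) = j x \<otimes>\<^bsub>K\<^esub> j y"
        using ring_hom_mult[OF eh(1), of a b, symmetric] ab je T.m_closed[of a b] by simp
      show "j (x \<oplus>\<^bsub>L\<^esub> y) = j x \<oplus>\<^bsub>K\<^esub> j y"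
        using ring_hom_add[OF eh(1), of a b, symmetric] ab je T.a_closed[of a b] by simp
    next
      show "j \<one>\<^bsub>L\<^esub> = \<one>\<^bsub>K\<^esub>" using ring_hom_one[OF eh(1), symmetric] je T.one_closed by simp
    qed
    have sL: "sig L \<in> ring_hom L L"
    proof -
      have s: "sig K \<in> ring_hom ?T ?T"
        by (rule ring_hom_memI)
          (use T(2) TK ring_hom_mult[OF h(4)] ring_hom_add[OF h(4)] ring_hom_one[OF h(4)] in
            \<open>auto simp: subset_iff\<close>)
      have j: "j \<in> ring_hom L ?T" using jh je by (auto simp: ring_hom_def L_simps)
      have "sig L = e \<circ> sig K \<circ> j" by (auto simp: L_simps)
      then show ?thesis using ring_hom_trans[OF ring_hom_trans[OF j s] eh(1)] by (simp add: comp_assoc)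
    qed
    interpret L: field L by fact
    have dL: "difference_field L"
      unfolding difference_field_def difference_ring_def difference_ring_axioms_def
      using sL fL L.is_cring by blast
    define \<iota>' where "\<iota>' = e \<circ> \<iota>"
    have "\<iota> \<in> ring_hom k ?T" using h(3) T(3) by (auto simp: ring_hom_def)
    then have \<iota>'h: "\<iota>' \<in> ring_hom k L" unfolding \<iota>'_def using ring_hom_trans eh(1) by blast
    have \<iota>T: "\<iota> c \<in> T" if "c \<in> carrier k" for c using T(3) that by blast
    have dLk: "difference_algebra k \<iota>' L"
      unfolding difference_algebra_def using fk dL \<iota>'h h(5) \<iota>T je
      by (auto simp: \<iota>'_def L_simps difference_field_def)
    have "inj_on (sig (tensor k \<phi> R \<iota>' L)) (carrier (tensor k \<phi> R \<iota>' L))"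
      using sep dLk dL unfolding difference_separable_def difference_field_extension_def by blast
    note inj = this[unfolded inj_sig_tensor_iff[OF R dLk], rule_format]
    have crT: "cring ?T" by unfold_locales
    have hT: "\<iota> \<in> ring_hom k ?T" by fact
    have idR: "id \<in> ring_hom R R" by (auto simp: ring_hom_def)
    let ?q = "free_map id e p"
    have pT: "Poly_Mapping.keys p \<subseteq> carrier R \<times> T" using p FT'(2) by force
    have qc: "Poly_Mapping.keys ?q \<subseteq> carrier R \<times> carrier L"
      using free_map_keys[of id e p] pT by (force simp: L_simps)
    have comp: "free_map f g (free_map f' g' x) = free_map (f \<circ> f') (g \<circ> g') x"
      for f g f' g' and x
    proof -
      have "Poly_Mapping.keys x \<subseteq> UNIV" by simp
      then show ?thesis by (induction x rule: frag_induction) (auto simp only: free_map_simps comp_def split: prod.splits)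
    qed
    have cong: "free_map f g p = free_map f' g' p"
      if "\<And>x. x \<in> carrier R \<Longrightarrow> f x = f' x" "\<And>x. x \<in> T \<Longrightarrow> g x = g' x" for f f' and g g'
      unfolding free_map_def by (rule frag_extend_eq) (use pT that in auto)
    have "free_map id e ?sp \<in> tensor_ideal k \<phi> R \<iota>' L"
      by (rule free_map_ideal[OF r(2) crT r(3) hT r(2) L.is_cring r(3) \<iota>'h idR eh(1), of id])
        (use FT[OF subfieldE(1)[OF T(1)] T(3) FT'(1)] in \<open>auto simp: \<iota>'_def\<close>)
    moreover have "free_map id e ?sp = free_map (sig R) (sig L) ?q"
      unfolding comp by (rule cong) (auto simp: L_simps je)
    ultimately have "?q \<in> tensor_ideal k \<phi> R \<iota>' L" using inj[OF qc] by simp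
    then have "free_map id j ?q \<in> tensor_ideal k \<phi> R \<iota> K"
      by (rule free_map_ideal[OF r(2) L.is_cring r(3) \<iota>'h r(2) h(2) r(3) h(3) idR jh, of id, rotated -1])
        (auto simp: \<iota>'_def je \<iota>T)
    moreover have "free_map id j ?q = p"
    proof -
      have "free_map id j ?q = free_map id id p" unfolding comp by (rule cong) (auto simp: je)
      also have "\<dots> = p" unfolding free_map_def using frag_expansion[of p] by (simp add: case_prod_unfold)
      finally show ?thesis .
    qed
    ultimately show "p \<in> tensor_ideal k \<phi> R \<iota> K" by simp
  qed
qed



section \<open>Base change of difference algebras\<close>

lemma tensor_simps:
  "\<one>\<^bsub>tensor k \<phi> R \<psi> S\<^esub> = \<one>\<^bsub>tensor_ring k \<phi> R \<psi> S\<^esub>"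
  "\<zero>\<^bsub>tensor k \<phi> R \<psi> S\<^esub> = \<zero>\<^bsub>tensor_ring k \<phi> R \<psi> S\<^esub>"
  "x \<otimes>\<^bsub>tensor k \<phi> R \<psi> S\<^esub> y = x \<otimes>\<^bsub>tensor_ring k \<phi> R \<psi> S\<^esub> y"
  "x \<oplus>\<^bsub>tensor k \<phi> R \<psi> S\<^esub> y = x \<oplus>\<^bsub>tensor_ring k \<phi> R \<psi> S\<^esub> y"
  by (simp_all add: tensor_def ring.defs)

lemma tensor_class_hom:
  assumes "cring R" "cring S" "\<phi> \<in> ring_hom k R" "\<psi> \<in> ring_hom k S"
  shows "tensor_class k \<phi> R \<psi> S \<in> ring_hom (monoid_ring (R \<times>\<times> S)) (tensor k \<phi> R \<psi> S)"
proof -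
  have "tensor_class k \<phi> R \<psi> S \<in> ring_hom (monoid_ring (R \<times>\<times> S)) (tensor_ring k \<phi> R \<psi> S)"
    using ideal.rcos_ring_hom[OF tensor_ideal_ideal[OF assms]]
    unfolding tensor_ring_def tensor_class_def[abs_def] by simp
  then show ?thesis unfolding ring_hom_def tensor_simps tensor_carrier(2) .
qed

lemma tensor_base_change:
  assumes R: "difference_algebra k \<phi> R" and K: "difference_field_extension k \<iota> K"
  shows "difference_algebra K (pure_tensor k \<phi> R \<iota> K \<one>\<^bsub>R\<^esub>) (tensor k \<phi> R \<iota> K)"
proof -
  have K': "difference_algebra k \<iota> K" and fK: "difference_field K"
    using K unfolding difference_field_extension_def by auto
  note r = difference_algebraD[OF R] and h = difference_algebraD[OF K']
  let ?T = "tensor k \<phi> R \<iota> K" and ?Z = "monoid_ring (R \<times>\<times> K)" and ?c = "tensor_class k \<phi> R \<iota> K"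
  interpret R: cring R by (rule r(2))
  interpret K: cring K by (rule h(2))
  interpret T0: cring "tensor_ring k \<phi> R \<iota> K" using tensor_ring_cring[OF r(2) h(2) r(3) h(3)] .
  interpret Z: cring ?Z using free_cring[OF r(2) h(2)] .
  note c = tensor_class_hom[OF r(2) h(2) r(3) h(3)]
  note s = free_map_hom[OF r(2) h(2) r(4) h(4)]
  have "id \<in> ring_iso (tensor_ring k \<phi> R \<iota> K) ?T"
    by (simp add: ring_iso_def ring_hom_def tensor_simps tensor_carrier(2))
  from T0.ring_iso_imp_img_cring[OF this] have T: "cring ?T"
    by (simp add: tensor_def ring.defs)
  have rep: "\<exists>p. p \<in> carrier ?Z \<and> x = ?c p" if "x \<in> carrier ?T" for x
    using that by (auto simp: tensor_carrier)
  have sc: "sig ?T (?c p) = ?c (free_map (sig R) (sig K) p)" if "p \<in> carrier ?Z" for p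
    using sig_tensor[OF R K'] that by simp
  have sT: "sig ?T \<in> ring_hom ?T ?T"
  proof (rule ring_hom_memI)
    fix x assume "x \<in> carrier ?T"
    then obtain p where p: "p \<in> carrier ?Z" "x = ?c p" using rep by blast
    show "sig ?T x \<in> carrier ?T"
      unfolding p(2) sc[OF p(1)] by (rule ring_hom_closed[OF c ring_hom_closed[OF s p(1)]])
  next
    fix x y assume "x \<in> carrier ?T" "y \<in> carrier ?T"
    then obtain p q where p: "p \<in> carrier ?Z" "x = ?c p" and q: "q \<in> carrier ?Z" "y = ?c q"
      using rep by metis
    note sp = ring_hom_closed[OF s p(1)] and sq = ring_hom_closed[OF s q(1)]
    show "sig ?T (x \<otimes>\<^bsub>?T\<^esub> y) = sig ?T x \<otimes>\<^bsub>?T\<^esub> sig ?T y"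
      unfolding p(2) q(2) sc[OF p(1)] sc[OF q(1)] ring_hom_mult[OF c p(1) q(1), symmetric]
        sc[OF Z.m_closed[OF p(1) q(1)]] ring_hom_mult[OF s p(1) q(1)] ring_hom_mult[OF c sp sq] ..
    show "sig ?T (x \<oplus>\<^bsub>?T\<^esub> y) = sig ?T x \<oplus>\<^bsub>?T\<^esub> sig ?T y"
      unfolding p(2) q(2) sc[OF p(1)] sc[OF q(1)] ring_hom_add[OF c p(1) q(1), symmetric]
        sc[OF Z.a_closed[OF p(1) q(1)]] ring_hom_add[OF s p(1) q(1)] ring_hom_add[OF c sp sq] ..
  next
    show "sig ?T \<one>\<^bsub>?T\<^esub> = \<one>\<^bsub>?T\<^esub>"
      unfolding ring_hom_one[OF c, symmetric] sc[OF Z.one_closed] ring_hom_one[OF s] ..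
  qed
  have dT: "difference_ring ?T"
    unfolding difference_ring_def difference_ring_axioms_def using T sT by blast
  have fc: "frag_of (\<one>\<^bsub>R\<^esub>, a) \<in> carrier ?Z" if "a \<in> carrier K" for a
    using that by (simp add: keys_frag_of)
  have "pure_tensor k \<phi> R \<iota> K \<one>\<^bsub>R\<^esub> \<in> ring_hom K ?T"
    unfolding pure_tensor_def
  proof (rule ring_hom_memI)
    fix a assume a: "a \<in> carrier K"
    show "?c (frag_of (\<one>\<^bsub>R\<^esub>, a)) \<in> carrier ?T" using ring_hom_closed[OF c fc[OF a]] .
  next
    fix a b assume ab: "a \<in> carrier K" "b \<in> carrier K"
    show "?c (frag_of (\<one>\<^bsub>R\<^esub>, a \<otimes>\<^bsub>K\<^esub> b)) = ?c (frag_of (\<one>\<^bsub>R\<^esub>, a)) \<otimes>\<^bsub>?T\<^esub> ?c (frag_of (\<one>\<^bsub>R\<^esub>, b))"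
      unfolding ring_hom_mult[OF c fc[OF ab(1)] fc[OF ab(2)], symmetric] by simp
    have "?c (frag_of (\<one>\<^bsub>R\<^esub>, a \<oplus>\<^bsub>K\<^esub> b)) = ?c (frag_of (\<one>\<^bsub>R\<^esub>, a) + frag_of (\<one>\<^bsub>R\<^esub>, b))"
    proof (subst tensor_class_eq_iff[OF r(2) h(2) r(3) h(3)])
      show "frag_of (\<one>\<^bsub>R\<^esub>, a \<oplus>\<^bsub>K\<^esub> b) - (frag_of (\<one>\<^bsub>R\<^esub>, a) + frag_of (\<one>\<^bsub>R\<^esub>, b)) \<in> tensor_ideal k \<phi> R \<iota> K"
        using tensor_relationsI(2)[OF R.one_closed ab] tensor_relations_ideal[OF r(2) h(2) r(3) h(3)]
        unfolding diff_diff_eq by blast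
      show "Poly_Mapping.keys (frag_of (\<one>\<^bsub>R\<^esub>, a) + frag_of (\<one>\<^bsub>R\<^esub>, b)) \<subseteq> carrier R \<times> carrier K"
        using Z.a_closed[OF fc[OF ab(1)] fc[OF ab(2)]] by simp
    qed (use fc[OF K.a_closed[OF ab]] in simp)
    then show "?c (frag_of (\<one>\<^bsub>R\<^esub>, a \<oplus>\<^bsub>K\<^esub> b)) = ?c (frag_of (\<one>\<^bsub>R\<^esub>, a)) \<oplus>\<^bsub>?T\<^esub> ?c (frag_of (\<one>\<^bsub>R\<^esub>, b))"
      unfolding ring_hom_add[OF c fc[OF ab(1)] fc[OF ab(2)], symmetric] by simp
  next
    show "?c (frag_of (\<one>\<^bsub>R\<^esub>, \<one>\<^bsub>K\<^esub>)) = \<one>\<^bsub>?T\<^esub>" using ring_hom_one[OF c] by simp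
  qed
  moreover have "pure_tensor k \<phi> R \<iota> K \<one>\<^bsub>R\<^esub> (sig K a) = sig ?T (pure_tensor k \<phi> R \<iota> K \<one>\<^bsub>R\<^esub> a)"
    if "a \<in> carrier K" for a
    unfolding pure_tensor_def sc[OF fc[OF that]] by (simp add: ring_hom_one[OF r(4)])
  ultimately show ?thesis
    unfolding difference_algebra_def using fK dT by blast
qed

end

theory Submission
  imports Defs
begin

text \<open>Call a \<open>k\<close>-algebra \<open>A\<close> separable if \<open>A \<otimes> A\<close> contains an element \<open>p\<close> with \<open>(a \<otimes> 1) p = (1 \<otimes> a) p\<close> for
  all \<open>a\<close> and with image \<open>1\<close> under multiplication. Such an algebra is finite-dimensional, and
  etale is the same as separable: an algebra split over the algebraic closure is separable there
  and separability descends; conversely every character \<open>\<chi>\<close> of \<open>A \<otimes> L\<close> turns \<open>p\<close> into the idempotent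
  \<open>(id \<otimes> \<chi>)(p)\<close> of \<open>A \<otimes> L\<close>, and these idempotents split the algebra. A finite-dimensional \<open>A\<close> is
  \<open>\<sigma>\<close>-separable if and only if \<open>\<sigma>(A)\<close> spans \<open>A\<close>.

  Both conditions are compatible with base change and composita. For the converse inclusion
  let \<open>B \<subseteq> R \<otimes> K\<close> be strongly \<open>\<sigma>\<close>-etale over \<open>K\<close> and \<open>V\<close> the span of the coefficients of the
  elements of \<open>B\<close>, i.e. the smallest subspace of \<open>R\<close> with \<open>B \<subseteq> V \<otimes> K\<close>. As \<open>B\<close> is spanned by
  \<open>\<sigma>(B)\<close>, the space \<open>V\<close> is contained in the span of \<open>\<sigma>(V)\<close>, and they agree by comparing dimensions.
  So \<open>A = k[V]\<close> is stable under \<open>\<sigma>\<close> and spanned by \<open>\<sigma>(A)\<close>. If \<open>I\<close> is the kernel of multiplication on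
  \<open>A \<otimes> A\<close>, separability of \<open>B\<close> forces the elements \<open>v \<otimes> 1 - 1 \<otimes> v\<close> with \<open>v \<in> V\<close> to lie in \<open>I\<^sup>2\<close>. Thus the
  finitely generated ideal \<open>I\<close> is idempotent, and Nakayama's lemma makes \<open>A\<close> separable.\<close>

section \<open>The universal property of the tensor product\<close>

text \<open>Etaleness refers to an algebraic closure and \<sigma>-separability to all extensions, so
  neither moves easily between \<open>k\<close> and \<open>K\<close>. The idempotent
  \<open>p\<close> and the condition that \<sigma>(A) spans \<open>A\<close> are statements about
  \<open>A\<close> alone, and ring homomorphisms carry them along. Coefficients of a tensor are read
  off without bases. A linear functional \<open>g\<close> on \<open>K\<close> gives a map
  \<open>id \<otimes> g\<close> to \<open>R\<close>, whose values, the slices, play the role of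
  coefficients: every tensor is a sum of products of its slices with elements of \<open>K\<close>.
  Membership in \<open>V \<otimes> K\<close> thus becomes a condition on slices, and flatness
  becomes the fact that a tensor with only zero slices is zero. The obstacle in the converse
  inclusion is that \<open>A \<otimes> K\<close> can be larger than \<open>B\<close>, and that
  \<open>A\<close> is not known in advance to be finite-dimensional. Hence \<open>A\<close> does not
  inherit separability from \<open>B\<close> by plain descent. The ideal \<open>I\<close>, however,
  is finitely generated as soon as \<open>A\<close> is a finitely generated algebra, which is all
  that Nakayama's lemma asks for.\<close>

locale k_algebra = k: field k + cring R
  for k :: "('k, 'l) ring_scheme" and \<phi> :: "'k \<Rightarrow> 'a" and R :: "('a, 'm) ring_scheme" (structure) +
  assumes str_hom: "\<phi> \<in> ring_hom k R"
begin

lemma str_closed [simp, intro]: "c \<in> carrier k \<Longrightarrow> \<phi> c \<in> carrier R"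
  using ring_hom_closed[OF str_hom] .

lemma str_simps [simp]:
  "c \<in> carrier k \<Longrightarrow> d \<in> carrier k \<Longrightarrow> \<phi> (c \<oplus>\<^bsub>k\<^esub> d) = \<phi> c \<oplus> \<phi> d"
  "c \<in> carrier k \<Longrightarrow> d \<in> carrier k \<Longrightarrow> \<phi> (c \<otimes>\<^bsub>k\<^esub> d) = \<phi> c \<otimes> \<phi> d"
  "\<phi> \<one>\<^bsub>k\<^esub> = \<one>" "\<phi> \<zero>\<^bsub>k\<^esub> = \<zero>"
  using ring_hom_add[OF str_hom] ring_hom_mult[OF str_hom] ring_hom_one[OF str_hom]
    ring_hom_zero[OF str_hom k.ring_axioms ring_axioms] by auto

lemma str_minus [simp]: "c \<in> carrier k \<Longrightarrow> \<phi> (\<ominus>\<^bsub>k\<^esub> c) = \<ominus> \<phi> c"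
proof -
  interpret ring_hom_ring k R \<phi> using str_hom by (intro ring_hom_ringI2) unfold_locales
  show "c \<in> carrier k \<Longrightarrow> \<phi> (\<ominus>\<^bsub>k\<^esub> c) = \<ominus> \<phi> c" by simp
qed

end

section \<open>Balanced maps and the additive maps they induce\<close>

definition balanced ::
    "('k, 'l) ring_scheme \<Rightarrow> ('k \<Rightarrow> 'a) \<Rightarrow> ('a, 'm) ring_scheme \<Rightarrow> ('k \<Rightarrow> 'b) \<Rightarrow> ('b, 'n) ring_scheme \<Rightarrow>
     ('q, 'o) ring_scheme \<Rightarrow> ('a \<Rightarrow> 'b \<Rightarrow> 'q) \<Rightarrow> bool"
  where "balanced k \<phi> R \<psi> S Q B \<longleftrightarrow>
    (\<forall>r\<in>carrier R. \<forall>s\<in>carrier S. B r s \<in> carrier Q) \<and>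
    (\<forall>r\<in>carrier R. \<forall>r'\<in>carrier R. \<forall>s\<in>carrier S. B (r \<oplus>\<^bsub>R\<^esub> r') s = B r s \<oplus>\<^bsub>Q\<^esub> B r' s) \<and>
    (\<forall>r\<in>carrier R. \<forall>s\<in>carrier S. \<forall>s'\<in>carrier S. B r (s \<oplus>\<^bsub>S\<^esub> s') = B r s \<oplus>\<^bsub>Q\<^esub> B r s') \<and>
    (\<forall>c\<in>carrier k. \<forall>r\<in>carrier R. \<forall>s\<in>carrier S. B (\<phi> c \<otimes>\<^bsub>R\<^esub> r) s = B r (\<psi> c \<otimes>\<^bsub>S\<^esub> s))"

text \<open>The lift is unique only on the carrier, hence the choice operator;
  \<open>lift_exists\<close> justifies the choice for balanced maps into abelian groups.\<close>

definition tensor_lift ::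
    "('k, 'l) ring_scheme \<Rightarrow> ('k \<Rightarrow> 'a) \<Rightarrow> ('a, 'm) ring_scheme \<Rightarrow> ('k \<Rightarrow> 'b) \<Rightarrow> ('b, 'n) ring_scheme \<Rightarrow>
     ('q, 'o) ring_scheme \<Rightarrow> ('a \<Rightarrow> 'b \<Rightarrow> 'q) \<Rightarrow> ('a \<times> 'b \<Rightarrow>\<^sub>0 int) set \<Rightarrow> 'q"
  where "tensor_lift k \<phi> R \<psi> S Q B =
    (SOME h. h \<in> hom (add_monoid (tensor_ring k \<phi> R \<psi> S)) (add_monoid Q) \<and>
      (\<forall>r\<in>carrier R. \<forall>s\<in>carrier S. h (pure_tensor k \<phi> R \<psi> S r s) = B r s))"

locale tensor_algebras = R: k_algebra k \<phi> R + S: k_algebra k \<psi> S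
  for k :: "('k, 'l) ring_scheme" and \<phi> :: "'k \<Rightarrow> 'a" and R :: "('a, 'm) ring_scheme"
    and \<psi> :: "'k \<Rightarrow> 'b" and S :: "('b, 'n) ring_scheme"
begin

abbreviation "T \<equiv> tensor_ring k \<phi> R \<psi> S"
abbreviation "pt \<equiv> pure_tensor k \<phi> R \<psi> S"
abbreviation "lift \<equiv> tensor_lift k \<phi> R \<psi> S"

lemmas hyps = R.cring_axioms S.cring_axioms R.str_hom S.str_hom

lemma tensor_cring: "cring T"
  by (rule tensor_ring_cring[OF hyps])

sublocale T: cring T
  by (rule tensor_cring)

abbreviation "cl \<equiv> tensor_class k \<phi> R \<psi> S"
abbreviation "Z \<equiv> monoid_ring (R \<times>\<times> S)"

lemma cl_hom: "cl \<in> ring_hom Z T"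
  using ideal.rcos_ring_hom[OF tensor_ideal_ideal[OF hyps]]
  unfolding tensor_ring_def tensor_class_def[abs_def] by simp

lemma carrier_cl: "x \<in> carrier T \<Longrightarrow> \<exists>p. Poly_Mapping.keys p \<subseteq> carrier R \<times> carrier S \<and> x = cl p"
  by (auto simp: tensor_carrier)

lemma pt_closed [simp, intro]: "r \<in> carrier R \<Longrightarrow> s \<in> carrier S \<Longrightarrow> pt r s \<in> carrier T"
  unfolding pure_tensor_def by (rule ring_hom_closed[OF cl_hom]) (simp add: keys_frag_of)

lemma cl_diff_zero:
  assumes "Poly_Mapping.keys p \<subseteq> carrier R \<times> carrier S" "Poly_Mapping.keys q \<subseteq> carrier R \<times> carrier S"
    and "p - q \<in> tensor_relations k \<phi> R \<psi> S"
  shows "cl p = cl q"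
  using tensor_class_eq_iff[OF hyps assms(1,2)] tensor_relations_ideal[OF hyps] assms(3) by blast

lemma cl_add:
  assumes "Poly_Mapping.keys p \<subseteq> carrier R \<times> carrier S" "Poly_Mapping.keys q \<subseteq> carrier R \<times> carrier S"
  shows "cl (p + q) = cl p \<oplus>\<^bsub>T\<^esub> cl q"
  using ring_hom_add[OF cl_hom, of p q] assms by simp

lemma pt_add:
  "r \<in> carrier R \<Longrightarrow> r' \<in> carrier R \<Longrightarrow> s \<in> carrier S \<Longrightarrow> pt (r \<oplus>\<^bsub>R\<^esub> r') s = pt r s \<oplus>\<^bsub>T\<^esub> pt r' s"
  "r \<in> carrier R \<Longrightarrow> s \<in> carrier S \<Longrightarrow> s' \<in> carrier S \<Longrightarrow> pt r (s \<oplus>\<^bsub>S\<^esub> s') = pt r s \<oplus>\<^bsub>T\<^esub> pt r s'"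
proof -
  have k: "Poly_Mapping.keys (frag_of a + frag_of b) \<subseteq> carrier R \<times> carrier S"
    if "a \<in> carrier R \<times> carrier S" "b \<in> carrier R \<times> carrier S" for a b
    using Poly_Mapping.keys_add[of "frag_of a" "frag_of b"] that by (auto simp: keys_frag_of)
  show "pt (r \<oplus>\<^bsub>R\<^esub> r') s = pt r s \<oplus>\<^bsub>T\<^esub> pt r' s"
    if "r \<in> carrier R" "r' \<in> carrier R" "s \<in> carrier S"
    unfolding pure_tensor_def
    by (subst cl_add[symmetric]; (rule cl_diff_zero)?)
      (use that k tensor_relationsI(1)[OF that] in \<open>auto simp: keys_frag_of diff_diff_eq\<close>)
  show "pt r (s \<oplus>\<^bsub>S\<^esub> s') = pt r s \<oplus>\<^bsub>T\<^esub> pt r s'"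
    if "r \<in> carrier R" "s \<in> carrier S" "s' \<in> carrier S"
    unfolding pure_tensor_def
    by (subst cl_add[symmetric]; (rule cl_diff_zero)?)
      (use that k tensor_relationsI(2)[OF that] in \<open>auto simp: keys_frag_of diff_diff_eq\<close>)
qed

lemma pt_scale:
  "c \<in> carrier k \<Longrightarrow> r \<in> carrier R \<Longrightarrow> s \<in> carrier S \<Longrightarrow> pt (\<phi> c \<otimes>\<^bsub>R\<^esub> r) s = pt r (\<psi> c \<otimes>\<^bsub>S\<^esub> s)"
  unfolding pure_tensor_def
  by (rule cl_diff_zero) (auto simp: keys_frag_of intro: tensor_relationsI(3))

lemma pt_str: "c \<in> carrier k \<Longrightarrow> pt (\<phi> c) \<one>\<^bsub>S\<^esub> = pt \<one>\<^bsub>R\<^esub> (\<psi> c)"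
  using pt_scale[of c "\<one>\<^bsub>R\<^esub>" "\<one>\<^bsub>S\<^esub>"] by simp

lemma pt_mult:
  "r \<in> carrier R \<Longrightarrow> r' \<in> carrier R \<Longrightarrow> s \<in> carrier S \<Longrightarrow> s' \<in> carrier S \<Longrightarrow>
    pt r s \<otimes>\<^bsub>T\<^esub> pt r' s' = pt (r \<otimes>\<^bsub>R\<^esub> r') (s \<otimes>\<^bsub>S\<^esub> s')"
  unfolding pure_tensor_def
  using ring_hom_mult[OF cl_hom, of "frag_of (r, s)" "frag_of (r', s')"] by (simp add: keys_frag_of)

lemma pt_one: "pt \<one>\<^bsub>R\<^esub> \<one>\<^bsub>S\<^esub> = \<one>\<^bsub>T\<^esub>"
  unfolding pure_tensor_def using ring_hom_one[OF cl_hom] by simp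

lemma pt_zero [simp]:
  "s \<in> carrier S \<Longrightarrow> pt \<zero>\<^bsub>R\<^esub> s = \<zero>\<^bsub>T\<^esub>"
  "r \<in> carrier R \<Longrightarrow> pt r \<zero>\<^bsub>S\<^esub> = \<zero>\<^bsub>T\<^esub>"
  using pt_add(1)[of "\<zero>\<^bsub>R\<^esub>" "\<zero>\<^bsub>R\<^esub>" s] pt_add(2)[of r "\<zero>\<^bsub>S\<^esub>" "\<zero>\<^bsub>S\<^esub>"] by auto

lemma pt_minus:
  "r \<in> carrier R \<Longrightarrow> s \<in> carrier S \<Longrightarrow> \<ominus>\<^bsub>T\<^esub> pt r s = pt (\<ominus>\<^bsub>R\<^esub> r) s"
  using pt_add(1)[of "\<ominus>\<^bsub>R\<^esub> r" r s] by (intro T.minus_equality) (auto simp: R.l_neg)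

lemma pt_split: "r \<in> carrier R \<Longrightarrow> s \<in> carrier S \<Longrightarrow> pt r \<one>\<^bsub>S\<^esub> \<otimes>\<^bsub>T\<^esub> pt \<one>\<^bsub>R\<^esub> s = pt r s"
  by (simp add: pt_mult)

text \<open>Negatives need no case of their own, because
  \<open>\<ominus> (r \<otimes> s) = (\<ominus> r) \<otimes> s\<close>, and zero is the pure tensor
  of two zeros.\<close>

lemma tensor_induct [consumes 1, case_names pure add]:
  assumes "x \<in> carrier T"
    and pure: "\<And>r s. r \<in> carrier R \<Longrightarrow> s \<in> carrier S \<Longrightarrow> P (pt r s)"
    and add: "\<And>x y. x \<in> carrier T \<Longrightarrow> y \<in> carrier T \<Longrightarrow> P x \<Longrightarrow> P y \<Longrightarrow> P (x \<oplus>\<^bsub>T\<^esub> y)"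
  shows "P x"
proof -
  obtain p where p: "Poly_Mapping.keys p \<subseteq> carrier R \<times> carrier S" "x = cl p"
    using carrier_cl[OF assms(1)] by blast
  have cl_diff: "cl (a - b) = cl a \<oplus>\<^bsub>T\<^esub> (\<ominus>\<^bsub>T\<^esub> cl b)"
    if "Poly_Mapping.keys a \<subseteq> carrier R \<times> carrier S" "Poly_Mapping.keys b \<subseteq> carrier R \<times> carrier S" for a b
  proof -
    have ab: "Poly_Mapping.keys (a - b) \<subseteq> carrier R \<times> carrier S" using keys_diff[of a b] that by blast
    from cl_add[OF ab that(2)] have "cl a = cl (a - b) \<oplus>\<^bsub>T\<^esub> cl b" by simp
    moreover have "cl (a - b) \<in> carrier T" "cl b \<in> carrier T"
      using ring_hom_closed[OF cl_hom, of "a - b"] ring_hom_closed[OF cl_hom, of b] that ab by simp_all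
    ultimately show ?thesis by (simp add: T.a_assoc T.r_neg)
  qed
  \<comment> \<open>\<open>frag_induction\<close> builds \<open>p\<close> from differences while
    \<open>add\<close> speaks only of sums, so the property is carried for both signs of the
    class.\<close>
  have "Poly_Mapping.keys p \<subseteq> carrier R \<times> carrier S \<and> P (cl p) \<and> P (\<ominus>\<^bsub>T\<^esub> cl p)"
    using p(1)
  proof (induction p rule: frag_induction)
    case zero
    have "cl 0 = \<zero>\<^bsub>T\<^esub>"
      using ring_hom_zero[OF cl_hom cring.axioms(1)[OF free_cring[OF hyps(1,2)]] T.ring_axioms] by simp
    then show ?case using pure[of "\<zero>\<^bsub>R\<^esub>" "\<zero>\<^bsub>S\<^esub>"] by simp
  next
    case (one x)
    then obtain r s where "x = (r, s)" "r \<in> carrier R" "s \<in> carrier S" by auto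
    then show ?case
      using pure[of r s] pure[of "\<ominus>\<^bsub>R\<^esub> r" s] pt_minus[of r s] pt_closed[of r s] unfolding pure_tensor_def
      by (auto simp: keys_frag_of)
  next
    case (diff a b)
    then have c: "cl a \<in> carrier T" "cl b \<in> carrier T" using ring_hom_closed[OF cl_hom] by auto
    have "\<ominus>\<^bsub>T\<^esub> (cl a \<oplus>\<^bsub>T\<^esub> (\<ominus>\<^bsub>T\<^esub> cl b)) = (\<ominus>\<^bsub>T\<^esub> cl a) \<oplus>\<^bsub>T\<^esub> cl b" using c by (simp add: T.minus_add)
    moreover have "Poly_Mapping.keys (a - b) \<subseteq> carrier R \<times> carrier S" using keys_diff[of a b] diff by blast
    ultimately show ?case using diff c add cl_diff[of a b] by auto
  qed
  then show ?thesis using p(2) by blast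
qed

text \<open>\<open>B\<close> extends additively to the free abelian group. The relations are divided
  out as a ring ideal, however, and the extension \<open>h0\<close> is not multiplicative. It kills
  the ideal nevertheless, since a generator \<open>(a, b)\<close> times a bilinearity relation is
  again a bilinearity relation.\<close>

lemma lift_exists:
  assumes Q: "abelian_group Q" and B: "balanced k \<phi> R \<psi> S Q B"
  shows "\<exists>h. h \<in> hom (add_monoid T) (add_monoid Q) \<and> (\<forall>r\<in>carrier R. \<forall>s\<in>carrier S. h (pt r s) = B r s)"
proof -
  interpret Q: abelian_group Q by fact
  interpret Z: cring Z using free_cring[OF hyps(1,2)] .
  have b: "\<And>r s. r \<in> carrier R \<Longrightarrow> s \<in> carrier S \<Longrightarrow> B r s \<in> carrier Q"
    "\<And>r r' s. r \<in> carrier R \<Longrightarrow> r' \<in> carrier R \<Longrightarrow> s \<in> carrier S \<Longrightarrow> B (r \<oplus>\<^bsub>R\<^esub> r') s = B r s \<oplus>\<^bsub>Q\<^esub> B r' s"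
    "\<And>r s s'. r \<in> carrier R \<Longrightarrow> s \<in> carrier S \<Longrightarrow> s' \<in> carrier S \<Longrightarrow> B r (s \<oplus>\<^bsub>S\<^esub> s') = B r s \<oplus>\<^bsub>Q\<^esub> B r s'"
    "\<And>c r s. c \<in> carrier k \<Longrightarrow> r \<in> carrier R \<Longrightarrow> s \<in> carrier S \<Longrightarrow> B (\<phi> c \<otimes>\<^bsub>R\<^esub> r) s = B r (\<psi> c \<otimes>\<^bsub>S\<^esub> s)"
    using B unfolding balanced_def by auto
  let ?F = "free_Abelian_group (carrier R \<times> carrier S)"
  have "case_prod B ` (carrier R \<times> carrier S) \<subseteq> carrier (add_monoid Q)" using b(1) by auto
  from comm_group.free_Abelian_group_universal[OF Q.a_comm_group this]
  obtain h0 where h0: "h0 \<in> hom ?F (add_monoid Q)"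
    and h0_of: "\<And>x. x \<in> carrier R \<times> carrier S \<Longrightarrow> h0 (frag_of x) = case_prod B x" by blast
  have h0_closed: "h0 p \<in> carrier Q" if "p \<in> carrier Z" for p
    using hom_in_carrier[OF h0, of p] that by simp
  have h0_add: "h0 (p + q) = h0 p \<oplus>\<^bsub>Q\<^esub> h0 q" if "p \<in> carrier Z" "q \<in> carrier Z" for p q
    using hom_mult[OF h0, of p q] that by simp
  have h0_zero: "h0 0 = \<zero>\<^bsub>Q\<^esub>"
    using h0_add[of 0 0] h0_closed[of 0] Q.r_neg1[of "h0 0" "h0 0"] by (auto simp: Q.l_neg)
  have h0_diff: "h0 (p - q) = h0 p \<ominus>\<^bsub>Q\<^esub> h0 q" if "p \<in> carrier Z" "q \<in> carrier Z" for p q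
  proof -
    have pq: "p - q \<in> carrier Z" using that keys_diff[of p q] by auto
    have "h0 p = h0 (p - q) \<oplus>\<^bsub>Q\<^esub> h0 q" using h0_add[OF pq that(2)] by simp
    then show ?thesis using h0_closed that pq
      by (simp add: a_minus_def Q.a_assoc Q.r_neg)
  qed
  \<comment> \<open>The largest ideal inside the kernel of \<open>h0\<close>; the generated ideal is
    contained in it as soon as the relations are.\<close>
  define J where "J = {p \<in> carrier Z. \<forall>q \<in> carrier Z. h0 (q \<otimes>\<^bsub>Z\<^esub> p) = \<zero>\<^bsub>Q\<^esub>}"
  have "ideal J Z"
  proof (rule idealI)
    show "subgroup J (add_monoid Z)"
    proof (rule subgroup.intro)
      fix p q assume "p \<in> J" "q \<in> J"
      then have pq: "p \<in> carrier Z" "q \<in> carrier Z" "\<And>x. x \<in> carrier Z \<Longrightarrow> h0 (x \<otimes>\<^bsub>Z\<^esub> p) = \<zero>\<^bsub>Q\<^esub>"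
        "\<And>x. x \<in> carrier Z \<Longrightarrow> h0 (x \<otimes>\<^bsub>Z\<^esub> q) = \<zero>\<^bsub>Q\<^esub>" unfolding J_def by blast+
      have "h0 (x \<otimes>\<^bsub>Z\<^esub> (p \<oplus>\<^bsub>Z\<^esub> q)) = \<zero>\<^bsub>Q\<^esub>" if x: "x \<in> carrier Z" for x
      proof -
        have "x \<otimes>\<^bsub>Z\<^esub> (p \<oplus>\<^bsub>Z\<^esub> q) = (x \<otimes>\<^bsub>Z\<^esub> p) + (x \<otimes>\<^bsub>Z\<^esub> q)"
          unfolding Z.r_distr[OF pq(1,2) x] by simp
        then show ?thesis
          unfolding J_def using h0_add[OF Z.m_closed[OF x pq(1)] Z.m_closed[OF x pq(2)]] pq x by simp
      qed
      then show "p \<otimes>\<^bsub>add_monoid Z\<^esub> q \<in> J" unfolding J_def using Z.a_closed[OF pq(1,2)] by simp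
    next
      fix p assume "p \<in> J"
      then have p: "p \<in> carrier Z" "\<And>x. x \<in> carrier Z \<Longrightarrow> h0 (x \<otimes>\<^bsub>Z\<^esub> p) = \<zero>\<^bsub>Q\<^esub>" unfolding J_def by blast+
      have "h0 (x \<otimes>\<^bsub>Z\<^esub> (\<ominus>\<^bsub>Z\<^esub> p)) = \<zero>\<^bsub>Q\<^esub>" if x: "x \<in> carrier Z" for x
      proof -
        have "x \<otimes>\<^bsub>Z\<^esub> (\<ominus>\<^bsub>Z\<^esub> p) = (\<ominus>\<^bsub>Z\<^esub> x) \<otimes>\<^bsub>Z\<^esub> p" using Z.l_minus[OF x p(1)] Z.r_minus[OF x p(1)] by (simp only:)
        then show ?thesis using p(2)[OF Z.a_inv_closed[OF x]] by (simp only:)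
      qed
      then show "inv\<^bsub>add_monoid Z\<^esub> p \<in> J"
        unfolding J_def a_inv_def[symmetric] using Z.a_inv_closed[OF p(1)] by blast
    next
      have "h0 (x \<otimes>\<^bsub>Z\<^esub> \<zero>\<^bsub>Z\<^esub>) = \<zero>\<^bsub>Q\<^esub>" if "x \<in> carrier Z" for x
        unfolding Z.r_null[OF that] using h0_zero by simp
      then show "\<one>\<^bsub>add_monoid Z\<^esub> \<in> J" unfolding J_def using Z.zero_closed by simp
    qed (auto simp: J_def)
  next
    fix p x assume "p \<in> J" "x \<in> carrier Z"
    then have p: "p \<in> carrier Z" "\<And>x. x \<in> carrier Z \<Longrightarrow> h0 (x \<otimes>\<^bsub>Z\<^esub> p) = \<zero>\<^bsub>Q\<^esub>" and x: "x \<in> carrier Z"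
      unfolding J_def by blast+
    have "h0 (y \<otimes>\<^bsub>Z\<^esub> (x \<otimes>\<^bsub>Z\<^esub> p)) = \<zero>\<^bsub>Q\<^esub>" if y: "y \<in> carrier Z" for y
      unfolding Z.m_assoc[OF y x p(1), symmetric] by (rule p(2)[OF Z.m_closed[OF y x]])
    then show xp: "x \<otimes>\<^bsub>Z\<^esub> p \<in> J" unfolding J_def using Z.m_closed[OF x p(1)] by blast
    then show "p \<otimes>\<^bsub>Z\<^esub> x \<in> J" using Z.m_comm[OF p(1) x] by (simp only:)
  qed (rule Z.ring_axioms)
  moreover have "tensor_relations k \<phi> R \<psi> S \<subseteq> J"
  proof
    fix p assume p: "p \<in> tensor_relations k \<phi> R \<psi> S"
    have pZ: "p \<in> carrier Z" using p tensor_relations_carrier[OF hyps] by blast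
    have h0_one: "h0 (frag_of (a, b) \<otimes>\<^bsub>Z\<^esub> p) = \<zero>\<^bsub>Q\<^esub>" if ab: "a \<in> carrier R" "b \<in> carrier S" for a b
    proof -
      have fc: "frag_of (x, y) \<in> carrier Z" if "x \<in> carrier R" "y \<in> carrier S" for x y
        using that by (simp add: keys_frag_of)
      have sub: "u - v \<in> carrier Z" if "u \<in> carrier Z" "v \<in> carrier Z" for u v
        using that keys_diff[of u v] by auto
      have mul: "frag_of (a, b) \<otimes>\<^bsub>Z\<^esub> frag_of (x, y) = frag_of (a \<otimes>\<^bsub>R\<^esub> x, b \<otimes>\<^bsub>S\<^esub> y)" for x y
        by simp
      have muld: "frag_of (a, b) \<otimes>\<^bsub>Z\<^esub> (u - v) = frag_of (a, b) \<otimes>\<^bsub>Z\<^esub> u - frag_of (a, b) \<otimes>\<^bsub>Z\<^esub> v" for u v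
        by (simp add: frag_extend_diff)
      from p consider
        r r' s where "p = frag_of (r \<oplus>\<^bsub>R\<^esub> r', s) - frag_of (r, s) - frag_of (r', s)"
          "r \<in> carrier R" "r' \<in> carrier R" "s \<in> carrier S"
      | r s s' where "p = frag_of (r, s \<oplus>\<^bsub>S\<^esub> s') - frag_of (r, s) - frag_of (r, s')"
          "r \<in> carrier R" "s \<in> carrier S" "s' \<in> carrier S"
      | c r s where "p = frag_of (\<phi> c \<otimes>\<^bsub>R\<^esub> r, s) - frag_of (r, \<psi> c \<otimes>\<^bsub>S\<^esub> s)"
          "c \<in> carrier k" "r \<in> carrier R" "s \<in> carrier S"
        unfolding tensor_relations_def by blast
      then show ?thesis
      proof cases
        case 1
        have "h0 (frag_of (a, b) \<otimes>\<^bsub>Z\<^esub> p) = B (a \<otimes>\<^bsub>R\<^esub> (r \<oplus>\<^bsub>R\<^esub> r')) (b \<otimes>\<^bsub>S\<^esub> s) \<ominus>\<^bsub>Q\<^esub> B (a \<otimes>\<^bsub>R\<^esub> r) (b \<otimes>\<^bsub>S\<^esub> s) \<ominus>\<^bsub>Q\<^esub> B (a \<otimes>\<^bsub>R\<^esub> r') (b \<otimes>\<^bsub>S\<^esub> s)"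
          unfolding 1(1) muld mul using ab 1(2-) by (simp only: h0_diff sub fc h0_of R.m_closed S.m_closed R.a_closed SigmaI) (simp add: h0_of)
        also have "\<dots> = \<zero>\<^bsub>Q\<^esub>"
          using ab 1(2-) b(1,2) by (simp add: R.r_distr a_minus_def Q.a_ac Q.r_neg2 Q.r_neg)
        finally show ?thesis .
      next
        case 2
        have "h0 (frag_of (a, b) \<otimes>\<^bsub>Z\<^esub> p) = B (a \<otimes>\<^bsub>R\<^esub> r) (b \<otimes>\<^bsub>S\<^esub> (s \<oplus>\<^bsub>S\<^esub> s')) \<ominus>\<^bsub>Q\<^esub> B (a \<otimes>\<^bsub>R\<^esub> r) (b \<otimes>\<^bsub>S\<^esub> s) \<ominus>\<^bsub>Q\<^esub> B (a \<otimes>\<^bsub>R\<^esub> r) (b \<otimes>\<^bsub>S\<^esub> s')"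
          unfolding 2(1) muld mul using ab 2(2-) by (simp only: h0_diff sub fc h0_of R.m_closed S.m_closed S.a_closed SigmaI) (simp add: h0_of)
        also have "\<dots> = \<zero>\<^bsub>Q\<^esub>"
          using ab 2(2-) b(1,3) by (simp add: S.r_distr a_minus_def Q.a_ac Q.r_neg2 Q.r_neg)
        finally show ?thesis .
      next
        case 3
        have "h0 (frag_of (a, b) \<otimes>\<^bsub>Z\<^esub> p) = B (a \<otimes>\<^bsub>R\<^esub> (\<phi> c \<otimes>\<^bsub>R\<^esub> r)) (b \<otimes>\<^bsub>S\<^esub> s) \<ominus>\<^bsub>Q\<^esub> B (a \<otimes>\<^bsub>R\<^esub> r) (b \<otimes>\<^bsub>S\<^esub> (\<psi> c \<otimes>\<^bsub>S\<^esub> s))"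
          unfolding 3(1) muld mul using ab 3(2-) by (simp only: h0_diff sub fc h0_of R.m_closed S.m_closed R.str_closed S.str_closed SigmaI) (simp add: h0_of)
        also have "\<dots> = \<zero>\<^bsub>Q\<^esub>"
          using ab 3(2-) b(1) b(4)[of c "a \<otimes>\<^bsub>R\<^esub> r" "b \<otimes>\<^bsub>S\<^esub> s"] by (simp add: R.m_lcomm S.m_lcomm a_minus_def Q.r_neg)
        finally show ?thesis .
      qed
    qed
    have "q \<in> carrier Z \<and> h0 (q \<otimes>\<^bsub>Z\<^esub> p) = \<zero>\<^bsub>Q\<^esub>" if "Poly_Mapping.keys q \<subseteq> carrier R \<times> carrier S" for q
      using that
    proof (induction q rule: frag_induction)
      case zero
      have "0 \<otimes>\<^bsub>Z\<^esub> p = 0" by (simp add: frag_extend_eq_0)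
      then show ?case using h0_zero by (simp only:) simp
    next
      case (one x)
      then show ?case using h0_one[of "fst x" "snd x"] by (auto simp: keys_frag_of)
    next
      case (diff q q')
      have "(q - q') \<otimes>\<^bsub>Z\<^esub> p = q \<otimes>\<^bsub>Z\<^esub> p - q' \<otimes>\<^bsub>Z\<^esub> p" by (simp add: frag_extend_diff)
      moreover have "q - q' \<in> carrier Z" using diff keys_diff[of q q'] by auto
      ultimately show ?case
        using diff h0_diff[of "q \<otimes>\<^bsub>Z\<^esub> p" "q' \<otimes>\<^bsub>Z\<^esub> p"] Z.m_closed[OF _ pZ] Q.r_neg[of "\<zero>\<^bsub>Q\<^esub>"] by (simp only: a_minus_def) auto
    qed
    then show "p \<in> J" unfolding J_def using pZ by auto
  qed
  ultimately have IJ: "tensor_ideal k \<phi> R \<psi> S \<subseteq> J"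
    unfolding tensor_ideal_def using Z.genideal_minimal by blast
  then have h0_ideal: "h0 p = \<zero>\<^bsub>Q\<^esub>" if "p \<in> tensor_ideal k \<phi> R \<psi> S" for p
  proof -
    have "p \<in> J" using that IJ by blast
    then have "p \<in> carrier Z" "h0 (\<one>\<^bsub>Z\<^esub> \<otimes>\<^bsub>Z\<^esub> p) = \<zero>\<^bsub>Q\<^esub>" unfolding J_def using Z.one_closed by blast+
    then show ?thesis using Z.l_one[of p] by (simp only:)
  qed
  \<comment> \<open>Any representative serves, because \<open>h0\<close> vanishes on the ideal;
    \<open>h_cl\<close> records this.\<close>
  define h where "h x = h0 (SOME p. p \<in> carrier Z \<and> x = cl p)" for x
  have h_cl: "h (cl p) = h0 p" if p: "p \<in> carrier Z" for p
  proof -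
    define p' where "p' = (SOME p'. p' \<in> carrier Z \<and> cl p = cl p')"
    have p': "p' \<in> carrier Z" "cl p = cl p'"
      using someI[of "\<lambda>p'. p' \<in> carrier Z \<and> cl p = cl p'" p] p unfolding p'_def by auto
    have "p - p' \<in> tensor_ideal k \<phi> R \<psi> S" using p p' tensor_class_eq_iff[OF hyps, of p p'] by simp
    from h0_ideal[OF this] have "h0 p \<ominus>\<^bsub>Q\<^esub> h0 p' = \<zero>\<^bsub>Q\<^esub>" using h0_diff[OF p p'(1)] by simp
    moreover have "h0 p = (h0 p \<ominus>\<^bsub>Q\<^esub> h0 p') \<oplus>\<^bsub>Q\<^esub> h0 p'"
      using h0_closed[OF p] h0_closed[OF p'(1)] by (simp add: a_minus_def Q.a_assoc Q.l_neg)
    ultimately have "h0 p = h0 p'" using h0_closed[OF p'(1)] by simp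
    then show ?thesis unfolding h_def p'_def by simp
  qed
  have rep: "\<exists>p. p \<in> carrier Z \<and> x = cl p" if "x \<in> carrier T" for x using carrier_cl[OF that] by auto
  have "h \<in> hom (add_monoid T) (add_monoid Q)"
  proof (rule homI)
    fix x assume "x \<in> carrier (add_monoid T)"
    then show "h x \<in> carrier (add_monoid Q)" using rep[of x] h_cl h0_closed by auto
  next
    fix x y assume "x \<in> carrier (add_monoid T)" "y \<in> carrier (add_monoid T)"
    then obtain p q where pq: "p \<in> carrier Z" "x = cl p" "q \<in> carrier Z" "y = cl q" using rep[of x] rep[of y] by auto
    have "cl p \<oplus>\<^bsub>T\<^esub> cl q = cl (p \<oplus>\<^bsub>Z\<^esub> q)" using ring_hom_add[OF cl_hom pq(1,3)] by (simp only:)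
    then show "h (x \<otimes>\<^bsub>add_monoid T\<^esub> y) = h x \<otimes>\<^bsub>add_monoid Q\<^esub> h y"
      using h_cl[OF Z.a_closed[OF pq(1,3)]] h_cl[OF pq(1)] h_cl[OF pq(3)] h0_add[OF pq(1,3)] pq by simp
  qed
  moreover have "h (pt r s) = B r s" if "r \<in> carrier R" "s \<in> carrier S" for r s
    unfolding pure_tensor_def using h_cl[of "frag_of (r, s)"] h0_of[of "(r, s)"] that by (simp add: keys_frag_of)
  ultimately show ?thesis by blast
qed

context
  fixes Q :: "('q, 'o) ring_scheme" and B :: "'a \<Rightarrow> 'b \<Rightarrow> 'q"
  assumes Q: "abelian_group Q" and B: "balanced k \<phi> R \<psi> S Q B"
begin

lemma
  lift_hom: "lift Q B \<in> hom (add_monoid T) (add_monoid Q)" and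
  lift_pt: "r \<in> carrier R \<Longrightarrow> s \<in> carrier S \<Longrightarrow> lift Q B (pt r s) = B r s"
  using someI_ex[OF lift_exists[OF Q B]] unfolding tensor_lift_def by blast+

lemma lift_closed: "x \<in> carrier T \<Longrightarrow> lift Q B x \<in> carrier Q"
  using hom_in_carrier[OF lift_hom] by simp

lemma lift_add: "x \<in> carrier T \<Longrightarrow> y \<in> carrier T \<Longrightarrow> lift Q B (x \<oplus>\<^bsub>T\<^esub> y) = lift Q B x \<oplus>\<^bsub>Q\<^esub> lift Q B y"
  using hom_mult[OF lift_hom] by simp

end

lemma lift_ring_hom:
  assumes Q: "cring Q" and f: "f \<in> ring_hom R Q" and g: "g \<in> ring_hom S Q"
    and fg: "\<And>c. c \<in> carrier k \<Longrightarrow> f (\<phi> c) = g (\<psi> c)"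
  defines "h \<equiv> lift Q (\<lambda>r s. f r \<otimes>\<^bsub>Q\<^esub> g s)"
  shows "h \<in> ring_hom T Q" "\<And>r s. r \<in> carrier R \<Longrightarrow> s \<in> carrier S \<Longrightarrow> h (pt r s) = f r \<otimes>\<^bsub>Q\<^esub> g s"
proof -
  interpret Q: cring Q by fact
  note [simp] = ring_hom_closed[OF f] ring_hom_closed[OF g] ring_hom_add[OF f] ring_hom_add[OF g]
    ring_hom_mult[OF f] ring_hom_mult[OF g] ring_hom_one[OF f] ring_hom_one[OF g]
  have B: "balanced k \<phi> R \<psi> S Q (\<lambda>r s. f r \<otimes>\<^bsub>Q\<^esub> g s)"
    unfolding balanced_def by (simp add: Q.l_distr Q.r_distr fg Q.m_assoc Q.m_lcomm)
  note l = lift_closed[OF Q.abelian_group_axioms B] lift_add[OF Q.abelian_group_axioms B]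
    lift_pt[OF Q.abelian_group_axioms B]
  show pt: "\<And>r s. r \<in> carrier R \<Longrightarrow> s \<in> carrier S \<Longrightarrow> h (pt r s) = f r \<otimes>\<^bsub>Q\<^esub> g s"
    unfolding h_def by (rule l)
  have pure: "h (pt r s \<otimes>\<^bsub>T\<^esub> y) = h (pt r s) \<otimes>\<^bsub>Q\<^esub> h y" if "y \<in> carrier T" "r \<in> carrier R" "s \<in> carrier S" for r s y
    using that
    by (induction y rule: tensor_induct)
      (simp_all add: pt pt_mult T.r_distr Q.r_distr l[folded h_def] Q.m_assoc Q.m_lcomm)
  show "h \<in> ring_hom T Q"
  proof (rule ring_hom_memI)
    fix x assume "x \<in> carrier T"
    then show "h x \<in> carrier Q" by (simp add: l[folded h_def])
  next
    fix x y assume "x \<in> carrier T" "y \<in> carrier T"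
    then show "h (x \<otimes>\<^bsub>T\<^esub> y) = h x \<otimes>\<^bsub>Q\<^esub> h y"
      by (induction x rule: tensor_induct)
        (simp_all add: pure T.l_distr Q.l_distr l[folded h_def])
    show "h (x \<oplus>\<^bsub>T\<^esub> y) = h x \<oplus>\<^bsub>Q\<^esub> h y"
      using \<open>x \<in> carrier T\<close> \<open>y \<in> carrier T\<close> by (simp add: l[folded h_def])
  next
    show "h \<one>\<^bsub>T\<^esub> = \<one>\<^bsub>Q\<^esub>" using pt[of "\<one>\<^bsub>R\<^esub>" "\<one>\<^bsub>S\<^esub>"] by (simp add: pt_one)
  qed
qed

lemma additive_eqI:
  assumes "\<And>x y. x \<in> carrier T \<Longrightarrow> y \<in> carrier T \<Longrightarrow> h (x \<oplus>\<^bsub>T\<^esub> y) = P (h x) (h y)"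
    and "\<And>x y. x \<in> carrier T \<Longrightarrow> y \<in> carrier T \<Longrightarrow> h' (x \<oplus>\<^bsub>T\<^esub> y) = P (h' x) (h' y)"
    and "\<And>r s. r \<in> carrier R \<Longrightarrow> s \<in> carrier S \<Longrightarrow> h (pt r s) = h' (pt r s)"
    and "x \<in> carrier T"
  shows "h x = h' x"
  using assms(4) by (induction x rule: tensor_induct) (simp_all add: assms(1-3))

lemma ring_hom_eqI:
  assumes "h \<in> ring_hom T Q" "h' \<in> ring_hom T Q"
    and "\<And>r s. r \<in> carrier R \<Longrightarrow> s \<in> carrier S \<Longrightarrow> h (pt r s) = h' (pt r s)"
    and "x \<in> carrier T"
  shows "h x = h' x"
  by (rule additive_eqI[where P = "\<lambda>x y. x \<oplus>\<^bsub>Q\<^esub> y"])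
    (use assms ring_hom_add[OF assms(1)] ring_hom_add[OF assms(2)] in auto)

lemma pt_l_hom: "(\<lambda>r. pt r \<one>\<^bsub>S\<^esub>) \<in> ring_hom R T"
  by (rule ring_hom_memI) (auto simp: pt_mult pt_add pt_one)

lemma pt_r_hom: "pt \<one>\<^bsub>R\<^esub> \<in> ring_hom S T"
  by (rule ring_hom_memI) (auto simp: pt_mult pt_add pt_one)

end

section \<open>Linear functionals and slices\<close>

definition linear_functional :: "('k, 'l) ring_scheme \<Rightarrow> ('k \<Rightarrow> 'a) \<Rightarrow> ('a, 'm) ring_scheme \<Rightarrow> ('a \<Rightarrow> 'k) \<Rightarrow> bool"
  where "linear_functional k \<phi> R g \<longleftrightarrow>
    (\<forall>x\<in>carrier R. g x \<in> carrier k) \<and>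
    (\<forall>x\<in>carrier R. \<forall>y\<in>carrier R. g (x \<oplus>\<^bsub>R\<^esub> y) = g x \<oplus>\<^bsub>k\<^esub> g y) \<and>
    (\<forall>c\<in>carrier k. \<forall>x\<in>carrier R. g (\<phi> c \<otimes>\<^bsub>R\<^esub> x) = c \<otimes>\<^bsub>k\<^esub> g x)"

lemma linear_functionalD:
  assumes "linear_functional k \<phi> R g"
  shows "x \<in> carrier R \<Longrightarrow> g x \<in> carrier k"
    "x \<in> carrier R \<Longrightarrow> y \<in> carrier R \<Longrightarrow> g (x \<oplus>\<^bsub>R\<^esub> y) = g x \<oplus>\<^bsub>k\<^esub> g y"
    "c \<in> carrier k \<Longrightarrow> x \<in> carrier R \<Longrightarrow> g (\<phi> c \<otimes>\<^bsub>R\<^esub> x) = c \<otimes>\<^bsub>k\<^esub> g x"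
  using assms unfolding linear_functional_def by blast+

section \<open>Subspaces and linear functionals\<close>

context k_algebra
begin

definition lin_closed :: "'a set \<Rightarrow> bool"
  where "lin_closed W \<longleftrightarrow> W \<subseteq> carrier R \<and> \<zero> \<in> W \<and> (\<forall>x\<in>W. \<forall>y\<in>W. x \<oplus> y \<in> W) \<and> (\<forall>c\<in>carrier k. \<forall>x\<in>W. \<phi> c \<otimes> x \<in> W)"

lemma str_minus_one: "x \<in> carrier R \<Longrightarrow> \<phi> (\<ominus>\<^bsub>k\<^esub> \<one>\<^bsub>k\<^esub>) \<otimes> x = \<ominus> x"
  by (simp add: l_minus)

lemma lin_closed_minus: "lin_closed W \<Longrightarrow> x \<in> W \<Longrightarrow> \<ominus> x \<in> W"
  using str_minus_one[of x] unfolding lin_closed_def by (metis k.a_inv_closed k.one_closed subsetD)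

lemma field_inv: "c \<in> carrier k \<Longrightarrow> c \<noteq> \<zero>\<^bsub>k\<^esub> \<Longrightarrow> inv\<^bsub>k\<^esub> c \<in> carrier k \<and> inv\<^bsub>k\<^esub> c \<otimes>\<^bsub>k\<^esub> c = \<one>\<^bsub>k\<^esub>"
  using k.field_Units k.Units_l_inv[of c] k.Units_inv_closed[of c] by auto

lemma scale_cancel:
  assumes "c \<in> carrier k" "c \<noteq> \<zero>\<^bsub>k\<^esub>" "x \<in> carrier R"
  shows "\<phi> (inv\<^bsub>k\<^esub> c) \<otimes> (\<phi> c \<otimes> x) = x"
  using field_inv[OF assms(1,2)] assms by (simp add: m_assoc[symmetric] str_simps(2)[symmetric] del: str_simps(2))

text \<open>A subspace \<open>W\<close> that is maximal among those avoiding \<open>v\<close> is a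
  complement of the line through \<open>v\<close>, and \<open>g\<close> is the coordinate along
  \<open>v\<close>.\<close>

lemma functional_exists:
  assumes v: "v \<in> carrier R" "v \<noteq> \<zero>"
  obtains g where "linear_functional k \<phi> R g" "g v = \<one>\<^bsub>k\<^esub>"
proof -
  define C where "C = {W. lin_closed W \<and> v \<notin> W}"
  have "\<exists>M\<in>C. \<forall>U\<in>C. M \<subseteq> U \<longrightarrow> U = M"
  proof (rule subset_Zorn_nonempty)
    have "{\<zero>} \<in> C" unfolding C_def lin_closed_def using v by auto
    then show "C \<noteq> {}" by blast
  next
    fix D assume D: "D \<noteq> {}" "subset.chain C D"
    have D1: "lin_closed W" "v \<notin> W" if "W \<in> D" for W
      using D(2) that unfolding subset_chain_def C_def by auto
    have D2: "\<exists>W\<in>D. x \<in> W \<and> y \<in> W" if "x \<in> \<Union>D" "y \<in> \<Union>D" for x y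
      using D(2) that unfolding subset_chain_def by (meson UnionE subsetD)
    have "lin_closed (\<Union>D)"
      unfolding lin_closed_def
    proof (intro conjI ballI)
      show "\<Union>D \<subseteq> carrier R" using D1(1) unfolding lin_closed_def by blast
      show "\<zero> \<in> \<Union>D" using D1(1) D(1) unfolding lin_closed_def by blast
      show "x \<oplus> y \<in> \<Union>D" if "x \<in> \<Union>D" "y \<in> \<Union>D" for x y
        using D2[OF that] D1(1) unfolding lin_closed_def by blast
      show "\<phi> c \<otimes> x \<in> \<Union>D" if "x \<in> \<Union>D" "c \<in> carrier k" for c x
        using that D1(1) unfolding lin_closed_def by blast
    qed
    then show "\<Union>D \<in> C" unfolding C_def using D1(2) by blast
  qed
  then obtain W where W: "lin_closed W" "v \<notin> W" and max: "\<And>U. lin_closed U \<Longrightarrow> v \<notin> U \<Longrightarrow> W \<subseteq> U \<Longrightarrow> U = W"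
    unfolding C_def by auto
  have Wc: "W \<subseteq> carrier R" "\<zero> \<in> W" "\<And>x y. x \<in> W \<Longrightarrow> y \<in> W \<Longrightarrow> x \<oplus> y \<in> W"
    "\<And>c x. c \<in> carrier k \<Longrightarrow> x \<in> W \<Longrightarrow> \<phi> c \<otimes> x \<in> W" "\<And>x. x \<in> W \<Longrightarrow> \<ominus> x \<in> W"
    using W(1) lin_closed_minus unfolding lin_closed_def by auto
  have ex: "\<exists>d\<in>carrier k. \<exists>w\<in>W. s = \<phi> d \<otimes> v \<oplus> w" if s: "s \<in> carrier R" for s
  proof (cases "s \<in> W")
    case True
    then show ?thesis using s v by (intro bexI[of _ "\<zero>\<^bsub>k\<^esub>"] bexI[of _ s]) auto
  next
    case False
    \<comment> \<open>The span of \<open>W\<close> and \<open>s\<close>. By maximality it contains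
      \<open>v\<close>, and an equation \<open>v = c s + w\<close> has \<open>c \<noteq> 0\<close>
      and can be solved for \<open>s\<close>.\<close>
    define U where "U = {\<phi> c \<otimes> s \<oplus> w | c w. c \<in> carrier k \<and> w \<in> W}"
    have "lin_closed U"
      unfolding lin_closed_def
    proof (intro conjI ballI)
      show "U \<subseteq> carrier R" unfolding U_def using s Wc(1) by auto
      have "\<zero> = \<phi> \<zero>\<^bsub>k\<^esub> \<otimes> s \<oplus> \<zero>" using s by simp
      then show "\<zero> \<in> U" unfolding U_def using Wc(2) k.zero_closed by blast
    next
      fix x y assume "x \<in> U" "y \<in> U"
      then obtain c w c' w' where *: "c \<in> carrier k" "w \<in> W" "c' \<in> carrier k" "w' \<in> W"
        "x = \<phi> c \<otimes> s \<oplus> w" "y = \<phi> c' \<otimes> s \<oplus> w'" unfolding U_def by blast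
      have "w \<in> carrier R" "w' \<in> carrier R" using * Wc(1) by auto
      then have "x \<oplus> y = \<phi> (c \<oplus>\<^bsub>k\<^esub> c') \<otimes> s \<oplus> (w \<oplus> w')" using * s by (simp add: l_distr a_ac)
      then show "x \<oplus> y \<in> U" unfolding U_def using * Wc(3) k.a_closed by blast
    next
      fix c x assume "c \<in> carrier k" "x \<in> U"
      then obtain d w where *: "c \<in> carrier k" "d \<in> carrier k" "w \<in> W" "x = \<phi> d \<otimes> s \<oplus> w"
        unfolding U_def by blast
      have "w \<in> carrier R" using * Wc(1) by auto
      then have "\<phi> c \<otimes> x = \<phi> (c \<otimes>\<^bsub>k\<^esub> d) \<otimes> s \<oplus> \<phi> c \<otimes> w" using * s by (simp add: r_distr m_assoc)
      then show "\<phi> c \<otimes> x \<in> U" unfolding U_def using * Wc(4) k.m_closed by blast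
    qed
    moreover have "W \<subseteq> U"
    proof
      fix w assume w: "w \<in> W"
      then have "w = \<phi> \<zero>\<^bsub>k\<^esub> \<otimes> s \<oplus> w" using s Wc(1) by auto
      then show "w \<in> U" unfolding U_def using w k.zero_closed by blast
    qed
    moreover have "s \<in> U"
    proof -
      have "s = \<phi> \<one>\<^bsub>k\<^esub> \<otimes> s \<oplus> \<zero>" using s by simp
      then show ?thesis unfolding U_def using Wc(2) k.one_closed by blast
    qed
    ultimately have "v \<in> U" using max[of U] False by blast
    then obtain c w where cw: "c \<in> carrier k" "w \<in> W" "v = \<phi> c \<otimes> s \<oplus> w" unfolding U_def by blast
    have w: "w \<in> carrier R" using cw Wc(1) by auto
    have "c \<noteq> \<zero>\<^bsub>k\<^esub>" using cw W(2) s w by auto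
    note i = field_inv[OF cw(1) this] scale_cancel[OF cw(1) this s]
    have "\<phi> (inv\<^bsub>k\<^esub> c) \<otimes> v = s \<oplus> \<phi> (inv\<^bsub>k\<^esub> c) \<otimes> w"
      unfolding cw(3) using i s w cw(1) by (simp add: r_distr)
    then have "s = \<phi> (inv\<^bsub>k\<^esub> c) \<otimes> v \<oplus> (\<ominus> (\<phi> (inv\<^bsub>k\<^esub> c) \<otimes> w))"
      using i s w by (simp add: a_assoc r_neg)
    then show ?thesis using i Wc(4,5) cw(2) by blast
  qed
  have uniq: "d = d'" if dw: "d \<in> carrier k" "d' \<in> carrier k" "w \<in> W" "w' \<in> W" "\<phi> d \<otimes> v \<oplus> w = \<phi> d' \<otimes> v \<oplus> w'" for d d' w w'
  proof (rule ccontr)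
    assume "d \<noteq> d'"
    let ?e = "d \<ominus>\<^bsub>k\<^esub> d'"
    have e: "?e \<in> carrier k" "?e \<noteq> \<zero>\<^bsub>k\<^esub>" using dw(1,2) \<open>d \<noteq> d'\<close> k.r_right_minus_eq by auto
    have w: "w \<in> carrier R" "w' \<in> carrier R" using dw Wc(1) by auto
    have "\<phi> ?e \<otimes> v = (\<phi> d \<otimes> v \<oplus> w) \<oplus> (\<ominus> (\<phi> d' \<otimes> v) \<oplus> \<ominus> w)"
      using w v dw(1,2) by (simp add: a_minus_def l_distr l_minus a_ac r_neg r_neg2)
    also have "\<dots> = w' \<oplus> \<ominus> w" unfolding dw(5) using w v dw(2) by (simp add: a_ac r_neg r_neg1 r_neg2)
    finally have "\<phi> ?e \<otimes> v \<in> W" using Wc(3,5) dw(3,4) by simp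
    then have "\<phi> (inv\<^bsub>k\<^esub> ?e) \<otimes> (\<phi> ?e \<otimes> v) \<in> W" using Wc(4) field_inv[OF e] by blast
    then show False using scale_cancel[OF e v(1)] W(2) by simp
  qed
  define g where "g s = (THE d. d \<in> carrier k \<and> (\<exists>w\<in>W. s = \<phi> d \<otimes> v \<oplus> w))" for s
  have g_eq: "g (\<phi> d \<otimes> v \<oplus> w) = d" if "d \<in> carrier k" "w \<in> W" for d w
    unfolding g_def using that uniq by (intro the_equality) blast+
  have "linear_functional k \<phi> R g"
    unfolding linear_functional_def
  proof (intro conjI ballI)
    fix s assume "s \<in> carrier R"
    then show "g s \<in> carrier k" using ex[of s] g_eq by auto
  next
    fix s t assume "s \<in> carrier R" "t \<in> carrier R"
    then obtain d w d' w' where *: "d \<in> carrier k" "w \<in> W" "s = \<phi> d \<otimes> v \<oplus> w" "d' \<in> carrier k" "w' \<in> W" "t = \<phi> d' \<otimes> v \<oplus> w'"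
      using ex by metis
    have "w \<in> carrier R" "w' \<in> carrier R" using * Wc(1) by auto
    then have "s \<oplus> t = \<phi> (d \<oplus>\<^bsub>k\<^esub> d') \<otimes> v \<oplus> (w \<oplus> w')" using * v by (simp add: l_distr a_ac)
    then show "g (s \<oplus> t) = g s \<oplus>\<^bsub>k\<^esub> g t" using * g_eq Wc(3) by (simp del: str_simps)
  next
    fix c s assume "c \<in> carrier k" "s \<in> carrier R"
    then obtain d w where *: "c \<in> carrier k" "d \<in> carrier k" "w \<in> W" "s = \<phi> d \<otimes> v \<oplus> w" using ex by metis
    have "w \<in> carrier R" using * Wc(1) by auto
    then have "\<phi> c \<otimes> s = \<phi> (c \<otimes>\<^bsub>k\<^esub> d) \<otimes> v \<oplus> \<phi> c \<otimes> w" using * v by (simp add: r_distr m_assoc)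
    then show "g (\<phi> c \<otimes> s) = c \<otimes>\<^bsub>k\<^esub> g s" using * g_eq Wc(4) by (simp del: str_simps)
  qed
  moreover have "g v = \<one>\<^bsub>k\<^esub>" using g_eq[of "\<one>\<^bsub>k\<^esub>" \<zero>] Wc(2) v by simp
  ultimately show ?thesis by (rule that)
qed

lemma functional_zero: "linear_functional k \<phi> R g \<Longrightarrow> g \<zero> = \<zero>\<^bsub>k\<^esub>"
  using linear_functionalD(3)[of k \<phi> R g "\<zero>\<^bsub>k\<^esub>" \<zero>] linear_functionalD(1)[of k \<phi> R g \<zero>] by simp

lemma functional_mult:
  assumes "linear_functional k \<phi> R g" "y \<in> carrier R"
  shows "linear_functional k \<phi> R (\<lambda>x. g (y \<otimes> x))"
proof -
  have "y \<otimes> (\<phi> c \<otimes> x) = \<phi> c \<otimes> (y \<otimes> x)" if "c \<in> carrier k" "x \<in> carrier R" for c x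
    using that assms(2) by (simp add: m_lcomm)
  then show ?thesis
    using assms unfolding linear_functional_def by (simp add: r_distr)
qed

text \<open>The finite-rank endomorphism \<open>s \<mapsto> \<Sigma> g(s) y\<close>.\<close>

fun expand :: "('a \<times> ('a \<Rightarrow> 'k)) list \<Rightarrow> 'a \<Rightarrow> 'a"
  where "expand [] s = \<zero>" | "expand ((y, g) # l) s = \<phi> (g s) \<otimes> y \<oplus> expand l s"

definition expansion :: "('a \<times> ('a \<Rightarrow> 'k)) list \<Rightarrow> bool"
  where "expansion l \<longleftrightarrow> (\<forall>(y, g)\<in>set l. y \<in> carrier R \<and> linear_functional k \<phi> R g)"

lemma expand_props:
  assumes "expansion l"
  shows "s \<in> carrier R \<Longrightarrow> expand l s \<in> carrier R"
    "s \<in> carrier R \<Longrightarrow> t \<in> carrier R \<Longrightarrow> expand l (s \<oplus> t) = expand l s \<oplus> expand l t"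
    "c \<in> carrier k \<Longrightarrow> s \<in> carrier R \<Longrightarrow> expand l (\<phi> c \<otimes> s) = \<phi> c \<otimes> expand l s"
proof -
  have "(\<forall>s\<in>carrier R. expand l s \<in> carrier R) \<and>
    (\<forall>s\<in>carrier R. \<forall>t\<in>carrier R. expand l (s \<oplus> t) = expand l s \<oplus> expand l t) \<and>
    (\<forall>c\<in>carrier k. \<forall>s\<in>carrier R. expand l (\<phi> c \<otimes> s) = \<phi> c \<otimes> expand l s)"
    using assms
  proof (induction l)
    case (Cons p l)
    obtain y g where p: "p = (y, g)" by force
    have l: "expansion l" and y: "y \<in> carrier R" and g: "linear_functional k \<phi> R g"
      using Cons.prems unfolding expansion_def p by auto
    show ?case using Cons.IH[OF l] y p linear_functionalD[OF g] by (simp add: l_distr r_distr m_assoc a_ac)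
  qed simp
  then show "s \<in> carrier R \<Longrightarrow> expand l s \<in> carrier R"
    "s \<in> carrier R \<Longrightarrow> t \<in> carrier R \<Longrightarrow> expand l (s \<oplus> t) = expand l s \<oplus> expand l t"
    "c \<in> carrier k \<Longrightarrow> s \<in> carrier R \<Longrightarrow> expand l (\<phi> c \<otimes> s) = \<phi> c \<otimes> expand l s" by blast+
qed

text \<open>Finitely many vectors can be recovered from the values of finitely many functionals, a
  local substitute for a base. One vector is added at a time: its residue \<open>v\<close> is zero
  or is detected by a functional \<open>g\<close> with \<open>g v = 1\<close>.\<close>

lemma expansion_exists:
  assumes "finite F" "F \<subseteq> carrier R"
  shows "\<exists>l. expansion l \<and> (\<forall>s\<in>F. expand l s = s)"
  using assms
proof (induction F rule: finite_induct)
  case empty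
  then show ?case by (intro exI[of _ "[]"]) (simp add: expansion_def)
next
  case (insert s F)
  then obtain l where l: "expansion l" "\<And>s. s \<in> F \<Longrightarrow> expand l s = s" by auto
  have s: "s \<in> carrier R" using insert by simp
  note ep = expand_props[OF l(1)]
  define v where "v = s \<ominus> expand l s"
  have v: "v \<in> carrier R" unfolding v_def using s ep by simp
  have es: "v \<oplus> expand l s = s" unfolding v_def using s ep(1) by (simp add: a_minus_def a_assoc l_neg)
  show ?case
  proof (cases "v = \<zero>")
    case True
    then have "expand l s = s" using es ep(1)[OF s] by simp
    then show ?thesis using l by auto
  next
    case False
    from functional_exists[OF v this] obtain g where g: "linear_functional k \<phi> R g" "g v = \<one>\<^bsub>k\<^esub>" .
    \<comment> \<open>Composed with \<open>x - expand l x\<close> the functional vanishes on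
      \<open>F\<close>, where \<open>l\<close> is already exact, and takes the value 1 at
      \<open>s\<close>; the new term supplies exactly the residue.\<close>
    let ?g = "\<lambda>x. g (x \<ominus> expand l x)"
    have "linear_functional k \<phi> R ?g"
      unfolding linear_functional_def
    proof (intro conjI ballI)
      fix x y assume x: "x \<in> carrier R"
      show "?g x \<in> carrier k" using x ep linear_functionalD(1)[OF g(1)] by simp
      assume y: "y \<in> carrier R"
      have "x \<oplus> y \<ominus> expand l (x \<oplus> y) = (x \<ominus> expand l x) \<oplus> (y \<ominus> expand l y)"
        using x y ep by (simp add: a_minus_def minus_add a_ac)
      then show "?g (x \<oplus> y) = ?g x \<oplus>\<^bsub>k\<^esub> ?g y" using x y ep linear_functionalD(2)[OF g(1)] by simp
    next
      fix c x assume x: "c \<in> carrier k" "x \<in> carrier R"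
      have "\<phi> c \<otimes> x \<ominus> expand l (\<phi> c \<otimes> x) = \<phi> c \<otimes> (x \<ominus> expand l x)"
        using x ep by (simp add: a_minus_def r_distr r_minus)
      then show "?g (\<phi> c \<otimes> x) = c \<otimes>\<^bsub>k\<^esub> ?g x" using x ep linear_functionalD(3)[OF g(1)] by simp
    qed
    then have "expansion ((v, ?g) # l)" using l(1) v unfolding expansion_def by simp
    moreover have "expand ((v, ?g) # l) x = x" if "x \<in> insert s F" for x
    proof (cases "x \<in> F")
      case True
      then have "x \<in> carrier R" using insert by auto
      then show ?thesis using l(2)[OF True] functional_zero[OF g(1)] v by (simp add: a_minus_def r_neg)
    next
      case False
      then have "x = s" using that by simp
      then show ?thesis using es v g(2) unfolding v_def[symmetric] by (simp add: v_def[symmetric])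
    qed
    ultimately show ?thesis by blast
  qed
qed

end

section \<open>Slices and the finite sums that express a tensor through them\<close>

context tensor_algebras
begin

abbreviation "functional \<equiv> linear_functional k \<psi> S"

text \<open>The map \<open>id \<otimes> g\<close> for a functional \<open>g\<close> on \<open>S\<close>, with values in \<open>R \<otimes> k = R\<close>.\<close>

definition slice :: "('b \<Rightarrow> 'k) \<Rightarrow> ('a \<times> 'b \<Rightarrow>\<^sub>0 int) set \<Rightarrow> 'a"
  where "slice g = lift R (\<lambda>r s. \<phi> (g s) \<otimes>\<^bsub>R\<^esub> r)"

lemma
  assumes g: "functional g"
  shows slice_pt: "r \<in> carrier R \<Longrightarrow> s \<in> carrier S \<Longrightarrow> slice g (pt r s) = \<phi> (g s) \<otimes>\<^bsub>R\<^esub> r"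
    and slice_closed: "x \<in> carrier T \<Longrightarrow> slice g x \<in> carrier R"
    and slice_add: "x \<in> carrier T \<Longrightarrow> y \<in> carrier T \<Longrightarrow> slice g (x \<oplus>\<^bsub>T\<^esub> y) = slice g x \<oplus>\<^bsub>R\<^esub> slice g y"
proof -
  note [simp] = linear_functionalD[OF g]
  have B: "balanced k \<phi> R \<psi> S R (\<lambda>r s. \<phi> (g s) \<otimes>\<^bsub>R\<^esub> r)"
    unfolding balanced_def by (auto simp: R.l_distr R.r_distr R.m_assoc R.m_lcomm)
  show "r \<in> carrier R \<Longrightarrow> s \<in> carrier S \<Longrightarrow> slice g (pt r s) = \<phi> (g s) \<otimes>\<^bsub>R\<^esub> r"
    "x \<in> carrier T \<Longrightarrow> slice g x \<in> carrier R"
    "x \<in> carrier T \<Longrightarrow> y \<in> carrier T \<Longrightarrow> slice g (x \<oplus>\<^bsub>T\<^esub> y) = slice g x \<oplus>\<^bsub>R\<^esub> slice g y"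
    unfolding slice_def
    using lift_pt[OF R.abelian_group_axioms B] lift_closed[OF R.abelian_group_axioms B]
      lift_add[OF R.abelian_group_axioms B] by auto
qed

text \<open>The second factor is absorbed by the functional. A condition imposed on all slices of a
  tensor is therefore stable under multiplication by \<open>1 \<otimes> s\<close>.\<close>

lemma slice_mult:
  assumes g: "functional g" and rs: "r \<in> carrier R" "s \<in> carrier S" and z: "z \<in> carrier T"
  shows "slice g (pt r s \<otimes>\<^bsub>T\<^esub> z) = r \<otimes>\<^bsub>R\<^esub> slice (\<lambda>x. g (s \<otimes>\<^bsub>S\<^esub> x)) z"
proof -
  note g' = S.functional_mult[OF g rs(2)]
  note [simp] = linear_functionalD[OF g]
  show ?thesis
    using z
    by (induction z rule: tensor_induct)
      (use rs in \<open>simp_all add: T.r_distr R.r_distr slice_add[OF g] slice_add[OF g'] slice_closed[OF g']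
        pt_mult slice_pt[OF g] slice_pt[OF g'] R.m_lcomm\<close>)
qed

lemma slice_zero: "functional g \<Longrightarrow> slice g \<zero>\<^bsub>T\<^esub> = \<zero>\<^bsub>R\<^esub>"
  using slice_pt[of g "\<zero>\<^bsub>R\<^esub>" "\<zero>\<^bsub>S\<^esub>"] linear_functionalD(1)[of k \<psi> S g] by simp

definition slices :: "('a \<times> 'b \<Rightarrow>\<^sub>0 int) set \<Rightarrow> 'a set"
  where "slices z = {slice g z | g. functional g}"

lemma slices_closed: "z \<in> carrier T \<Longrightarrow> slices z \<subseteq> carrier R"
  unfolding slices_def using slice_closed by auto

text \<open>This is \<open>id \<otimes> expand l\<close>, written so that the first factors are
  slices of \<open>z\<close>.\<close>

fun expand_l :: "('b \<times> ('b \<Rightarrow> 'k)) list \<Rightarrow> ('a \<times> 'b \<Rightarrow>\<^sub>0 int) set \<Rightarrow> ('a \<times> 'b \<Rightarrow>\<^sub>0 int) set"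
  where "expand_l [] z = \<zero>\<^bsub>T\<^esub>" | "expand_l ((y, g) # l) z = pt (slice g z) y \<oplus>\<^bsub>T\<^esub> expand_l l z"

lemma expand_l_props:
  assumes "S.expansion l"
  shows "x \<in> carrier T \<Longrightarrow> expand_l l x \<in> carrier T"
    "x \<in> carrier T \<Longrightarrow> y \<in> carrier T \<Longrightarrow> expand_l l (x \<oplus>\<^bsub>T\<^esub> y) = expand_l l x \<oplus>\<^bsub>T\<^esub> expand_l l y"
    "r \<in> carrier R \<Longrightarrow> s \<in> carrier S \<Longrightarrow> expand_l l (pt r s) = pt r (S.expand l s)"
proof -
  have "(\<forall>x\<in>carrier T. expand_l l x \<in> carrier T) \<and>
    (\<forall>x\<in>carrier T. \<forall>y\<in>carrier T. expand_l l (x \<oplus>\<^bsub>T\<^esub> y) = expand_l l x \<oplus>\<^bsub>T\<^esub> expand_l l y) \<and>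
    (\<forall>r\<in>carrier R. \<forall>s\<in>carrier S. expand_l l (pt r s) = pt r (S.expand l s))"
    using assms
  proof (induction l)
    case (Cons p l)
    obtain y g where p: "p = (y, g)" by force
    have l: "S.expansion l" and y: "y \<in> carrier S" and g: "functional g"
      using Cons.prems unfolding S.expansion_def p by auto
    show ?case
      using Cons.IH[OF l] y p linear_functionalD[OF g] slice_closed[OF g] slice_add[OF g] slice_pt[OF g] S.expand_props[OF l]
      by (simp add: pt_add pt_scale T.a_ac)
  qed simp
  then show "x \<in> carrier T \<Longrightarrow> expand_l l x \<in> carrier T"
    "x \<in> carrier T \<Longrightarrow> y \<in> carrier T \<Longrightarrow> expand_l l (x \<oplus>\<^bsub>T\<^esub> y) = expand_l l x \<oplus>\<^bsub>T\<^esub> expand_l l y"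
    "r \<in> carrier R \<Longrightarrow> s \<in> carrier S \<Longrightarrow> expand_l l (pt r s) = pt r (S.expand l s)" by blast+
qed

text \<open>\<open>F\<close> collects the right factors in an expression of \<open>z\<close> as a
  sum of pure tensors; \<open>id \<otimes> expand l\<close> fixes \<open>z\<close> once
  \<open>expand l\<close> fixes these.\<close>

lemma finite_rank:
  assumes "z \<in> carrier T"
  shows "\<exists>F. finite F \<and> F \<subseteq> carrier S \<and> (\<forall>l. S.expansion l \<longrightarrow> (\<forall>s\<in>F. S.expand l s = s) \<longrightarrow> expand_l l z = z)"
  using assms
proof (induction z rule: tensor_induct)
  case (pure r s)
  then show ?case using expand_l_props(3) by (intro exI[of _ "{s}"]) auto
next
  case (add x y)
  then obtain F G where "finite F" "F \<subseteq> carrier S" "finite G" "G \<subseteq> carrier S"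
    "\<And>l. S.expansion l \<Longrightarrow> \<forall>s\<in>F. S.expand l s = s \<Longrightarrow> expand_l l x = x"
    "\<And>l. S.expansion l \<Longrightarrow> \<forall>s\<in>G. S.expand l s = s \<Longrightarrow> expand_l l y = y" by metis
  then show ?case using add(1,2) expand_l_props(2) by (intro exI[of _ "F \<union> G"]) auto
qed

text \<open>For an \<open>l\<close> that is exact on the right factors of \<open>z\<close>, the
  identity \<open>expand_l l z = z\<close> writes \<open>z\<close> as a sum of terms
  \<open>pt (slice g z) y\<close>. The form of an induction rule avoids explicit sums, and the
  finiteness of \<open>F\<close> later yields finite generating sets.\<close>

lemma slice_support:
  assumes z: "z \<in> carrier T"
  obtains F where "finite F" "F \<subseteq> slices z"
    "\<And>P. P \<zero>\<^bsub>T\<^esub> \<Longrightarrow> (\<And>s y. s \<in> F \<Longrightarrow> y \<in> carrier S \<Longrightarrow> P (pt s y)) \<Longrightarrow>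
      (\<And>x y. x \<in> carrier T \<Longrightarrow> y \<in> carrier T \<Longrightarrow> P x \<Longrightarrow> P y \<Longrightarrow> P (x \<oplus>\<^bsub>T\<^esub> y)) \<Longrightarrow> P z"
proof -
  obtain G where G: "finite G" "G \<subseteq> carrier S" "\<And>l. S.expansion l \<Longrightarrow> \<forall>s\<in>G. S.expand l s = s \<Longrightarrow> expand_l l z = z"
    using finite_rank[OF z] by blast
  obtain l where l: "S.expansion l" "\<forall>s\<in>G. S.expand l s = s" using S.expansion_exists[OF G(1,2)] by blast
  have lz: "expand_l l z = z" using G(3) l by blast
  define F where "F = (\<lambda>(y, g). slice g z) ` set l"
  have "finite F" unfolding F_def by simp
  moreover have "F \<subseteq> slices z" unfolding F_def slices_def using l(1) by (auto simp: S.expansion_def)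
  moreover have "P z" if P: "P \<zero>\<^bsub>T\<^esub>" "\<And>s y. s \<in> F \<Longrightarrow> y \<in> carrier S \<Longrightarrow> P (pt s y)"
    "\<And>x y. x \<in> carrier T \<Longrightarrow> y \<in> carrier T \<Longrightarrow> P x \<Longrightarrow> P y \<Longrightarrow> P (x \<oplus>\<^bsub>T\<^esub> y)" for P
  proof -
    have "P (expand_l l' z)" if "set l' \<subseteq> set l" for l'
      using that
    proof (induction l')
      case Nil
      then show ?case using P(1) by simp
    next
      case (Cons p l')
      obtain y g where p: "p = (y, g)" by force
      have "slice g z \<in> F" unfolding F_def using Cons.prems p by force
      moreover have "y \<in> carrier S" "S.expansion l'" "functional g"
        using l(1) Cons.prems p by (auto simp: S.expansion_def)
      ultimately show ?case using Cons p P(2,3) expand_l_props(1)[of l' z] z slice_closed by simp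
    qed
    then show ?thesis using lz by force
  qed
  ultimately show ?thesis by (rule that)
qed

lemma slices_induct [consumes 1, case_names zero pure add]:
  assumes z: "z \<in> carrier T"
    and P: "P \<zero>\<^bsub>T\<^esub>" "\<And>s y. s \<in> slices z \<Longrightarrow> y \<in> carrier S \<Longrightarrow> P (pt s y)"
      "\<And>x y. x \<in> carrier T \<Longrightarrow> y \<in> carrier T \<Longrightarrow> P x \<Longrightarrow> P y \<Longrightarrow> P (x \<oplus>\<^bsub>T\<^esub> y)"
  shows "P z"
proof (rule slice_support[OF z])
  fix F assume F: "F \<subseteq> slices z"
    and supp: "\<And>P. P \<zero>\<^bsub>T\<^esub> \<Longrightarrow> (\<And>s y. s \<in> F \<Longrightarrow> y \<in> carrier S \<Longrightarrow> P (pt s y)) \<Longrightarrow>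
      (\<And>x y. x \<in> carrier T \<Longrightarrow> y \<in> carrier T \<Longrightarrow> P x \<Longrightarrow> P y \<Longrightarrow> P (x \<oplus>\<^bsub>T\<^esub> y)) \<Longrightarrow> P z"
  show "P z" by (rule supp[of P]) (use F P in blast)+
qed

text \<open>Slices separate tensors. For a subalgebra \<open>A\<close> of \<open>R\<close> this is
  how the map from \<open>A \<otimes> K\<close> to \<open>R \<otimes> K\<close> is seen to be
  injective.\<close>

lemma slices_zero_imp:
  assumes "z \<in> carrier T" "\<And>g. functional g \<Longrightarrow> slice g z = \<zero>\<^bsub>R\<^esub>"
  shows "z = \<zero>\<^bsub>T\<^esub>"
  using assms(1) by (induction rule: slices_induct) (use assms(2) in \<open>auto simp: slices_def\<close>)

end

section \<open>Separable algebras\<close>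

text \<open>The generators form a set, possibly infinite as for \<sigma>(A). The rules never mention
  the carrier of \<open>R\<close>, so a span is the same in a subalgebra and in the whole
  ring.\<close>

inductive_set lin_gen :: "('k, 'l) ring_scheme \<Rightarrow> ('k \<Rightarrow> 'a) \<Rightarrow> ('a, 'm) ring_scheme \<Rightarrow> 'a set \<Rightarrow> 'a set"
  for k \<phi> R F where
    zero: "\<zero>\<^bsub>R\<^esub> \<in> lin_gen k \<phi> R F"
  | scale: "f \<in> F \<Longrightarrow> c \<in> carrier k \<Longrightarrow> \<phi> c \<otimes>\<^bsub>R\<^esub> f \<in> lin_gen k \<phi> R F"
  | add: "x \<in> lin_gen k \<phi> R F \<Longrightarrow> y \<in> lin_gen k \<phi> R F \<Longrightarrow> x \<oplus>\<^bsub>R\<^esub> y \<in> lin_gen k \<phi> R F"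

inductive_set alg_gen :: "('k, 'l) ring_scheme \<Rightarrow> ('k \<Rightarrow> 'a) \<Rightarrow> ('a, 'm) ring_scheme \<Rightarrow> 'a set \<Rightarrow> 'a set"
  for k \<phi> R F where
    str: "c \<in> carrier k \<Longrightarrow> \<phi> c \<in> alg_gen k \<phi> R F"
  | incl: "f \<in> F \<Longrightarrow> f \<in> alg_gen k \<phi> R F"
  | add: "x \<in> alg_gen k \<phi> R F \<Longrightarrow> y \<in> alg_gen k \<phi> R F \<Longrightarrow> x \<oplus>\<^bsub>R\<^esub> y \<in> alg_gen k \<phi> R F"
  | mult: "x \<in> alg_gen k \<phi> R F \<Longrightarrow> y \<in> alg_gen k \<phi> R F \<Longrightarrow> x \<otimes>\<^bsub>R\<^esub> y \<in> alg_gen k \<phi> R F"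

lemma lin_gen_mono_ops:
  assumes "\<zero>\<^bsub>R\<^esub> = \<zero>\<^bsub>R'\<^esub>" "\<And>x y. x \<otimes>\<^bsub>R\<^esub> y = x \<otimes>\<^bsub>R'\<^esub> y" "\<And>x y. x \<oplus>\<^bsub>R\<^esub> y = x \<oplus>\<^bsub>R'\<^esub> y"
  shows "lin_gen k \<phi> R F \<subseteq> lin_gen k \<phi> R' F"
proof
  fix x assume "x \<in> lin_gen k \<phi> R F"
  then show "x \<in> lin_gen k \<phi> R' F"
    by induction (simp_all add: assms lin_gen.intros)
qed

lemma lin_gen_carrier_update [simp]: "lin_gen k \<phi> (R\<lparr>carrier := A\<rparr>) F = lin_gen k \<phi> R F"
  by (intro equalityI lin_gen_mono_ops) simp_all

lemma alg_gen_carrier_update [simp]: "alg_gen k \<phi> (R\<lparr>carrier := A\<rparr>) F = alg_gen k \<phi> R F"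
proof (intro equalityI subsetI)
  fix x assume "x \<in> alg_gen k \<phi> (R\<lparr>carrier := A\<rparr>) F"
  then show "x \<in> alg_gen k \<phi> R F"
    by (induction rule: alg_gen.induct) (auto intro: alg_gen.intros)
next
  fix x assume "x \<in> alg_gen k \<phi> R F"
  then show "x \<in> alg_gen k \<phi> (R\<lparr>carrier := A\<rparr>) F"
    by (induction rule: alg_gen.induct)
      (use alg_gen.intros[where R = "R\<lparr>carrier := A\<rparr>" and k = k and F = F and \<phi> = \<phi>] in auto)
qed

text \<open>The element \<open>p\<close> is a separability idempotent of \<open>A\<close> over \<open>k\<close>.\<close>

definition separable_algebra :: "('k, 'l) ring_scheme \<Rightarrow> ('k \<Rightarrow> 'a) \<Rightarrow> ('a, 'm) ring_scheme \<Rightarrow> bool"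
  where "separable_algebra k \<phi> A \<longleftrightarrow>
    (\<exists>p\<in>carrier (tensor_ring k \<phi> A \<phi> A).
       tensor_lift k \<phi> A \<phi> A A (\<lambda>a b. a \<otimes>\<^bsub>A\<^esub> b) p = \<one>\<^bsub>A\<^esub> \<and>
       (\<forall>a\<in>carrier A. pure_tensor k \<phi> A \<phi> A a \<one>\<^bsub>A\<^esub> \<otimes>\<^bsub>tensor_ring k \<phi> A \<phi> A\<^esub> p =
          pure_tensor k \<phi> A \<phi> A \<one>\<^bsub>A\<^esub> a \<otimes>\<^bsub>tensor_ring k \<phi> A \<phi> A\<^esub> p))"

section \<open>Spans, generated subalgebras and separability idempotents\<close>

context k_algebra
begin

lemma lin_gen_least: "lin_closed W \<Longrightarrow> F \<subseteq> W \<Longrightarrow> lin_gen k \<phi> R F \<subseteq> W"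
proof
  fix x assume W: "lin_closed W" "F \<subseteq> W" and "x \<in> lin_gen k \<phi> R F"
  from this(3) show "x \<in> W" by induction (use W in \<open>auto simp: lin_closed_def\<close>)
qed

lemma lin_closed_lin_gen:
  assumes "F \<subseteq> carrier R"
  shows "lin_closed (lin_gen k \<phi> R F)"
proof -
  have c: "lin_gen k \<phi> R F \<subseteq> carrier R"
    by (rule lin_gen_least) (use assms in \<open>auto simp: lin_closed_def\<close>)
  have "\<phi> c \<otimes> x \<in> lin_gen k \<phi> R F" if "x \<in> lin_gen k \<phi> R F" "c \<in> carrier k" for c x
    using that
  proof induction
    case zero
    then show ?case by (simp add: lin_gen.zero)
  next
    case (scale f d)
    then have "\<phi> c \<otimes> (\<phi> d \<otimes> f) = \<phi> (c \<otimes>\<^bsub>k\<^esub> d) \<otimes> f" using assms by (auto simp: m_assoc)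
    then show ?case using scale lin_gen.scale by (metis k.m_closed)
  next
    case (add x y)
    then have "x \<in> carrier R" "y \<in> carrier R" using c by auto
    then have "\<phi> c \<otimes> (x \<oplus> y) = \<phi> c \<otimes> x \<oplus> \<phi> c \<otimes> y" using add by (simp add: r_distr)
    then show ?case using add lin_gen.add by metis
  qed
  then show ?thesis unfolding lin_closed_def using c by (simp add: lin_gen.zero lin_gen.add)
qed

lemma lin_gen_incl: "F \<subseteq> carrier R \<Longrightarrow> F \<subseteq> lin_gen k \<phi> R F"
proof
  fix f assume f: "F \<subseteq> carrier R" "f \<in> F"
  then show "f \<in> lin_gen k \<phi> R F"
    using lin_gen.scale[where \<phi> = \<phi> and R = R, OF f(2) k.one_closed] by auto
qed

lemma lin_gen_closed: "F \<subseteq> carrier R \<Longrightarrow> lin_gen k \<phi> R F \<subseteq> carrier R"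
  using lin_closed_lin_gen unfolding lin_closed_def by blast

lemma lin_closed_subring: "subring A R \<Longrightarrow> \<phi> ` carrier k \<subseteq> A \<Longrightarrow> lin_closed A"
  unfolding lin_closed_def using subringE[of A R] by (auto simp: image_subset_iff)

lemma alg_gen_least: "subring A R \<Longrightarrow> \<phi> ` carrier k \<subseteq> A \<Longrightarrow> F \<subseteq> A \<Longrightarrow> alg_gen k \<phi> R F \<subseteq> A"
proof
  fix x assume A: "subring A R" "\<phi> ` carrier k \<subseteq> A" "F \<subseteq> A" and "x \<in> alg_gen k \<phi> R F"
  from this(4) show "x \<in> A" by induction (use A subringE(6,7)[OF A(1)] in auto)
qed

lemma alg_gen_subring:
  assumes "F \<subseteq> carrier R"
  shows "subring (alg_gen k \<phi> R F) R" "\<phi> ` carrier k \<subseteq> alg_gen k \<phi> R F" "F \<subseteq> alg_gen k \<phi> R F"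
proof -
  have c: "alg_gen k \<phi> R F \<subseteq> carrier R"
    by (rule alg_gen_least) (use assms carrier_is_subring in auto)
  show "subring (alg_gen k \<phi> R F) R"
  proof (rule subringI)
    show "\<one> \<in> alg_gen k \<phi> R F" using alg_gen.str[where c = "\<one>\<^bsub>k\<^esub>" and k = k and \<phi> = \<phi> and R = R and F = F] by simp
  next
    fix x assume x: "x \<in> alg_gen k \<phi> R F"
    have "\<phi> (\<ominus>\<^bsub>k\<^esub> \<one>\<^bsub>k\<^esub>) \<otimes> x \<in> alg_gen k \<phi> R F"
      by (intro alg_gen.mult alg_gen.str x) simp
    then show "\<ominus> x \<in> alg_gen k \<phi> R F" using str_minus_one[of x] x c by auto
  qed (use c in \<open>auto intro: alg_gen.intros\<close>)
qed (auto intro: alg_gen.intros)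

lemma k_subalgebra:
  assumes "subring A R" "\<phi> ` carrier k \<subseteq> A"
  shows "k_algebra k \<phi> (R\<lparr>carrier := A\<rparr>)"
proof -
  interpret A: cring "R\<lparr>carrier := A\<rparr>"
    using subcringI'[OF assms(1)] subcring_iff subringE(1)[OF assms(1)] by blast
  show ?thesis
    by unfold_locales (use str_hom assms(2) in \<open>auto simp: ring_hom_def\<close>)
qed

interpretation sq: tensor_algebras k \<phi> R \<phi> R
  by unfold_locales

lemma mu:
  shows mu_hom: "sq.lift R (\<lambda>a b. a \<otimes> b) \<in> ring_hom sq.T R"
    and mu_pt: "a \<in> carrier R \<Longrightarrow> b \<in> carrier R \<Longrightarrow> sq.lift R (\<lambda>a b. a \<otimes> b) (sq.pt a b) = a \<otimes> b"
proof -
  have id: "(\<lambda>x. x) \<in> ring_hom R R" by (rule ring_hom_memI) auto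
  show "sq.lift R (\<lambda>a b. a \<otimes> b) \<in> ring_hom sq.T R"
    "a \<in> carrier R \<Longrightarrow> b \<in> carrier R \<Longrightarrow> sq.lift R (\<lambda>a b. a \<otimes> b) (sq.pt a b) = a \<otimes> b"
    using sq.lift_ring_hom[OF cring_axioms id id] by auto
qed

text \<open>The elements \<open>a\<close> with \<open>(a \<otimes> 1) p = (1 \<otimes> a) p\<close>
  form a subalgebra: scalars pass through the tensor sign, and for a product
  \<open>x \<otimes> 1\<close> is exchanged with \<open>1 \<otimes> y\<close>. Hence it is enough to
  test generators.\<close>

lemma separableI:
  assumes p: "p \<in> carrier sq.T" "sq.lift R (\<lambda>a b. a \<otimes> b) p = \<one>"
    and F: "carrier R \<subseteq> alg_gen k \<phi> R F" "F \<subseteq> carrier R"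
    and comm: "\<And>a. a \<in> F \<Longrightarrow> sq.pt a \<one> \<otimes>\<^bsub>sq.T\<^esub> p = sq.pt \<one> a \<otimes>\<^bsub>sq.T\<^esub> p"
  shows "separable_algebra k \<phi> R"
proof -
  have "a \<in> carrier R \<and> sq.pt a \<one> \<otimes>\<^bsub>sq.T\<^esub> p = sq.pt \<one> a \<otimes>\<^bsub>sq.T\<^esub> p" if "a \<in> alg_gen k \<phi> R F" for a
    using that
  proof induction
    case (str c)
    then show ?case using sq.pt_str by simp
  next
    case (incl f)
    then show ?case using comm F by auto
  next
    case (add x y)
    then show ?case using p(1) by (simp add: sq.pt_add sq.T.l_distr)
  next
    case (mult x y)
    then have xy: "x \<in> carrier R" "y \<in> carrier R" by auto
    have "sq.pt (x \<otimes> y) \<one> \<otimes>\<^bsub>sq.T\<^esub> p = sq.pt x \<one> \<otimes>\<^bsub>sq.T\<^esub> (sq.pt y \<one> \<otimes>\<^bsub>sq.T\<^esub> p)"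
      using xy p(1) by (simp add: sq.pt_mult sq.T.m_assoc[symmetric])
    also have "\<dots> = sq.pt x \<one> \<otimes>\<^bsub>sq.T\<^esub> (sq.pt \<one> y \<otimes>\<^bsub>sq.T\<^esub> p)" using mult by simp
    also have "\<dots> = sq.pt \<one> y \<otimes>\<^bsub>sq.T\<^esub> (sq.pt x \<one> \<otimes>\<^bsub>sq.T\<^esub> p)" using xy p(1) by (simp add: sq.T.m_lcomm)
    also have "\<dots> = sq.pt \<one> y \<otimes>\<^bsub>sq.T\<^esub> (sq.pt \<one> x \<otimes>\<^bsub>sq.T\<^esub> p)" using mult by simp
    also have "\<dots> = sq.pt \<one> (x \<otimes> y) \<otimes>\<^bsub>sq.T\<^esub> p"
      using xy p(1) by (simp add: sq.pt_mult sq.T.m_assoc[symmetric] m_comm)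
    finally show ?case using mult by simp
  qed
  then show ?thesis unfolding separable_algebra_def using p F(1) by blast
qed

lemma separableE:
  assumes "separable_algebra k \<phi> R"
  obtains p where "p \<in> carrier sq.T" "sq.lift R (\<lambda>a b. a \<otimes> b) p = \<one>"
    "\<And>a. a \<in> carrier R \<Longrightarrow> sq.pt a \<one> \<otimes>\<^bsub>sq.T\<^esub> p = sq.pt \<one> a \<otimes>\<^bsub>sq.T\<^esub> p"
  using assms unfolding separable_algebra_def by blast

text \<open>A separability idempotent commutes with \<open>A \<otimes> A\<close>, so its slices span an ideal; that
  ideal contains the image \<open>1\<close> of the idempotent under multiplication.\<close>

lemma separable_finite:
  assumes "separable_algebra k \<phi> R"
  obtains F where "finite F" "F \<subseteq> carrier R" "carrier R \<subseteq> lin_gen k \<phi> R F"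
proof -
  obtain p where p: "p \<in> carrier sq.T" "sq.lift R (\<lambda>a b. a \<otimes> b) p = \<one>"
    and comm: "\<And>a. a \<in> carrier R \<Longrightarrow> sq.pt a \<one> \<otimes>\<^bsub>sq.T\<^esub> p = sq.pt \<one> a \<otimes>\<^bsub>sq.T\<^esub> p"
    using separableE[OF assms] by metis
  obtain F where F: "finite F" "F \<subseteq> sq.slices p" and
    supp: "\<And>P. P \<zero>\<^bsub>sq.T\<^esub> \<Longrightarrow> (\<And>s y. s \<in> F \<Longrightarrow> y \<in> carrier R \<Longrightarrow> P (sq.pt s y)) \<Longrightarrow>
      (\<And>x y. x \<in> carrier sq.T \<Longrightarrow> y \<in> carrier sq.T \<Longrightarrow> P x \<Longrightarrow> P y \<Longrightarrow> P (x \<oplus>\<^bsub>sq.T\<^esub> y)) \<Longrightarrow> P p"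
    using sq.slice_support[OF p(1)] by metis
  have FR: "F \<subseteq> carrier R" using F(2) sq.slices_closed[OF p(1)] by blast
  let ?W = "lin_gen k \<phi> R F"
  have W: "?W \<subseteq> carrier R" "\<zero> \<in> ?W" "\<And>x y. x \<in> ?W \<Longrightarrow> y \<in> ?W \<Longrightarrow> x \<oplus> y \<in> ?W"
    "\<And>c x. c \<in> carrier k \<Longrightarrow> x \<in> ?W \<Longrightarrow> \<phi> c \<otimes> x \<in> ?W"
    using lin_closed_lin_gen[OF FR] unfolding lin_closed_def by auto
  have slW: "sq.slice g p \<in> ?W" if g: "sq.functional g" for g
  proof (rule supp)
    fix s y assume s: "s \<in> F" "y \<in> carrier R"
    then show "sq.slice g (sq.pt s y) \<in> ?W"
      using lin_gen.scale[where \<phi> = \<phi> and R = R, OF s(1) linear_functionalD(1)[OF g s(2)]] sq.slice_pt[OF g, of s y] FR by auto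
  qed (use W g in \<open>simp_all add: sq.slice_zero sq.slice_add\<close>)
  have mul: "a \<otimes> s \<in> ?W" if a: "a \<in> carrier R" and s: "s \<in> F" for a s
  proof -
    obtain g where g: "sq.functional g" "s = sq.slice g p" using s F(2) unfolding sq.slices_def by blast
    \<comment> \<open>With the left factor \<open>a \<otimes> 1\<close>, \<open>slice_mult\<close>
      produces the functional \<open>x \<mapsto> g (1 x)\<close>, which agrees with \<open>g\<close>
      only on the carrier; the two slices are still equal.\<close>
    note g1 = functional_mult[OF g(1) one_closed]
    have eq: "sq.slice (\<lambda>x. g (\<one> \<otimes> x)) p = sq.slice g p"
      by (rule sq.additive_eqI[OF sq.slice_add[OF g1] sq.slice_add[OF g(1)] _ p(1)])
        (simp_all add: sq.slice_pt[OF g1] sq.slice_pt[OF g(1)])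
    \<comment> \<open>A multiple of a slice of \<open>p\<close> is a slice of \<open>p\<close> for
      another functional, because \<open>comm\<close> moves \<open>a\<close> from the left factor to
      the right one.\<close>
    have "a \<otimes> s = sq.slice g (sq.pt \<one> a \<otimes>\<^bsub>sq.T\<^esub> p)"
      using sq.slice_mult[OF g(1) a one_closed p(1)] comm[OF a] g(2) eq by simp
    also have "\<dots> = sq.slice (\<lambda>x. g (a \<otimes> x)) p"
      using sq.slice_mult[OF g(1) one_closed a p(1)] sq.slice_closed[OF functional_mult[OF g(1) a] p(1)] by simp
    finally show ?thesis using slW[OF functional_mult[OF g(1) a]] by simp
  qed
  have *: "a \<otimes> sq.lift R (\<lambda>a b. a \<otimes> b) p \<in> ?W" if a: "a \<in> carrier R" for a
  proof (rule supp)
    fix s y assume s: "s \<in> F" "y \<in> carrier R"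
    then have "s \<in> carrier R" using FR by blast
    then have "a \<otimes> (s \<otimes> y) = (a \<otimes> y) \<otimes> s" using a s by (simp add: m_ac)
    then show "a \<otimes> sq.lift R (\<lambda>a b. a \<otimes> b) (sq.pt s y) \<in> ?W"
      using mul[of "a \<otimes> y" s] s a mu_pt[of s y] \<open>s \<in> carrier R\<close> by simp
  next
    fix x y assume "x \<in> carrier sq.T" "y \<in> carrier sq.T"
      "a \<otimes> sq.lift R (\<lambda>a b. a \<otimes> b) x \<in> ?W" "a \<otimes> sq.lift R (\<lambda>a b. a \<otimes> b) y \<in> ?W"
    then show "a \<otimes> sq.lift R (\<lambda>a b. a \<otimes> b) (x \<oplus>\<^bsub>sq.T\<^esub> y) \<in> ?W"
      using W(3) a ring_hom_add[OF mu_hom, of x y] ring_hom_closed[OF mu_hom] by (simp add: r_distr)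
  next
    show "a \<otimes> sq.lift R (\<lambda>a b. a \<otimes> b) \<zero>\<^bsub>sq.T\<^esub> \<in> ?W"
      using ring_hom_zero[OF mu_hom sq.T.ring_axioms ring_axioms] W(2) a by simp
  qed
  have "a \<in> ?W" if "a \<in> carrier R" for a
    using *[OF that] that unfolding p(2) by simp
  then have "carrier R \<subseteq> ?W" by (rule subsetI)
  then show ?thesis by (rule that[OF F(1) FR])
qed

end

text \<open>The idempotent is pushed forward by \<open>f \<otimes> f\<close>, which exists because
  \<open>f\<close> is semilinear along \<open>\<tau>\<close>. The result commutes with
  \<open>f(A)\<close> only, so \<open>B\<close> is shown to be separable when \<open>f(A)\<close>,
  together with other elements that commute, generates it. For base change \<open>\<tau>\<close> is
  the embedding of the fields, for composita the identity.\<close>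

lemma separable_transport:
  assumes "k_algebra k \<phi> A" "k_algebra K \<rho> B"
    and f: "f \<in> ring_hom A B" "\<And>c. c \<in> carrier k \<Longrightarrow> \<tau> c \<in> carrier K" "\<And>c. c \<in> carrier k \<Longrightarrow> f (\<phi> c) = \<rho> (\<tau> c)"
    and sep: "separable_algebra k \<phi> A"
  obtains p where "p \<in> carrier (tensor_ring K \<rho> B \<rho> B)"
    "tensor_lift K \<rho> B \<rho> B B (\<lambda>a b. a \<otimes>\<^bsub>B\<^esub> b) p = \<one>\<^bsub>B\<^esub>"
    "\<And>a. a \<in> carrier A \<Longrightarrow> pure_tensor K \<rho> B \<rho> B (f a) \<one>\<^bsub>B\<^esub> \<otimes>\<^bsub>tensor_ring K \<rho> B \<rho> B\<^esub> p =
      pure_tensor K \<rho> B \<rho> B \<one>\<^bsub>B\<^esub> (f a) \<otimes>\<^bsub>tensor_ring K \<rho> B \<rho> B\<^esub> p"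
proof -
  interpret A: k_algebra k \<phi> A by fact
  interpret B: k_algebra K \<rho> B by fact
  interpret AA: tensor_algebras k \<phi> A \<phi> A by unfold_locales
  interpret BB: tensor_algebras K \<rho> B \<rho> B by unfold_locales
  obtain p where p: "p \<in> carrier AA.T" "AA.lift A (\<lambda>a b. a \<otimes>\<^bsub>A\<^esub> b) p = \<one>\<^bsub>A\<^esub>"
    and comm: "\<And>a. a \<in> carrier A \<Longrightarrow> AA.pt a \<one>\<^bsub>A\<^esub> \<otimes>\<^bsub>AA.T\<^esub> p = AA.pt \<one>\<^bsub>A\<^esub> a \<otimes>\<^bsub>AA.T\<^esub> p"
    using A.separableE[OF sep] by metis
  have l: "(\<lambda>a. BB.pt (f a) \<one>\<^bsub>B\<^esub>) \<in> ring_hom A BB.T"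
    using ring_hom_trans[OF f(1) BB.pt_l_hom] by (simp add: comp_def)
  have r: "(\<lambda>a. BB.pt \<one>\<^bsub>B\<^esub> (f a)) \<in> ring_hom A BB.T"
    using ring_hom_trans[OF f(1) BB.pt_r_hom] by (simp add: comp_def)
  have bal: "BB.pt (f (\<phi> c)) \<one>\<^bsub>B\<^esub> = BB.pt \<one>\<^bsub>B\<^esub> (f (\<phi> c))" if "c \<in> carrier k" for c
    using f(2,3)[OF that] BB.pt_str by simp
  note [simp] = ring_hom_closed[OF f(1)]
  obtain h where h: "h \<in> ring_hom AA.T BB.T"
    "\<And>a b. a \<in> carrier A \<Longrightarrow> b \<in> carrier A \<Longrightarrow> h (AA.pt a b) = BB.pt (f a) (f b)"
    using AA.lift_ring_hom[OF BB.T.cring_axioms l r bal] by (simp add: BB.pt_mult)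
  have "BB.lift B (\<lambda>a b. a \<otimes>\<^bsub>B\<^esub> b) (h x) = f (AA.lift A (\<lambda>a b. a \<otimes>\<^bsub>A\<^esub> b) x)" if "x \<in> carrier AA.T" for x
    using AA.ring_hom_eqI[OF ring_hom_trans[OF h(1) B.mu_hom] ring_hom_trans[OF A.mu_hom f(1)] _ that]
    by (simp add: h(2) B.mu_pt A.mu_pt ring_hom_mult[OF f(1)])
  then have "BB.lift B (\<lambda>a b. a \<otimes>\<^bsub>B\<^esub> b) (h p) = \<one>\<^bsub>B\<^esub>" using p ring_hom_one[OF f(1)] by simp
  moreover have "BB.pt (f a) \<one>\<^bsub>B\<^esub> \<otimes>\<^bsub>BB.T\<^esub> h p = BB.pt \<one>\<^bsub>B\<^esub> (f a) \<otimes>\<^bsub>BB.T\<^esub> h p" if a: "a \<in> carrier A" for a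
    using arg_cong[OF comm[OF a], of h] a p(1)
    by (simp add: ring_hom_mult[OF h(1)] h(2) ring_hom_one[OF f(1)])
  ultimately show ?thesis by (rule that[OF ring_hom_closed[OF h(1) p(1)]])
qed

lemma separable_base_change:
  assumes "k_algebra k \<phi> A" "k_algebra K \<rho> B"
    and f: "f \<in> ring_hom A B" "\<And>c. c \<in> carrier k \<Longrightarrow> \<tau> c \<in> carrier K" "\<And>c. c \<in> carrier k \<Longrightarrow> f (\<phi> c) = \<rho> (\<tau> c)"
    and sep: "separable_algebra k \<phi> A" and gen: "carrier B \<subseteq> alg_gen K \<rho> B (f ` carrier A)"
  shows "separable_algebra K \<rho> B"
proof -
  interpret B: k_algebra K \<rho> B by fact
  obtain p where p: "p \<in> carrier (tensor_ring K \<rho> B \<rho> B)"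
    "tensor_lift K \<rho> B \<rho> B B (\<lambda>a b. a \<otimes>\<^bsub>B\<^esub> b) p = \<one>\<^bsub>B\<^esub>"
    "\<And>a. a \<in> carrier A \<Longrightarrow> pure_tensor K \<rho> B \<rho> B (f a) \<one>\<^bsub>B\<^esub> \<otimes>\<^bsub>tensor_ring K \<rho> B \<rho> B\<^esub> p =
      pure_tensor K \<rho> B \<rho> B \<one>\<^bsub>B\<^esub> (f a) \<otimes>\<^bsub>tensor_ring K \<rho> B \<rho> B\<^esub> p"
    using separable_transport[OF assms(1-6)] by metis
  show ?thesis
    by (rule B.separableI[OF p(1,2) gen]) (use p(3) ring_hom_closed[OF f(1)] in auto)
qed

text \<open>The product of the two transported idempotents commutes with the images of both
  algebras, and multiplication, being a ring homomorphism, sends it to 1.\<close>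

lemma separable_compositum:
  assumes "k_algebra k \<phi> A" "k_algebra k \<phi>' A'" "k_algebra k \<rho> B"
    and f: "f \<in> ring_hom A B" "\<And>c. c \<in> carrier k \<Longrightarrow> f (\<phi> c) = \<rho> c"
    and f': "f' \<in> ring_hom A' B" "\<And>c. c \<in> carrier k \<Longrightarrow> f' (\<phi>' c) = \<rho> c"
    and sep: "separable_algebra k \<phi> A" "separable_algebra k \<phi>' A'"
    and gen: "carrier B \<subseteq> alg_gen k \<rho> B (f ` carrier A \<union> f' ` carrier A')"
  shows "separable_algebra k \<rho> B"
proof -
  interpret B: k_algebra k \<rho> B by fact
  interpret BB: tensor_algebras k \<rho> B \<rho> B by unfold_locales
  obtain p where p: "p \<in> carrier BB.T" "BB.lift B (\<lambda>a b. a \<otimes>\<^bsub>B\<^esub> b) p = \<one>\<^bsub>B\<^esub>"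
    "\<And>a. a \<in> carrier A \<Longrightarrow> BB.pt (f a) \<one>\<^bsub>B\<^esub> \<otimes>\<^bsub>BB.T\<^esub> p = BB.pt \<one>\<^bsub>B\<^esub> (f a) \<otimes>\<^bsub>BB.T\<^esub> p"
    using separable_transport[where \<tau> = "\<lambda>c. c", OF assms(1,3) f(1) _ f(2) sep(1)] by blast
  obtain q where q: "q \<in> carrier BB.T" "BB.lift B (\<lambda>a b. a \<otimes>\<^bsub>B\<^esub> b) q = \<one>\<^bsub>B\<^esub>"
    "\<And>a. a \<in> carrier A' \<Longrightarrow> BB.pt (f' a) \<one>\<^bsub>B\<^esub> \<otimes>\<^bsub>BB.T\<^esub> q = BB.pt \<one>\<^bsub>B\<^esub> (f' a) \<otimes>\<^bsub>BB.T\<^esub> q"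
    using separable_transport[where \<tau> = "\<lambda>c. c", OF assms(2,3) f'(1) _ f'(2) sep(2)] by blast
  note [simp] = ring_hom_closed[OF f(1)] ring_hom_closed[OF f'(1)]
  show ?thesis
  proof (rule B.separableI[OF _ _ gen])
    show "p \<otimes>\<^bsub>BB.T\<^esub> q \<in> carrier BB.T" using p q by simp
    show "BB.lift B (\<lambda>a b. a \<otimes>\<^bsub>B\<^esub> b) (p \<otimes>\<^bsub>BB.T\<^esub> q) = \<one>\<^bsub>B\<^esub>"
      using ring_hom_mult[OF B.mu_hom p(1) q(1)] p q by simp
    show "f ` carrier A \<union> f' ` carrier A' \<subseteq> carrier B" by auto
  next
    fix a assume a: "a \<in> f ` carrier A \<union> f' ` carrier A'"
    then have aB: "a \<in> carrier B" by auto
    from a consider "BB.pt a \<one>\<^bsub>B\<^esub> \<otimes>\<^bsub>BB.T\<^esub> p = BB.pt \<one>\<^bsub>B\<^esub> a \<otimes>\<^bsub>BB.T\<^esub> p" | "BB.pt a \<one>\<^bsub>B\<^esub> \<otimes>\<^bsub>BB.T\<^esub> q = BB.pt \<one>\<^bsub>B\<^esub> a \<otimes>\<^bsub>BB.T\<^esub> q"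
      using p(3) q(3) by blast
    then show "BB.pt a \<one>\<^bsub>B\<^esub> \<otimes>\<^bsub>BB.T\<^esub> (p \<otimes>\<^bsub>BB.T\<^esub> q) = BB.pt \<one>\<^bsub>B\<^esub> a \<otimes>\<^bsub>BB.T\<^esub> (p \<otimes>\<^bsub>BB.T\<^esub> q)"
    proof cases
      case 1
      then show ?thesis using p(1) q(1) aB by (simp add: BB.T.m_assoc[symmetric])
    next
      case 2
      then show ?thesis
        using BB.T.m_lcomm[OF _ p(1) q(1), of "BB.pt a \<one>\<^bsub>B\<^esub>"] BB.T.m_lcomm[OF _ p(1) q(1), of "BB.pt \<one>\<^bsub>B\<^esub> a"] aB by simp
    qed
  qed
qed

section \<open>Descent of separability\<close>

text \<open>Nakayama's lemma without determinants: the generators are eliminated one at a time,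
  while an element \<open>1 + i\<close> with \<open>i \<in> I\<close> multiplies \<open>I\<close>
  into the ideal generated by the remaining ones.\<close>

lemma (in cring) idempotent_ideal_annihilator:
  assumes I: "ideal I R" and D: "finite D" "D \<subseteq> I" "I \<subseteq> Idl D" "D \<subseteq> ideal_prod R I I"
  obtains i where "i \<in> I" "\<And>x. x \<in> I \<Longrightarrow> (\<one> \<oplus> i) \<otimes> x = \<zero>"
proof -
  interpret I: ideal I R by fact
  note Ic = I.Icarr
  have II: "ideal (ideal_prod R I I) R" using ideal_prod_is_ideal[OF I I] .
  have I2: "I \<subseteq> ideal_prod R I I" using D(3) genideal_minimal[OF II D(4)] by blast
  have "\<exists>i\<in>I. \<forall>x\<in>I. (\<one> \<oplus> i) \<otimes> x = \<zero>"
    if "finite E" "E \<subseteq> I" "i \<in> I" "\<forall>x\<in>I. (\<one> \<oplus> i) \<otimes> x \<in> Idl E" for E i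
    using that
  proof (induction E arbitrary: i rule: finite_induct)
    case empty
    have "Idl {} \<subseteq> {\<zero>}" using genideal_minimal[OF zeroideal, of "{}"] by simp
    then show ?case using empty by blast
  next
    case (insert d E)
    have d: "d \<in> I" "d \<in> carrier R" and EI: "E \<subseteq> I" and EC: "E \<subseteq> carrier R" and i: "i \<in> I" "i \<in> carrier R"
      using insert.prems Ic by auto
    interpret E: ideal "Idl E" R using genideal_ideal[OF EC] .
    define y where "y = \<one> \<oplus> i"
    have y: "y \<in> carrier R" unfolding y_def using i by simp
    have "ideal (PIdl d <+> Idl E) R" using add_ideals[OF cgenideal_ideal[OF d(2)] E.ideal_axioms] .
    moreover have "insert d E \<subseteq> PIdl d <+> Idl E"
    proof -
      have "d = d \<oplus> \<zero>" "\<And>e. e \<in> E \<Longrightarrow> e = \<zero> \<oplus> e" using d EC by auto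
      moreover have "d \<in> PIdl d" "\<zero> \<in> PIdl d" "\<zero> \<in> Idl E" "E \<subseteq> Idl E"
        using cgenideal_self[OF d(2)] additive_subgroup.zero_closed[OF ideal.axioms(1)[OF cgenideal_ideal[OF d(2)]]]
          E.zero_closed genideal_self[OF EC] by auto
      ultimately show ?thesis unfolding set_add_def' by blast
    qed
    ultimately have "Idl (insert d E) \<subseteq> PIdl d <+> Idl E" using genideal_minimal by blast
    then have rep: "\<exists>r\<in>carrier R. \<exists>e\<in>Idl E. y \<otimes> x = r \<otimes> d \<oplus> e" if "x \<in> I" for x
      using insert.prems(3) that unfolding set_add_def' cgenideal_def y_def by blast
    \<comment> \<open>Applied to \<open>z = d\<close>, which lies in the product of \<open>I\<close>
      with itself, this gives \<open>(y - c) d \<in> Idl E\<close> with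
      \<open>c \<in> I\<close>.\<close>
    have "\<exists>c\<in>I. y \<otimes> z \<ominus> c \<otimes> d \<in> Idl E" if "z \<in> ideal_prod R I I" for z
      using that
    proof (induction rule: ideal_prod.induct)
      case (prod a b)
      obtain r e where re: "r \<in> carrier R" "e \<in> Idl E" "y \<otimes> b = r \<otimes> d \<oplus> e" using rep[OF prod(2)] by blast
      have c: "a \<in> carrier R" "b \<in> carrier R" "e \<in> carrier R" using prod Ic re(2) E.Icarr by auto
      have "y \<otimes> (a \<otimes> b) = a \<otimes> (y \<otimes> b)" using c y by (simp add: m_lcomm)
      also have "\<dots> = (a \<otimes> r) \<otimes> d \<oplus> a \<otimes> e" unfolding re(3) using c re d by (simp add: r_distr m_assoc)
      finally have "y \<otimes> (a \<otimes> b) \<ominus> (a \<otimes> r) \<otimes> d = a \<otimes> e" using c re d by (simp add: a_minus_def a_ac r_neg r_neg1 r_neg2)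
      moreover have "a \<otimes> r \<in> I" using I.I_r_closed prod re by blast
      ultimately show ?case using E.I_l_closed[OF re(2) c(1)] by metis
    next
      case (sum a b)
      then obtain c c' where cc: "c \<in> I" "y \<otimes> a \<ominus> c \<otimes> d \<in> Idl E" "c' \<in> I" "y \<otimes> b \<ominus> c' \<otimes> d \<in> Idl E" by blast
      have cr: "a \<in> carrier R" "b \<in> carrier R" "c \<in> carrier R" "c' \<in> carrier R"
        using cc Ic sum(1,2) ideal.Icarr[OF II] by auto
      have "(y \<otimes> a \<ominus> c \<otimes> d) \<oplus> (y \<otimes> b \<ominus> c' \<otimes> d) = y \<otimes> (a \<oplus> b) \<ominus> (c \<oplus> c') \<otimes> d"
        using cr y d by (simp add: a_minus_def r_distr l_distr minus_add a_ac)
      then show ?case using E.a_closed[OF cc(2,4)] I.a_closed[OF cc(1,3)] by metis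
    qed
    then obtain c where c: "c \<in> I" "y \<otimes> d \<ominus> c \<otimes> d \<in> Idl E" using I2 d by blast
    have cR: "c \<in> carrier R" using Ic c by blast
    \<comment> \<open>Chosen so that \<open>1 + i' = (y - c) y\<close>: the factor \<open>y\<close>
      brings \<open>x\<close> to the form \<open>r d + e\<close>, and \<open>y - c\<close> then
      moves \<open>d\<close> into \<open>Idl E\<close>.\<close>
    define i' where "i' = i \<oplus> (i \<ominus> c) \<oplus> (i \<ominus> c) \<otimes> i"
    have ic: "i \<ominus> c \<in> I" using i(1) c(1) I.a_inv_closed unfolding a_minus_def by blast
    have i': "i' \<in> I" unfolding i'_def using ic i I.I_r_closed by blast
    have eq: "\<one> \<oplus> i' = (y \<ominus> c) \<otimes> y"
      unfolding i'_def y_def using i cR by (simp add: a_minus_def r_distr l_distr a_ac)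
    have "(\<one> \<oplus> i') \<otimes> x \<in> Idl E" if x: "x \<in> I" for x
    proof -
      obtain r e where re: "r \<in> carrier R" "e \<in> Idl E" "y \<otimes> x = r \<otimes> d \<oplus> e" using rep[OF x] by blast
      have xc: "x \<in> carrier R" "e \<in> carrier R" using x Ic re E.Icarr by auto
      have "(\<one> \<oplus> i') \<otimes> x = (y \<ominus> c) \<otimes> (r \<otimes> d \<oplus> e)"
        unfolding eq re(3)[symmetric] using y cR xc by (simp add: m_assoc)
      also have "\<dots> = r \<otimes> (y \<otimes> d \<ominus> c \<otimes> d) \<oplus> (y \<ominus> c) \<otimes> e"
        using y cR xc d re by (simp add: a_minus_def r_distr l_distr l_minus r_minus m_ac a_ac)
      finally show ?thesis
        using E.a_closed[OF E.I_l_closed[OF c(2) re(1)] E.I_l_closed[OF re(2), of "y \<ominus> c"]] y cR by simp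
    qed
    then show ?case using insert.IH[OF EI i'] by blast
  qed
  from this[OF D(1,2), of \<zero>] obtain i where "i \<in> I" "\<forall>x\<in>I. (\<one> \<oplus> i) \<otimes> x = \<zero>"
    using D(3) I.zero_closed Ic by (auto simp: subset_iff)
  then show ?thesis using that by blast
qed

lemma (in tensor_algebras) slice_diff:
  assumes g: "functional g" and x: "x \<in> carrier T" "y \<in> carrier T"
  shows "slice g (x \<ominus>\<^bsub>T\<^esub> y) = slice g x \<ominus>\<^bsub>R\<^esub> slice g y"
proof -
  have "x = (x \<ominus>\<^bsub>T\<^esub> y) \<oplus>\<^bsub>T\<^esub> y" using x by (simp add: a_minus_def T.a_assoc T.l_neg)
  then have "slice g x = slice g (x \<ominus>\<^bsub>T\<^esub> y) \<oplus>\<^bsub>R\<^esub> slice g y"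
    using slice_add[OF g, of "x \<ominus>\<^bsub>T\<^esub> y" y] x by simp
  then show ?thesis using slice_closed[OF g] x by (simp add: a_minus_def R.a_assoc R.r_neg)
qed

text \<open>Slices in \<open>I\<close> mean that \<open>x\<close> lies in
  \<open>I \<otimes> S\<close>. Writing \<open>x\<close> as a sum of \<open>s \<otimes> t\<close>
  with \<open>s \<in> I\<close> reduces the claim to the product of \<open>s\<close> with a slice of
  \<open>y\<close>.\<close>

lemma (in tensor_algebras) slice_prod_ideal:
  assumes I: "ideal I R" and x: "x \<in> carrier T" "slices x \<subseteq> I" and y: "y \<in> carrier T" "slices y \<subseteq> I"
  shows "slices (x \<otimes>\<^bsub>T\<^esub> y) \<subseteq> ideal_prod R I I"
proof -
  have II: "ideal (ideal_prod R I I) R" using R.ideal_prod_is_ideal[OF I I] .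
  interpret II: ideal "ideal_prod R I I" R by fact
  have "\<forall>g. functional g \<longrightarrow> slice g (x \<otimes>\<^bsub>T\<^esub> y) \<in> ideal_prod R I I"
    using x(1)
  proof (induction rule: slices_induct)
    case zero
    show ?case using y slice_zero II.zero_closed by simp
  next
    case (pure s t)
    have s: "s \<in> I" "s \<in> carrier R" using x(2) slices_closed[OF x(1)] pure by auto
    show ?case
    proof (intro allI impI)
      fix g assume g: "functional g"
      have "slice (\<lambda>x. g (t \<otimes>\<^bsub>S\<^esub> x)) y \<in> I" using y(2) S.functional_mult[OF g pure(2)] unfolding slices_def by blast
      then show "slice g (pt s t \<otimes>\<^bsub>T\<^esub> y) \<in> ideal_prod R I I"
        unfolding slice_mult[OF g s(2) pure(2) y(1)] by (rule ideal_prod.prod[OF s(1)])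
    qed
  next
    case (add u v)
    then show ?case using y by (simp add: T.l_distr slice_add)
  qed
  then show ?thesis unfolding slices_def by blast
qed

text \<open>The difference of the two images of \<open>b \<in> B\<close> in \<open>(A \<otimes> A) \<otimes> K\<close> lies in \<open>I\<^sup>2 \<otimes> K\<close>, where \<open>I\<close> is the
  kernel of multiplication on \<open>A \<otimes> A\<close>: it is killed by the image of the separability
  idempotent of \<open>B\<close>, which is \<open>1\<close> modulo \<open>I\<close>. Hence \<open>I = I\<^sup>2\<close>.\<close>

lemma separable_descent:
  assumes A: "k_algebra k \<phi> A" and K: "k_algebra k \<iota> K" and B: "k_algebra K \<rho> B"
    and sep: "separable_algebra K \<rho> B"
    and j: "j \<in> ring_hom B (tensor_ring k \<phi> A \<iota> K)"
      "\<And>c. c \<in> carrier K \<Longrightarrow> j (\<rho> c) = pure_tensor k \<phi> A \<iota> K \<one>\<^bsub>A\<^esub> c"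
    and F: "finite F" "F \<subseteq> (\<Union>b\<in>carrier B. tensor_algebras.slices k \<phi> A \<iota> K (j b))"
      "carrier A \<subseteq> alg_gen k \<phi> A F"
  shows "separable_algebra k \<phi> A"
proof -
  interpret A: k_algebra k \<phi> A by fact
  interpret K: k_algebra k \<iota> K by fact
  interpret B: k_algebra K \<rho> B by fact
  interpret AK: tensor_algebras k \<phi> A \<iota> K by unfold_locales
  interpret AA: tensor_algebras k \<phi> A \<phi> A by unfold_locales
  interpret BB: tensor_algebras K \<rho> B \<rho> B by unfold_locales
  \<comment> \<open>The square becomes a \<open>k\<close>-algebra through its left factor; by
    \<open>\<eta>'\<close> the right factor gives the same structure.\<close>
  define \<eta> where "\<eta> c = AA.pt (\<phi> c) \<one>\<^bsub>A\<^esub>" for c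
  have "\<eta> \<in> ring_hom k AA.T"
    using ring_hom_trans[OF A.str_hom AA.pt_l_hom] unfolding \<eta>_def comp_def .
  interpret AA': k_algebra k \<eta> AA.T
    by unfold_locales fact
  interpret Q: tensor_algebras k \<eta> AA.T \<iota> K by unfold_locales
  note [simp] = ring_hom_closed[OF j(1)]
  obtain p where p: "p \<in> carrier BB.T" "BB.lift B (\<lambda>a b. a \<otimes>\<^bsub>B\<^esub> b) p = \<one>\<^bsub>B\<^esub>"
    and comm: "\<And>a. a \<in> carrier B \<Longrightarrow> BB.pt a \<one>\<^bsub>B\<^esub> \<otimes>\<^bsub>BB.T\<^esub> p = BB.pt \<one>\<^bsub>B\<^esub> a \<otimes>\<^bsub>BB.T\<^esub> p"
    using B.separableE[OF sep] by metis
  define \<mu> where "\<mu> = AA.lift A (\<lambda>a b. a \<otimes>\<^bsub>A\<^esub> b)"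
  have \<mu>: "\<mu> \<in> ring_hom AA.T A" "\<And>a b. a \<in> carrier A \<Longrightarrow> b \<in> carrier A \<Longrightarrow> \<mu> (AA.pt a b) = a \<otimes>\<^bsub>A\<^esub> b"
    unfolding \<mu>_def using A.mu by auto
  note [simp] = ring_hom_closed[OF \<mu>(1)]
  have \<eta>': "\<eta> c = AA.pt \<one>\<^bsub>A\<^esub> (\<phi> c)" if "c \<in> carrier k" for c
    unfolding \<eta>_def using AA.pt_str that .
  have \<eta>1: "\<eta> c = AA.pt (\<phi> c) \<one>\<^bsub>A\<^esub>" if "c \<in> carrier k" for c
    by (simp only: \<eta>_def)
  have \<mu>\<eta>: "\<mu> (\<eta> c) = \<phi> c" if "c \<in> carrier k" for c using that unfolding \<eta>_def by (simp add: \<mu>)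
  \<comment> \<open>The maps \<open>h1\<close> and \<open>h2\<close> below place \<open>A\<close> in
    the left and in the right factor of the square and fix \<open>K\<close>; \<open>M\<close> is
    \<open>\<mu> \<otimes> id\<close>, a common retraction of both.\<close>
  have l1: "(\<lambda>a. Q.pt (AA.pt a \<one>\<^bsub>A\<^esub>) \<one>\<^bsub>K\<^esub>) \<in> ring_hom A Q.T"
    using ring_hom_trans[OF AA.pt_l_hom Q.pt_l_hom] by (simp add: comp_def)
  have l2: "(\<lambda>a. Q.pt (AA.pt \<one>\<^bsub>A\<^esub> a) \<one>\<^bsub>K\<^esub>) \<in> ring_hom A Q.T"
    using ring_hom_trans[OF AA.pt_r_hom Q.pt_l_hom] by (simp add: comp_def)
  have bal1: "Q.pt (AA.pt (\<phi> c) \<one>\<^bsub>A\<^esub>) \<one>\<^bsub>K\<^esub> = Q.pt \<one>\<^bsub>AA.T\<^esub> (\<iota> c)" if "c \<in> carrier k" for c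
    using Q.pt_str[OF that] unfolding \<eta>_def .
  have bal2: "Q.pt (AA.pt \<one>\<^bsub>A\<^esub> (\<phi> c)) \<one>\<^bsub>K\<^esub> = Q.pt \<one>\<^bsub>AA.T\<^esub> (\<iota> c)" if "c \<in> carrier k" for c
    using Q.pt_str[OF that] unfolding \<eta>'[OF that] .
  define h1 where "h1 = AK.lift Q.T (\<lambda>r s. Q.pt (AA.pt r \<one>\<^bsub>A\<^esub>) \<one>\<^bsub>K\<^esub> \<otimes>\<^bsub>Q.T\<^esub> Q.pt \<one>\<^bsub>AA.T\<^esub> s)"
  define h2 where "h2 = AK.lift Q.T (\<lambda>r s. Q.pt (AA.pt \<one>\<^bsub>A\<^esub> r) \<one>\<^bsub>K\<^esub> \<otimes>\<^bsub>Q.T\<^esub> Q.pt \<one>\<^bsub>AA.T\<^esub> s)"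
  have h1: "h1 \<in> ring_hom AK.T Q.T"
    "\<And>a s. a \<in> carrier A \<Longrightarrow> s \<in> carrier K \<Longrightarrow> h1 (AK.pt a s) = Q.pt (AA.pt a \<one>\<^bsub>A\<^esub>) s"
    unfolding h1_def using AK.lift_ring_hom[OF Q.T.cring_axioms l1 Q.pt_r_hom bal1] by (simp_all add: Q.pt_split)
  have h2: "h2 \<in> ring_hom AK.T Q.T"
    "\<And>a s. a \<in> carrier A \<Longrightarrow> s \<in> carrier K \<Longrightarrow> h2 (AK.pt a s) = Q.pt (AA.pt \<one>\<^bsub>A\<^esub> a) s"
    unfolding h2_def using AK.lift_ring_hom[OF Q.T.cring_axioms l2 Q.pt_r_hom bal2] by (simp_all add: Q.pt_split)
  have lM: "(\<lambda>z. AK.pt (\<mu> z) \<one>\<^bsub>K\<^esub>) \<in> ring_hom AA.T AK.T"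
    using ring_hom_trans[OF \<mu>(1) AK.pt_l_hom] by (simp add: comp_def)
  have balM: "AK.pt (\<mu> (\<eta> c)) \<one>\<^bsub>K\<^esub> = AK.pt \<one>\<^bsub>A\<^esub> (\<iota> c)" if "c \<in> carrier k" for c
    using AK.pt_str[OF that] that by (simp add: \<mu>\<eta>)
  define M where "M = Q.lift AK.T (\<lambda>z s. AK.pt (\<mu> z) \<one>\<^bsub>K\<^esub> \<otimes>\<^bsub>AK.T\<^esub> AK.pt \<one>\<^bsub>A\<^esub> s)"
  have M: "M \<in> ring_hom Q.T AK.T"
    "\<And>z s. z \<in> carrier AA.T \<Longrightarrow> s \<in> carrier K \<Longrightarrow> M (Q.pt z s) = AK.pt (\<mu> z) s"
    unfolding M_def using Q.lift_ring_hom[OF AK.T.cring_axioms lM AK.pt_r_hom balM] by (simp_all add: AK.pt_split)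
  have id: "(\<lambda>x. x) \<in> ring_hom AK.T AK.T" by (rule ring_hom_memI) auto
  have Mh1: "M (h1 x) = x" if "x \<in> carrier AK.T" for x
    using AK.ring_hom_eqI[OF ring_hom_trans[OF h1(1) M(1)] id _ that] by (simp add: h1 M \<mu>)
  have Mh2: "M (h2 x) = x" if "x \<in> carrier AK.T" for x
    using AK.ring_hom_eqI[OF ring_hom_trans[OF h2(1) M(1)] id _ that] by (simp add: h2 M \<mu>)
  have b1: "(\<lambda>b. h1 (j b)) \<in> ring_hom B Q.T" and b2: "(\<lambda>b. h2 (j b)) \<in> ring_hom B Q.T"
    using ring_hom_trans[OF j(1) h1(1)] ring_hom_trans[OF j(1) h2(1)] by (simp_all add: comp_def)
  have balT: "h1 (j (\<rho> c)) = h2 (j (\<rho> c))" if "c \<in> carrier K" for c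
    using that by (simp add: j(2) h1(2) h2(2))
  \<comment> \<open>\<open>h1\<close> and \<open>h2\<close> agree on \<open>K\<close>, so together
    they define a map from \<open>B \<otimes> B\<close> over \<open>K\<close> to
    \<open>(A \<otimes> A) \<otimes> K\<close>.\<close>
  define \<Theta> where "\<Theta> = BB.lift Q.T (\<lambda>a b. h1 (j a) \<otimes>\<^bsub>Q.T\<^esub> h2 (j b))"
  have \<Theta>: "\<Theta> \<in> ring_hom BB.T Q.T"
    "\<And>a b. a \<in> carrier B \<Longrightarrow> b \<in> carrier B \<Longrightarrow> \<Theta> (BB.pt a b) = h1 (j a) \<otimes>\<^bsub>Q.T\<^esub> h2 (j b)"
    unfolding \<Theta>_def using BB.lift_ring_hom[OF Q.T.cring_axioms b1 b2 balT] by simp_all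
  note [simp] = ring_hom_closed[OF h1(1)] ring_hom_closed[OF h2(1)] ring_hom_closed[OF M(1)] ring_hom_closed[OF \<Theta>(1)]
  have M\<Theta>: "M (\<Theta> x) = j (BB.lift B (\<lambda>a b. a \<otimes>\<^bsub>B\<^esub> b) x)" if "x \<in> carrier BB.T" for x
    using BB.ring_hom_eqI[OF ring_hom_trans[OF \<Theta>(1) M(1)] ring_hom_trans[OF B.mu_hom j(1)] _ that]
    by (simp add: \<Theta>(2) B.mu_pt ring_hom_mult[OF M(1)] Mh1 Mh2 ring_hom_mult[OF j(1)])
  \<comment> \<open>\<open>M\<close>, \<open>h1\<close> and \<open>h2\<close> act on the first
    factor alone and thus commute with slicing by functionals on \<open>K\<close>.\<close>
  have slM: "\<mu> (Q.slice g z) = AK.slice g (M z)" if g: "AK.functional g" and z: "z \<in> carrier Q.T" for g z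
    by (rule Q.additive_eqI[where P = "\<lambda>x y. x \<oplus>\<^bsub>A\<^esub> y", OF _ _ _ z])
      (simp_all add: Q.slice_add[OF g] Q.slice_closed[OF g] ring_hom_add[OF \<mu>(1)] ring_hom_add[OF M(1)]
        AK.slice_add[OF g] M(2) Q.slice_pt[OF g] AK.slice_pt[OF g] ring_hom_mult[OF \<mu>(1)] \<mu>\<eta> linear_functionalD[OF g])
  have sl1: "Q.slice g (h1 w) = AA.pt (AK.slice g w) \<one>\<^bsub>A\<^esub>" if g: "AK.functional g" and w: "w \<in> carrier AK.T" for g w
    by (rule AK.additive_eqI[where P = "\<lambda>x y. x \<oplus>\<^bsub>AA.T\<^esub> y", OF _ _ _ w])
      (simp_all add: Q.slice_add[OF g] AK.slice_closed[OF g] ring_hom_add[OF h1(1)] AA.pt_add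
        AK.slice_add[OF g] h1(2) Q.slice_pt[OF g] AK.slice_pt[OF g] \<eta>1 AA.pt_mult linear_functionalD[OF g])
  have sl2: "Q.slice g (h2 w) = AA.pt \<one>\<^bsub>A\<^esub> (AK.slice g w)" if g: "AK.functional g" and w: "w \<in> carrier AK.T" for g w
    by (rule AK.additive_eqI[where P = "\<lambda>x y. x \<oplus>\<^bsub>AA.T\<^esub> y", OF _ _ _ w])
      (simp_all add: Q.slice_add[OF g] AK.slice_closed[OF g] ring_hom_add[OF h2(1)] AA.pt_add
        AK.slice_add[OF g] h2(2) Q.slice_pt[OF g] AK.slice_pt[OF g] \<eta>' AA.pt_mult linear_functionalD[OF g])
  interpret \<mu>: ring_hom_ring AA.T A \<mu> using \<mu>(1) by (intro ring_hom_ringI2) unfold_locales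
  define I where "I = {z \<in> carrier AA.T. \<mu> z = \<zero>\<^bsub>A\<^esub>}"
  have I: "ideal I AA.T" using \<mu>.kernel_is_ideal unfolding I_def a_kernel_def' by simp
  interpret I: ideal I AA.T by fact
  \<comment> \<open>\<open>M\<close> sends \<open>\<Theta> p\<close> to 1 and \<open>y\<close> to 0,
    so the slices of \<open>y\<close> lie in \<open>I\<close>.\<close>
  define y where "y = \<one>\<^bsub>Q.T\<^esub> \<ominus>\<^bsub>Q.T\<^esub> \<Theta> p"
  have y: "y \<in> carrier Q.T" unfolding y_def using p by simp
  have yI: "Q.slices y \<subseteq> I"
  proof -
    interpret M: ring_hom_ring Q.T AK.T M using M(1) by (intro ring_hom_ringI2) unfold_locales
    have "M y = \<one>\<^bsub>AK.T\<^esub> \<ominus>\<^bsub>AK.T\<^esub> M (\<Theta> p)" unfolding y_def using p by (simp add: a_minus_def)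
    also have "\<dots> = \<zero>\<^bsub>AK.T\<^esub>" using M\<Theta>[OF p(1)] p(2) ring_hom_one[OF j(1)] by (simp add: a_minus_def AK.T.r_neg)
    finally show ?thesis
      unfolding I_def Q.slices_def using slM y Q.slice_closed AK.slice_zero by auto
  qed
  define d where "d a = AA.pt a \<one>\<^bsub>A\<^esub> \<ominus>\<^bsub>AA.T\<^esub> AA.pt \<one>\<^bsub>A\<^esub> a" for a
  have d_closed: "d a \<in> carrier AA.T" if "a \<in> carrier A" for a unfolding d_def using that by simp
  have dI: "d a \<in> I" if "a \<in> carrier A" for a
    unfolding I_def using d_closed[OF that] that unfolding d_def by (simp add: a_minus_def \<mu> A.r_neg)
  have FA: "F \<subseteq> carrier A"
    using F(2) AK.slices_closed[OF ring_hom_closed[OF j(1)]] by blast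
  have dII: "d a \<in> ideal_prod AA.T I I" if a: "a \<in> F" for a
  proof -
    obtain b g where b: "b \<in> carrier B" and g: "AK.functional g" "a = AK.slice g (j b)"
      using a F(2) unfolding AK.slices_def by blast
    \<comment> \<open>The slices of \<open>w\<close> are values of \<open>d\<close>. As
      \<open>p\<close> commutes with \<open>b\<close>, the product of \<open>w\<close> and
      \<open>\<Theta> p\<close> vanishes; that is, \<open>w = y w\<close>, a product of two tensors
      whose slices lie in \<open>I\<close>.\<close>
    define w where "w = h1 (j b) \<ominus>\<^bsub>Q.T\<^esub> h2 (j b)"
    have w: "w \<in> carrier Q.T" unfolding w_def using b by simp
    have slw: "Q.slice g w = d (AK.slice g (j b))" if g: "AK.functional g" for g
      unfolding w_def d_def using b sl1[OF g] sl2[OF g] Q.slice_diff[OF g] by simp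
    have "h1 (j b) \<otimes>\<^bsub>Q.T\<^esub> \<Theta> p = \<Theta> (BB.pt b \<one>\<^bsub>B\<^esub> \<otimes>\<^bsub>BB.T\<^esub> p)" "h2 (j b) \<otimes>\<^bsub>Q.T\<^esub> \<Theta> p = \<Theta> (BB.pt \<one>\<^bsub>B\<^esub> b \<otimes>\<^bsub>BB.T\<^esub> p)"
      using b p(1) by (simp_all add: ring_hom_mult[OF \<Theta>(1)] \<Theta>(2) ring_hom_one[OF b1] ring_hom_one[OF b2])
    then have "w \<otimes>\<^bsub>Q.T\<^esub> \<Theta> p = \<zero>\<^bsub>Q.T\<^esub>"
      unfolding w_def using b p(1) comm[OF b] by (simp add: a_minus_def Q.T.l_distr Q.T.l_minus Q.T.r_neg)
    then have "y \<otimes>\<^bsub>Q.T\<^esub> w = w"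
      unfolding y_def using w p(1) Q.T.m_comm[of w "\<Theta> p"] by (simp add: a_minus_def Q.T.l_distr Q.T.l_minus)
    moreover have "Q.slices w \<subseteq> I"
      unfolding Q.slices_def using slw dI AK.slice_closed b by auto
    ultimately have "Q.slices w \<subseteq> ideal_prod AA.T I I"
      using Q.slice_prod_ideal[OF I y yI w] by simp
    then show ?thesis using slw[OF g(1)] g unfolding Q.slices_def by auto
  qed
  let ?J = "Idl\<^bsub>AA.T\<^esub> (d ` F)"
  have dF: "d ` F \<subseteq> carrier AA.T" using FA d_closed by blast
  interpret J: ideal ?J AA.T using AA.T.genideal_ideal[OF dF] .
  \<comment> \<open>By the Leibniz rule
    \<open>d(x y) = (x \<otimes> 1) d y + (1 \<otimes> y) d x\<close>, an ideal containing
    \<open>d\<close> on \<open>F\<close> contains it on the algebra generated by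
    \<open>F\<close>.\<close>
  have dJ: "a \<in> carrier A \<and> d a \<in> ?J" if "a \<in> alg_gen k \<phi> A F" for a
    using that
  proof induction
    case (str c)
    then have "d (\<phi> c) = \<zero>\<^bsub>AA.T\<^esub>" unfolding d_def AA.pt_str[OF str] by (simp add: a_minus_def AA.T.r_neg)
    then show ?case using str J.zero_closed by simp
  next
    case (incl f)
    then show ?case using AA.T.genideal_self[OF dF] FA by blast
  next
    case (add x y)
    then have "d (x \<oplus>\<^bsub>A\<^esub> y) = d x \<oplus>\<^bsub>AA.T\<^esub> d y"
      unfolding d_def by (simp add: AA.pt_add a_minus_def AA.T.minus_add AA.T.a_ac)
    then show ?case using add J.a_closed by simp
  next
    case (mult x y)
    then have xy: "x \<in> carrier A" "y \<in> carrier A" by auto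
    have "d (x \<otimes>\<^bsub>A\<^esub> y) = AA.pt x \<one>\<^bsub>A\<^esub> \<otimes>\<^bsub>AA.T\<^esub> d y \<oplus>\<^bsub>AA.T\<^esub> AA.pt \<one>\<^bsub>A\<^esub> y \<otimes>\<^bsub>AA.T\<^esub> d x"
      unfolding d_def using xy
      by (simp add: AA.pt_mult a_minus_def AA.T.r_distr AA.T.r_minus A.m_comm AA.T.a_assoc AA.T.r_neg1)
    then show ?case using mult J.a_closed J.I_l_closed xy by simp
  qed
  have IJ: "I \<subseteq> ?J"
  proof
    fix z assume z: "z \<in> I"
    \<comment> \<open>Modulo \<open>?J\<close> a pure tensor \<open>a \<otimes> b\<close> equals
      \<open>1 \<otimes> a b\<close>, the difference being
      \<open>(1 \<otimes> b) d a\<close>.\<close>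
    have "z \<ominus>\<^bsub>AA.T\<^esub> AA.pt \<one>\<^bsub>A\<^esub> (\<mu> z) \<in> ?J" if "z \<in> carrier AA.T" for z
      using that
    proof (induction z rule: AA.tensor_induct)
      case (pure a b)
      have "AA.pt a b \<ominus>\<^bsub>AA.T\<^esub> AA.pt \<one>\<^bsub>A\<^esub> (\<mu> (AA.pt a b)) = AA.pt \<one>\<^bsub>A\<^esub> b \<otimes>\<^bsub>AA.T\<^esub> d a"
        unfolding d_def using pure
        by (simp add: \<mu> a_minus_def AA.T.r_distr AA.T.r_minus AA.pt_mult A.m_comm)
      then show ?case using dJ[of a] F(3) pure J.I_l_closed by auto
    next
      case (add x y)
      have "(x \<oplus>\<^bsub>AA.T\<^esub> y) \<ominus>\<^bsub>AA.T\<^esub> AA.pt \<one>\<^bsub>A\<^esub> (\<mu> (x \<oplus>\<^bsub>AA.T\<^esub> y)) =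
          (x \<ominus>\<^bsub>AA.T\<^esub> AA.pt \<one>\<^bsub>A\<^esub> (\<mu> x)) \<oplus>\<^bsub>AA.T\<^esub> (y \<ominus>\<^bsub>AA.T\<^esub> AA.pt \<one>\<^bsub>A\<^esub> (\<mu> y))"
        using add(1,2) by (simp add: AA.pt_add a_minus_def AA.T.minus_add AA.T.a_ac)
      then show ?case using add J.a_closed by simp
    qed
    from this[of z] show "z \<in> ?J" using z unfolding I_def by (simp add: a_minus_def)
  qed
  obtain i where i: "i \<in> I" "\<And>x. x \<in> I \<Longrightarrow> (\<one>\<^bsub>AA.T\<^esub> \<oplus>\<^bsub>AA.T\<^esub> i) \<otimes>\<^bsub>AA.T\<^esub> x = \<zero>\<^bsub>AA.T\<^esub>"
    using AA.T.idempotent_ideal_annihilator[OF I _ _ IJ] F(1) dI dII FA by blast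
  have iT: "i \<in> carrier AA.T" using i unfolding I_def by simp
  show ?thesis
  \<comment> \<open>\<open>1 + i\<close> annihilates each \<open>d a\<close>, which is the
    commutation rule, and it is sent to 1 because \<open>i\<close> lies in the kernel of
    \<open>\<mu>\<close>.\<close>
  proof (rule A.separableI[where F = F])
    show u: "\<one>\<^bsub>AA.T\<^esub> \<oplus>\<^bsub>AA.T\<^esub> i \<in> carrier AA.T" using iT by simp
    show "AA.lift A (\<lambda>a b. a \<otimes>\<^bsub>A\<^esub> b) (\<one>\<^bsub>AA.T\<^esub> \<oplus>\<^bsub>AA.T\<^esub> i) = \<one>\<^bsub>A\<^esub>"
      using i(1) unfolding I_def \<mu>_def[symmetric] by simp
    fix a assume "a \<in> F"
    then have a: "a \<in> carrier A" using FA by blast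
    let ?u = "\<one>\<^bsub>AA.T\<^esub> \<oplus>\<^bsub>AA.T\<^esub> i"
    have "AA.pt a \<one>\<^bsub>A\<^esub> \<otimes>\<^bsub>AA.T\<^esub> ?u = (AA.pt \<one>\<^bsub>A\<^esub> a \<oplus>\<^bsub>AA.T\<^esub> d a) \<otimes>\<^bsub>AA.T\<^esub> ?u"
      unfolding d_def using a by (simp add: a_minus_def AA.T.a_ac AA.T.r_neg AA.T.r_neg1 AA.T.r_neg2)
    also have "\<dots> = AA.pt \<one>\<^bsub>A\<^esub> a \<otimes>\<^bsub>AA.T\<^esub> ?u \<oplus>\<^bsub>AA.T\<^esub> ?u \<otimes>\<^bsub>AA.T\<^esub> d a"
      using a d_closed[OF a] AA.T.m_comm[OF d_closed[OF a] u] AA.T.l_distr[OF _ d_closed[OF a] u] u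
      by simp
    also have "\<dots> = AA.pt \<one>\<^bsub>A\<^esub> a \<otimes>\<^bsub>AA.T\<^esub> ?u" using i(2)[OF dI[OF a]] a u by simp
    finally show "AA.pt a \<one>\<^bsub>A\<^esub> \<otimes>\<^bsub>AA.T\<^esub> ?u = AA.pt \<one>\<^bsub>A\<^esub> a \<otimes>\<^bsub>AA.T\<^esub> ?u" .
  qed (use F(3) FA in auto)
qed

section \<open>Characters of finite algebras over an algebraically closed field\<close>

context k_algebra
begin

lemma
  assumes "\<one> \<noteq> \<zero>"
  shows str_subfield: "subfield (\<phi> ` carrier k) R" and str_inj: "inj_on \<phi> (carrier k)"
proof -
  interpret ring_hom_ring k R \<phi> using str_hom by (intro ring_hom_ringI2) unfold_locales
  show "subfield (\<phi> ` carrier k) R" "inj_on \<phi> (carrier k)"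
    using img_is_subfield[OF k.carrier_is_subfield assms] by auto
qed

lemma Span_eq_lin_gen:
  assumes "\<one> \<noteq> \<zero>" "set Us \<subseteq> carrier R"
  shows "Span (\<phi> ` carrier k) Us = lin_gen k \<phi> R (set Us)"
proof
  show "Span (\<phi> ` carrier k) Us \<subseteq> lin_gen k \<phi> R (set Us)"
    using assms(2)
  proof (induction Us)
    case Nil
    then show ?case by (simp add: lin_gen.zero)
  next
    case (Cons u Us)
    have sub: "lin_gen k \<phi> R (set Us) \<subseteq> lin_gen k \<phi> R (set (u # Us))"
      by (rule lin_gen_least[OF lin_closed_lin_gen]) (use Cons.prems lin_gen_incl[of "set (u # Us)"] in auto)
    show ?case
    proof
      fix x assume "x \<in> Span (\<phi> ` carrier k) (u # Us)"
      then obtain c v where cv: "c \<in> carrier k" "v \<in> Span (\<phi> ` carrier k) Us" "x = \<phi> c \<otimes> u \<oplus> v"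
        by (auto simp: line_extension_mem_iff)
      then have "v \<in> lin_gen k \<phi> R (set (u # Us))" using Cons sub by auto
      then show "x \<in> lin_gen k \<phi> R (set (u # Us))"
        unfolding cv(3) by (intro lin_gen.add lin_gen.scale) (use cv in auto)
    qed
  qed
next
  note s = str_subfield[OF assms(1)]
  have "lin_closed (Span (\<phi> ` carrier k) Us)"
    using Span_subgroup_props[OF s assms(2)] Span_smult_closed[OF s assms(2)] unfolding lin_closed_def by auto
  then show "lin_gen k \<phi> R (set Us) \<subseteq> Span (\<phi> ` carrier k) Us"
    using lin_gen_least Span_base_incl[OF s assms(2)] by blast
qed

lemma finite_dimension_lin_gen:
  assumes "\<one> \<noteq> \<zero>" "finite F" "F \<subseteq> carrier R"
  shows "finite_dimension (\<phi> ` carrier k) (lin_gen k \<phi> R F)"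
proof -
  obtain Us where "set Us = F" using finite_list[OF assms(2)] by blast
  then show ?thesis
    using Span_eq_lin_gen[OF assms(1), of Us] Span_finite_dimension[OF str_subfield[OF assms(1)], of Us] assms(3) by simp
qed

text \<open>Finite dimension takes the place of Zorn's lemma. Ideals are subspaces, so among the
  proper ideals above \<open>J\<close> there is one of largest dimension; a proper ideal containing
  it has no larger dimension and is spanned by the same base.\<close>

lemma maximal_ideal_exists:
  assumes F: "finite F" "F \<subseteq> carrier R" "carrier R \<subseteq> lin_gen k \<phi> R F"
    and J: "ideal J R" "\<one> \<notin> J"
  obtains M where "maximalideal M R" "J \<subseteq> M"
proof -
  let ?K = "\<phi> ` carrier k"
  have ne: "\<one> \<noteq> \<zero>" using J additive_subgroup.zero_closed[OF ideal.axioms(1)[OF J(1)]] by auto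
  note s = str_subfield[OF ne]
  have Kc: "?K \<subseteq> carrier R" by auto
  have "finite_dimension ?K (carrier R)"
    using finite_dimension_lin_gen[OF ne F(1,2)] F(3) lin_gen_closed[OF F(2)] by (simp add: subset_antisym)
  then obtain n where n: "dimension n ?K (carrier R)" unfolding finite_dimension_def by blast
  have dim: "\<exists>d. dimension d ?K I" if "ideal I R" for I
    using subalbegra_incl_imp_finite_dimension[OF s \<open>finite_dimension ?K (carrier R)\<close> ideal_is_subalgebra[OF Kc that]]
      ideal.Icarr[OF that] unfolding finite_dimension_def by blast
  define P where "P d \<longleftrightarrow> (\<exists>I. ideal I R \<and> J \<subseteq> I \<and> \<one> \<notin> I \<and> dimension d ?K I)" for d
  obtain d0 where "P d0" using dim[OF J(1)] J unfolding P_def by blast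
  moreover have "d \<le> n" if "P d" for d
  proof -
    obtain I where I: "ideal I R" "dimension d ?K I" using \<open>P d\<close> unfolding P_def by blast
    from exists_base[OF s I(2)] obtain Vs where "independent ?K Vs" "length Vs = d" "set Vs \<subseteq> carrier R" by blast
    then show "d \<le> n" using independent_length_le_dimension[OF s n] by blast
  qed
  ultimately obtain d where d: "P d" "\<And>d'. P d' \<Longrightarrow> d' \<le> d"
    using Greatest_le_nat[of P _ n] GreatestI_nat[of P d0 n] by metis
  then obtain M where M: "ideal M R" "J \<subseteq> M" "\<one> \<notin> M" "dimension d ?K M" unfolding P_def by blast
  have "maximalideal M R"
  proof (rule maximalidealI[OF M(1)])
    show "carrier R \<noteq> M" using M(3) by auto
    fix I assume I: "ideal I R" "M \<subseteq> I" "I \<subseteq> carrier R"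
    show "I = M \<or> I = carrier R"
    proof (cases "\<one> \<in> I")
      case True
      then show ?thesis using ideal.one_imp_carrier[OF I(1)] by blast
    next
      case False
      obtain d' where d': "dimension d' ?K I" using dim[OF I(1)] by blast
      then have "d' \<le> d" using d(2) I M False unfolding P_def by blast
      obtain Vs where Vs: "independent ?K Vs" "length Vs = d" "Span ?K Vs = M"
        using exists_base[OF s M(4)] by blast
      have "set Vs \<subseteq> I" using Span_base_incl[OF s independent_in_carrier[OF Vs(1)]] Vs(3) I(2) by blast
      moreover have "d \<le> d'" using independent_length_le_dimension[OF s d' Vs(1)] Vs(2) calculation by simp
      ultimately show ?thesis using independent_length_eq_dimension[OF s d' Vs(1)] Vs \<open>d' \<le> d\<close> by simp
    qed
  qed
  then show ?thesis using M(2) by (rule that)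
qed

end

text \<open>Needed because a residue field contains only an isomorphic copy of \<open>L\<close>.
  Polynomials are pulled back along the isomorphism and roots pushed forward.\<close>

lemma algebraically_closed_iso:
  assumes L: "algebraically_closed L" and M: "field M" and h: "h \<in> ring_hom L M" "h ` carrier L = carrier M"
  shows "algebraically_closed M"
proof -
  interpret L: algebraically_closed L by fact
  interpret M: field M by fact
  interpret h: ring_hom_ring L M h using h(1) by (intro ring_hom_ringI2) unfold_locales
  have inj: "inj_on h (carrier L)"
    using h.img_is_subfield(1)[OF L.carrier_is_subfield] by simp
  define g where "g = inv_into (carrier L) h"
  have gh: "h (g x) = x" "g x \<in> carrier L" if "x \<in> carrier M" for x
    using that h(2) unfolding g_def by (auto simp: f_inv_into_f inv_into_into)
  have g: "g \<in> ring_hom M L"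
  proof (rule ring_hom_memI)
    fix x y assume xy: "x \<in> carrier M" "y \<in> carrier M"
    show "g x \<in> carrier L" using gh xy by simp
    show "g (x \<otimes>\<^bsub>M\<^esub> y) = g x \<otimes>\<^bsub>L\<^esub> g y" "g (x \<oplus>\<^bsub>M\<^esub> y) = g x \<oplus>\<^bsub>L\<^esub> g y"
      by (rule inj_onD[OF inj]; use gh xy in simp)+
  next
    show "g \<one>\<^bsub>M\<^esub> = \<one>\<^bsub>L\<^esub>" by (rule inj_onD[OF inj]; use gh in simp)
  qed
  show ?thesis
  proof (rule M.algebraically_closedI)
    fix p assume p: "p \<in> carrier (poly_ring M)" "degree p > 1"
    have q: "map g p \<in> carrier (poly_ring L)"
      by (rule polynomial_hom[OF g M.field_axioms L.field_axioms p(1)])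
    have setp: "set p \<subseteq> carrier M" using p(1) M.polynomial_incl by (simp add: univ_poly_carrier)
    have "size (L.roots (map g p)) = degree (map g p)"
      using L.roots_over_carrier[OF q] unfolding L.splitted_def .
    then have "L.roots (map g p) \<noteq> {#}" using p(2) by auto
    then obtain c where "c \<in># L.roots (map g p)" by blast
    then have c: "c \<in> carrier L" "L.eval (map g p) c = \<zero>\<^bsub>L\<^esub>"
      using L.roots_mem_iff_is_root[OF q] unfolding L.is_root_def by auto
    have "map h (map g p) = p" unfolding map_map by (rule map_idI) (use setp gh in auto)
    moreover have "set (map g p) \<subseteq> carrier L" using setp gh by auto
    ultimately have "M.eval p (h c) = \<zero>\<^bsub>M\<^esub>" using h.eval_hom'[OF c(1), of "map g p"] c(2) by simp
    then show "\<exists>x\<in>carrier M. M.eval p x = \<zero>\<^bsub>M\<^esub>" using h.hom_closed[OF c(1)] by blast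
  qed
qed

text \<open>The minimal polynomial over \<open>K\<close> of any element of \<open>D\<close> is
  irreducible and splits over \<open>K\<close>, hence is linear.\<close>

lemma algebraically_closed_no_extension:
  assumes D: "field D" and K: "subfield K D" "algebraically_closed (D\<lparr>carrier := K\<rparr>)"
    and fin: "ring.finite_dimension D K (carrier D)"
  shows "carrier D \<subseteq> K"
proof
  interpret D: field D by fact
  interpret K: algebraically_closed "D\<lparr>carrier := K\<rparr>" by fact
  fix x assume x: "x \<in> carrier D"
  have alg: "(D.algebraic over K) x"
    using D.finite_dimension_imp_algebraic[OF K(1) D.carrier_is_subring fin x] .
  note irr = D.IrrE[OF K(1) x alg]
  let ?p = "D.Irr K x"
  have sub: "subring K D" using subfieldE(1)[OF K(1)] .
  have p: "?p \<in> carrier (poly_ring (D\<lparr>carrier := K\<rparr>))"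
    using irr(1) D.univ_poly_consistent[OF sub] by simp
  have "pirreducible\<^bsub>D\<lparr>carrier := K\<rparr>\<^esub> K ?p"
    using irr(2) D.univ_poly_consistent[OF sub] by simp
  then have "degree ?p = 1"
    using K.pirreducible_imp_not_splitted[OF p] K.roots_over_carrier[OF p] by auto
  then obtain a b where ab: "?p = [a, b]"
    by (cases ?p; cases "tl ?p") auto
  have "set ?p \<subseteq> K" using p K.polynomial_incl[of "carrier (D\<lparr>carrier := K\<rparr>)" ?p] by (simp add: univ_poly_carrier)
  then have b: "b \<in> K" "b \<in> carrier D" using ab subfieldE(3)[OF K(1)] by auto
  have "a = \<one>\<^bsub>D\<^esub>" using irr(3) ab by simp
  then have "x \<oplus>\<^bsub>D\<^esub> b = \<zero>\<^bsub>D\<^esub>" using irr(4) x b ab by simp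
  then have "x = \<ominus>\<^bsub>D\<^esub> b" using D.minus_equality[of x b] x b by simp
  then show "x \<in> K" using subringE(5)[OF sub] b(1) by simp
qed

text \<open>Modulo a maximal ideal above \<open>J\<close> the algebra becomes a field that is finite
  over its copy of \<open>L\<close>, hence equal to that copy. The character is the projection
  followed by the inverse of the embedding of \<open>L\<close>.\<close>

lemma character_exists:
  fixes N :: "('a, 'm) ring_scheme"
  assumes L: "algebraically_closed L" and N: "k_algebra L \<rho> N"
    and F: "finite F" "F \<subseteq> carrier N" "carrier N \<subseteq> lin_gen L \<rho> N F"
    and J: "ideal J N" "\<one>\<^bsub>N\<^esub> \<notin> J"
  obtains \<chi> where "\<chi> \<in> ring_hom N L" "\<And>l. l \<in> carrier L \<Longrightarrow> \<chi> (\<rho> l) = l" "\<And>x. x \<in> J \<Longrightarrow> \<chi> x = \<zero>\<^bsub>L\<^esub>"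
proof -
  interpret L: algebraically_closed L by fact
  interpret N: k_algebra L \<rho> N by fact
  obtain M where M: "maximalideal M N" "J \<subseteq> M" using N.maximal_ideal_exists[OF F J] by metis
  interpret M: maximalideal M N by fact
  let ?D = "N Quot M"
  interpret D: field ?D using M.quotient_is_field[OF N.cring_axioms] .
  have \<pi>: "(\<lambda>x. M +>\<^bsub>N\<^esub> x) \<in> ring_hom N ?D" using M.rcos_ring_hom .
  define h where "h = (\<lambda>x. M +>\<^bsub>N\<^esub> x)"
  interpret h: ring_hom_ring N ?D h using \<pi> unfolding h_def by (intro ring_hom_ringI2) unfold_locales
  have surj: "carrier ?D = h ` carrier N" unfolding h_def FactRing_def A_RCOSETS_def' by auto
  have hz: "h x = \<zero>\<^bsub>?D\<^esub>" if "x \<in> M" for x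
    unfolding h_def using M.a_rcos_const[OF that] by (simp add: FactRing_def)
  have comp: "h \<circ> \<rho> \<in> ring_hom L ?D" using ring_hom_trans[OF N.str_hom h.homh] .
  interpret c: ring_hom_ring L ?D "h \<circ> \<rho>" using comp by (intro ring_hom_ringI2) unfold_locales
  have inj: "inj_on (h \<circ> \<rho>) (carrier L)" and sf: "subfield ((h \<circ> \<rho>) ` carrier L) ?D"
    using c.img_is_subfield[OF L.carrier_is_subfield] by auto
  have ne: "\<one>\<^bsub>N\<^esub> \<noteq> \<zero>\<^bsub>N\<^esub>" using J additive_subgroup.zero_closed[OF ideal.axioms(1)[OF J(1)]] by auto
  let ?K = "(h \<circ> \<rho>) ` carrier L"
  obtain Us where Us: "set Us = F" using finite_list[OF F(1)] by blast
  have "D.Span ?K (map h Us) = h ` N.Span (\<rho> ` carrier L) Us"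
    using h.Span_hom[of "\<rho> ` carrier L" Us] F(2) Us by (auto simp: image_comp)
  also have "\<dots> = carrier ?D"
    using N.Span_eq_lin_gen[OF ne, of Us] F Us surj N.lin_gen_closed[OF F(2)] by (simp add: subset_antisym)
  finally have sp: "D.Span ?K (map h Us) = carrier ?D" .
  have "set (map h Us) \<subseteq> carrier ?D" using F(2) Us h.hom_closed by auto
  from D.Span_finite_dimension[OF sf this] have "D.finite_dimension ?K (carrier ?D)" unfolding sp .
  moreover have "algebraically_closed (?D\<lparr>carrier := ?K\<rparr>)"
    by (rule algebraically_closed_iso[OF L D.subfield_iff(2)[OF sf], of "h \<circ> \<rho>"])
      (use comp in \<open>auto simp: ring_hom_def\<close>)
  ultimately have "carrier ?D \<subseteq> ?K"
    using algebraically_closed_no_extension[OF D.field_axioms sf] by blast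
  then have K: "carrier ?D = ?K" using c.hom_closed by auto
  define g where "g = inv_into (carrier L) (h \<circ> \<rho>)"
  have g: "g (h (\<rho> l)) = l" if "l \<in> carrier L" for l
    unfolding g_def using inv_into_f_f[OF inj that] by simp
  have hg: "\<exists>l\<in>carrier L. h x = h (\<rho> l)" if "x \<in> carrier N" for x
  proof -
    have "h x \<in> ?K" using h.hom_closed[OF that] unfolding K .
    then show ?thesis by auto
  qed
  have \<chi>: "(\<lambda>x. g (h x)) \<in> ring_hom N L"
  proof (rule ring_hom_memI)
    fix x y assume xy: "x \<in> carrier N" "y \<in> carrier N"
    obtain l m where lm: "l \<in> carrier L" "h x = h (\<rho> l)" "m \<in> carrier L" "h y = h (\<rho> m)" using hg xy by metis
    show "g (h x) \<in> carrier L" using lm g by simp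
    have "h (x \<otimes>\<^bsub>N\<^esub> y) = h (\<rho> (l \<otimes>\<^bsub>L\<^esub> m))" "h (x \<oplus>\<^bsub>N\<^esub> y) = h (\<rho> (l \<oplus>\<^bsub>L\<^esub> m))" using xy lm by simp_all
    then show "g (h (x \<otimes>\<^bsub>N\<^esub> y)) = g (h x) \<otimes>\<^bsub>L\<^esub> g (h y)" "g (h (x \<oplus>\<^bsub>N\<^esub> y)) = g (h x) \<oplus>\<^bsub>L\<^esub> g (h y)"
      using lm g by (simp_all del: N.str_simps h.hom_mult h.hom_add)
  next
    show "g (h \<one>\<^bsub>N\<^esub>) = \<one>\<^bsub>L\<^esub>" using g[of "\<one>\<^bsub>L\<^esub>"] by simp
  qed
  show ?thesis
  proof (rule that[OF \<chi>])
    show "g (h (\<rho> l)) = l" if "l \<in> carrier L" for l using g that .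
    fix x assume "x \<in> J"
    then have "h x = h (\<rho> \<zero>\<^bsub>L\<^esub>)" using hz M(2) by auto
    then show "g (h x) = \<zero>\<^bsub>L\<^esub>" using g[of "\<zero>\<^bsub>L\<^esub>"] by (simp del: N.str_simps)
  qed
qed

section \<open>Etale algebras are the separable algebras\<close>

lemma RDirProd_list_Cons_carrier:
  "carrier (RDirProd_list (L # Ls)) = {x # xs | x xs. x \<in> carrier L \<and> xs \<in> carrier (RDirProd_list Ls)}"
  unfolding RDirProd_list_carrier by auto

lemma RDirProd_list_Cons_ops:
  assumes "x \<in> carrier L" "y \<in> carrier L" "xs \<in> carrier (RDirProd_list Ls)" "ys \<in> carrier (RDirProd_list Ls)"
  shows "(x # xs) \<otimes>\<^bsub>RDirProd_list (L # Ls)\<^esub> (y # ys) = (x \<otimes>\<^bsub>L\<^esub> y) # (xs \<otimes>\<^bsub>RDirProd_list Ls\<^esub> ys)"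
    "(x # xs) \<oplus>\<^bsub>RDirProd_list (L # Ls)\<^esub> (y # ys) = (x \<oplus>\<^bsub>L\<^esub> y) # (xs \<oplus>\<^bsub>RDirProd_list Ls\<^esub> ys)"
  using ring_hom_mult[OF RDirProd_list_hom1[of L Ls], of "(x, xs)" "(y, ys)"]
    ring_hom_add[OF RDirProd_list_hom1[of L Ls], of "(x, xs)" "(y, ys)"] assms
  by (simp_all add: RDirProd_def monoid.defs DirProd_def)

lemma
  shows carrier_RDirProd_replicate:
      "carrier (RDirProd_list (replicate n L)) = {xs. length xs = n \<and> set xs \<subseteq> carrier L}"
    and one_RDirProd_replicate: "\<one>\<^bsub>RDirProd_list (replicate n L)\<^esub> = replicate n \<one>\<^bsub>L\<^esub>"
proof -
  show "carrier (RDirProd_list (replicate n L)) = {xs. length xs = n \<and> set xs \<subseteq> carrier L}"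
  proof (induction n)
    case (Suc n)
    show ?case
      unfolding replicate_Suc RDirProd_list_Cons_carrier Suc by (auto simp: length_Suc_conv)
  qed auto
  show "\<one>\<^bsub>RDirProd_list (replicate n L)\<^esub> = replicate n \<one>\<^bsub>L\<^esub>"
    unfolding RDirProd_list_one by (induction n) auto
qed

lemma RDirProd_replicate_ops:
  assumes "xs \<in> carrier (RDirProd_list (replicate n L))" "ys \<in> carrier (RDirProd_list (replicate n L))"
  shows "xs \<otimes>\<^bsub>RDirProd_list (replicate n L)\<^esub> ys = map2 (\<lambda>x y. x \<otimes>\<^bsub>L\<^esub> y) xs ys"
    "xs \<oplus>\<^bsub>RDirProd_list (replicate n L)\<^esub> ys = map2 (\<lambda>x y. x \<oplus>\<^bsub>L\<^esub> y) xs ys"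
  using assms
proof (induction n arbitrary: xs ys)
  case (Suc n)
  {
    case 1
    then show ?case using Suc.IH unfolding replicate_Suc RDirProd_list_Cons_carrier
      by (auto simp: RDirProd_list_Cons_ops)
  next
    case 2
    then show ?case using Suc.IH unfolding replicate_Suc RDirProd_list_Cons_carrier
      by (auto simp: RDirProd_list_Cons_ops)
  }
qed (auto simp: monoid.defs)

lemma nth_RDirProd_replicate_hom:
  assumes "i < n"
  shows "(\<lambda>xs. xs ! i) \<in> ring_hom (RDirProd_list (replicate n L)) L"
  by (rule ring_hom_memI)
    (use assms in \<open>auto simp: RDirProd_replicate_ops carrier_RDirProd_replicate one_RDirProd_replicate\<close>)

lemma RDirProd_replicate_cring:
  assumes "cring L"
  shows "cring (RDirProd_list (replicate n L))"
proof -
  interpret L: cring L by fact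
  interpret ring "RDirProd_list (replicate n L)"
    by (rule RDirProd_list_is_ring) (simp add: L.ring_axioms)
  show ?thesis
  proof unfold_locales
    fix x y assume "x \<in> carrier (RDirProd_list (replicate n L))" "y \<in> carrier (RDirProd_list (replicate n L))"
    then show "x \<otimes>\<^bsub>RDirProd_list (replicate n L)\<^esub> y = y \<otimes>\<^bsub>RDirProd_list (replicate n L)\<^esub> x"
      unfolding carrier_RDirProd_replicate
      by (auto simp: RDirProd_replicate_ops carrier_RDirProd_replicate subset_code(1)
          intro!: nth_equalityI L.m_comm)
  qed
qed

section \<open>Splitting an algebra by idempotents\<close>

context k_algebra
begin

lemma lin_closed_finsum:
  assumes "lin_closed W" "\<And>i. i \<in> I \<Longrightarrow> f i \<in> W"
  shows "(\<Oplus>i\<in>I. f i) \<in> W"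
proof -
  note W = assms(1)[unfolded lin_closed_def]
  show ?thesis
    using assms(2)
  proof (induction I rule: infinite_finite_induct)
    case (insert x F)
    then have "f \<in> F \<rightarrow> carrier R" "f x \<in> carrier R" using W by auto
    then show ?case using insert W by simp
  qed (use W in simp_all)
qed

interpretation sq: tensor_algebras k \<phi> R \<phi> R
  by unfold_locales

text \<open>The sum of the tensors \<open>e i \<otimes> e i\<close> is a separability idempotent: on
  each \<open>e i\<close> an element acts through a scalar, and scalars pass through the tensor
  sign.\<close>

lemma separable_of_idempotents:
  assumes I: "finite I" "\<And>i. i \<in> I \<Longrightarrow> e i \<in> carrier R" "(\<Oplus>i\<in>I. e i) = \<one>"
    and idem: "\<And>i. i \<in> I \<Longrightarrow> e i \<otimes> e i = e i"
    and scalar: "\<And>a i. a \<in> carrier R \<Longrightarrow> i \<in> I \<Longrightarrow> \<exists>c\<in>carrier k. a \<otimes> e i = \<phi> c \<otimes> e i"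
  shows "separable_algebra k \<phi> R" "carrier R \<subseteq> lin_gen k \<phi> R (e ` I)"
proof -
  have eI: "e \<in> I \<rightarrow> carrier R" using I(2) by blast
  have a_sum: "a = (\<Oplus>i\<in>I. a \<otimes> e i)" if "a \<in> carrier R" for a
    using finsum_rdistr[OF I(1) that eI] I(3) that by simp
  have W: "lin_closed (lin_gen k \<phi> R (e ` I))" by (rule lin_closed_lin_gen) (use I(2) in auto)
  show "carrier R \<subseteq> lin_gen k \<phi> R (e ` I)"
  proof
    fix a assume a: "a \<in> carrier R"
    have "(\<Oplus>i\<in>I. a \<otimes> e i) \<in> lin_gen k \<phi> R (e ` I)"
    proof (rule lin_closed_finsum[OF W])
      fix i assume i: "i \<in> I"
      obtain c where c: "c \<in> carrier k" "a \<otimes> e i = \<phi> c \<otimes> e i" using scalar[OF a i] by blast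
      show "a \<otimes> e i \<in> lin_gen k \<phi> R (e ` I)"
        unfolding c(2) using i c(1) by (intro lin_gen.scale) auto
    qed
    then show "a \<in> lin_gen k \<phi> R (e ` I)" using a_sum[OF a] by simp
  qed
  let ?p = "\<Oplus>\<^bsub>sq.T\<^esub>i\<in>I. sq.pt (e i) (e i)"
  have eI2: "(\<lambda>i. sq.pt (e i) (e i)) \<in> I \<rightarrow> carrier sq.T" using I(2) by simp
  have pc: "?p \<in> carrier sq.T" using eI2 by (rule sq.T.finsum_closed)
  show "separable_algebra k \<phi> R"
  proof (rule separableI[OF pc, of "carrier R"])
    interpret mu: ring_hom_cring sq.T R "sq.lift R (\<lambda>a b. a \<otimes> b)"
      using mu_hom by unfold_locales
    have "sq.lift R (\<lambda>a b. a \<otimes> b) ?p = (\<Oplus>i\<in>I. (sq.lift R (\<lambda>a b. a \<otimes> b) \<circ> (\<lambda>i. sq.pt (e i) (e i))) i)"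
      by (rule mu.hom_finsum[OF eI2])
    also have "\<dots> = (\<Oplus>i\<in>I. e i)"
      by (rule finsum_cong') (use I(2) idem mu_pt in auto)
    finally show "sq.lift R (\<lambda>a b. a \<otimes> b) ?p = \<one>" using I(3) by simp
  next
    fix a assume a: "a \<in> carrier R"
    have "sq.pt a \<one> \<otimes>\<^bsub>sq.T\<^esub> ?p = (\<Oplus>\<^bsub>sq.T\<^esub>i\<in>I. sq.pt a \<one> \<otimes>\<^bsub>sq.T\<^esub> sq.pt (e i) (e i))"
      by (rule sq.T.finsum_rdistr[OF I(1) _ eI2]) (use a in simp)
    also have "\<dots> = (\<Oplus>\<^bsub>sq.T\<^esub>i\<in>I. sq.pt \<one> a \<otimes>\<^bsub>sq.T\<^esub> sq.pt (e i) (e i))"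
    proof (rule sq.T.finsum_cong')
      fix i assume i: "i \<in> I"
      obtain c where c: "c \<in> carrier k" "a \<otimes> e i = \<phi> c \<otimes> e i" using scalar[OF a i] by blast
      show "sq.pt a \<one> \<otimes>\<^bsub>sq.T\<^esub> sq.pt (e i) (e i) = sq.pt \<one> a \<otimes>\<^bsub>sq.T\<^esub> sq.pt (e i) (e i)"
        using I(2)[OF i] a c sq.pt_scale[OF c(1), of "e i" "e i"] by (simp add: sq.pt_mult)
    qed (use a I(2) in auto)
    also have "\<dots> = sq.pt \<one> a \<otimes>\<^bsub>sq.T\<^esub> ?p"
      by (rule sq.T.finsum_rdistr[OF I(1) _ eI2, symmetric]) (use a in simp)
    finally show "sq.pt a \<one> \<otimes>\<^bsub>sq.T\<^esub> ?p = sq.pt \<one> a \<otimes>\<^bsub>sq.T\<^esub> ?p" .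
  qed (auto intro: alg_gen.incl)
qed

text \<open>The coordinate of \<open>a\<close> at \<open>i\<close> is the scalar through which
  \<open>a\<close> acts on \<open>e i\<close>; it is unique because
  \<open>e i \<noteq> \<zero>\<close>. Injectivity comes from writing \<open>a\<close> as the sum of
  the products of \<open>a\<close> with \<open>e i\<close>, surjectivity from orthogonality.\<close>

lemma split_iso:
  assumes e: "\<And>i. i < n \<Longrightarrow> e i \<in> carrier R" "\<And>i. i < n \<Longrightarrow> e i \<noteq> \<zero>" "\<And>i. i < n \<Longrightarrow> e i \<otimes> e i = e i"
    and orth: "\<And>i j. i < n \<Longrightarrow> j < n \<Longrightarrow> i \<noteq> j \<Longrightarrow> e i \<otimes> e j = \<zero>"
    and scalar: "\<And>a i. a \<in> carrier R \<Longrightarrow> i < n \<Longrightarrow> \<exists>c\<in>carrier k. a \<otimes> e i = \<phi> c \<otimes> e i"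
    and one: "(\<Oplus>i\<in>{..<n}. e i) = \<one>"
  shows "\<exists>h. h \<in> ring_iso R (RDirProd_list (replicate n k)) \<and> (\<forall>c\<in>carrier k. h (\<phi> c) = replicate n c)"
proof -
  have uniq: "c = d" if "c \<in> carrier k" "d \<in> carrier k" "i < n" "\<phi> c \<otimes> e i = \<phi> d \<otimes> e i" for c d i
  proof (rule ccontr)
    assume "c \<noteq> d"
    then have cd: "c \<ominus>\<^bsub>k\<^esub> d \<in> carrier k" "c \<ominus>\<^bsub>k\<^esub> d \<noteq> \<zero>\<^bsub>k\<^esub>" using that(1,2) k.r_right_minus_eq by auto
    have "\<phi> (c \<ominus>\<^bsub>k\<^esub> d) \<otimes> e i = \<zero>"
      using that e(1)[OF that(3)] by (simp add: a_minus_def l_distr l_minus r_neg)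
    then show False using scale_cancel[OF cd e(1)[OF that(3)]] e(2)[OF that(3)] cd field_inv[OF cd] by simp
  qed
  define x where "x a i = (THE c. c \<in> carrier k \<and> a \<otimes> e i = \<phi> c \<otimes> e i)" for a i
  have x_eq: "x a i = c" if "i < n" "c \<in> carrier k" "a \<otimes> e i = \<phi> c \<otimes> e i" for a i c
    unfolding x_def using that uniq by (intro the_equality) auto
  have x: "x a i \<in> carrier k" "a \<otimes> e i = \<phi> (x a i) \<otimes> e i" if "a \<in> carrier R" "i < n" for a i
    using scalar[OF that] x_eq[OF that(2)] by auto
  define h where "h a = map (x a) [0..<n]" for a
  let ?P = "RDirProd_list (replicate n k)"
  have hc: "h a \<in> carrier ?P" if "a \<in> carrier R" for a
    unfolding carrier_RDirProd_replicate h_def using x(1)[OF that] by auto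
  have "h \<in> ring_hom R ?P"
  proof (rule ring_hom_memI)
    fix a b assume ab: "a \<in> carrier R" "b \<in> carrier R"
    have "x (a \<otimes> b) i = x a i \<otimes>\<^bsub>k\<^esub> x b i" "x (a \<oplus> b) i = x a i \<oplus>\<^bsub>k\<^esub> x b i" if i: "i < n" for i
    proof -
      note c = x[OF ab(1) i] x[OF ab(2) i] e(1)[OF i]
      have "(a \<otimes> b) \<otimes> e i = a \<otimes> (\<phi> (x b i) \<otimes> e i)" using c ab by (simp add: m_assoc)
      also have "\<dots> = \<phi> (x b i) \<otimes> (a \<otimes> e i)" using c(1,3,5) ab by (simp add: m_lcomm)
      also have "\<dots> = \<phi> (x a i \<otimes>\<^bsub>k\<^esub> x b i) \<otimes> e i" unfolding c(2) using c(1,3,5) by (simp add: m_ac)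
      finally show "x (a \<otimes> b) i = x a i \<otimes>\<^bsub>k\<^esub> x b i" using x_eq[OF i] c by blast
      have "(a \<oplus> b) \<otimes> e i = \<phi> (x a i \<oplus>\<^bsub>k\<^esub> x b i) \<otimes> e i" using c ab by (simp add: l_distr)
      then show "x (a \<oplus> b) i = x a i \<oplus>\<^bsub>k\<^esub> x b i" using x_eq[OF i] c by blast
    qed
    then show "h (a \<otimes> b) = h a \<otimes>\<^bsub>?P\<^esub> h b" "h (a \<oplus> b) = h a \<oplus>\<^bsub>?P\<^esub> h b"
      unfolding RDirProd_replicate_ops[OF hc[OF ab(1)] hc[OF ab(2)]]
      unfolding h_def by (auto intro: nth_equalityI)
  next
    have "x \<one> i = \<one>\<^bsub>k\<^esub>" if "i < n" for i using x_eq[OF that, of "\<one>\<^bsub>k\<^esub>" \<one>] by simp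
    then show "h \<one> = \<one>\<^bsub>?P\<^esub>" unfolding one_RDirProd_replicate h_def by (auto intro: nth_equalityI)
  qed (rule hc)
  moreover have "bij_betw h (carrier R) (carrier ?P)"
  proof (rule bij_betw_imageI)
    have a_sum: "a = (\<Oplus>i\<in>{..<n}. a \<otimes> e i)" if "a \<in> carrier R" for a
      using finsum_rdistr[of "{..<n}" a e] one that e(1) by auto
    show "inj_on h (carrier R)"
    proof (rule inj_onI)
      fix a b assume ab: "a \<in> carrier R" "b \<in> carrier R" "h a = h b"
      have "a \<otimes> e i = b \<otimes> e i" if "i < n" for i
        using ab(3) that x(2)[OF ab(1) that] x(2)[OF ab(2) that] unfolding h_def by (auto simp: map_eq_conv)
      then have "(\<Oplus>i\<in>{..<n}. a \<otimes> e i) = (\<Oplus>i\<in>{..<n}. b \<otimes> e i)"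
        by (intro finsum_cong') (use ab e(1) in auto)
      then show "a = b" using a_sum ab by metis
    qed
    show "h ` carrier R = carrier ?P"
    proof
      show "h ` carrier R \<subseteq> carrier ?P" using hc by auto
      show "carrier ?P \<subseteq> h ` carrier R"
      proof
        fix xs assume "xs \<in> carrier ?P"
        then have xs: "length xs = n" "\<And>i. i < n \<Longrightarrow> xs ! i \<in> carrier k"
          unfolding carrier_RDirProd_replicate by auto
        define a where "a = (\<Oplus>i\<in>{..<n}. \<phi> (xs ! i) \<otimes> e i)"
        have fc: "(\<lambda>i. \<phi> (xs ! i) \<otimes> e i) \<in> {..<n} \<rightarrow> carrier R" using xs e(1) by auto
        have a: "a \<in> carrier R" unfolding a_def using fc by (rule finsum_closed)
        have "a \<otimes> e j = \<phi> (xs ! j) \<otimes> e j" if j: "j < n" for j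
        proof -
          have "a \<otimes> e j = (\<Oplus>i\<in>{..<n}. (\<phi> (xs ! i) \<otimes> e i) \<otimes> e j)"
            unfolding a_def by (rule finsum_ldistr) (use fc e(1) j in auto)
          also have "\<dots> = (\<Oplus>i\<in>{..<n}. if j = i then \<phi> (xs ! i) \<otimes> e i else \<zero>)"
            by (rule finsum_cong') (use e xs orth j in \<open>auto simp: m_assoc\<close>)
          also have "\<dots> = \<phi> (xs ! j) \<otimes> e j"
            by (rule finsum_singleton) (use fc j in auto)
          finally show ?thesis .
        qed
        then have "x a j = xs ! j" if "j < n" for j using x_eq that xs by blast
        then have "h a = xs" unfolding h_def using xs(1) by (auto intro: nth_equalityI)
        then show "xs \<in> h ` carrier R" using a by blast
      qed
    qed
  qed
  moreover have "h (\<phi> c) = replicate n c" if "c \<in> carrier k" for c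
    unfolding h_def using x_eq[OF _ that] by (auto intro: nth_equalityI)
  ultimately show ?thesis unfolding ring_iso_def by blast
qed

end

section \<open>Finitely spanned subspaces of a base change\<close>

context tensor_algebras
begin

text \<open>Each generator is supported by finitely many of its slices, and multiplication by
  \<open>1 \<otimes> s\<close> only changes the functional. So finitely many slices of the
  generators span the slices of everything in the span.\<close>

lemma slices_lin_gen:
  assumes E: "finite E" "E \<subseteq> carrier T"
  obtains F where "finite F" "F \<subseteq> (\<Union>e\<in>E. slices e)"
    "\<And>b. b \<in> lin_gen S (pt \<one>\<^bsub>R\<^esub>) T E \<Longrightarrow> slices b \<subseteq> lin_gen k \<phi> R F"
proof -
  have "\<exists>F. finite F \<and> F \<subseteq> slices e \<and> slices e \<subseteq> lin_gen k \<phi> R F" if e: "e \<in> carrier T" for e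
  proof -
    obtain F where F: "finite F" "F \<subseteq> slices e" and
      supp: "\<And>P. P \<zero>\<^bsub>T\<^esub> \<Longrightarrow> (\<And>s y. s \<in> F \<Longrightarrow> y \<in> carrier S \<Longrightarrow> P (pt s y)) \<Longrightarrow>
        (\<And>x y. x \<in> carrier T \<Longrightarrow> y \<in> carrier T \<Longrightarrow> P x \<Longrightarrow> P y \<Longrightarrow> P (x \<oplus>\<^bsub>T\<^esub> y)) \<Longrightarrow> P e"
      using slice_support[OF e] by metis
    have FR: "F \<subseteq> carrier R" using F(2) slices_closed[OF e] by blast
    have "slice g e \<in> lin_gen k \<phi> R F" if g: "functional g" for g
    proof (rule supp)
      fix s y assume s: "s \<in> F" "y \<in> carrier S"
      then show "slice g (pt s y) \<in> lin_gen k \<phi> R F"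
        using lin_gen.scale[where \<phi> = \<phi> and R = R, OF s(1) linear_functionalD(1)[OF g s(2)]] slice_pt[OF g, of s y] FR by auto
    qed (use g in \<open>simp_all add: slice_zero slice_add lin_gen.zero lin_gen.add\<close>)
    then show ?thesis using F unfolding slices_def by blast
  qed
  then obtain G where G: "\<And>e. e \<in> carrier T \<Longrightarrow> finite (G e) \<and> G e \<subseteq> slices e \<and> slices e \<subseteq> lin_gen k \<phi> R (G e)"
    by metis
  define F where "F = (\<Union>e\<in>E. G e)"
  have GE: "finite (G e)" "G e \<subseteq> slices e" "slices e \<subseteq> lin_gen k \<phi> R (G e)" if "e \<in> E" for e
    using G E(2) that by blast+
  have FR: "F \<subseteq> carrier R"
    unfolding F_def using GE(2) slices_closed E(2) by blast
  note W = R.lin_closed_lin_gen[OF FR]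
  have GF: "lin_gen k \<phi> R (G e) \<subseteq> lin_gen k \<phi> R F" if "e \<in> E" for e
    by (rule R.lin_gen_least[OF W]) (use R.lin_gen_incl[OF FR] that in \<open>auto simp: F_def\<close>)
  have "b \<in> carrier T \<and> (\<forall>g. functional g \<longrightarrow> slice g b \<in> lin_gen k \<phi> R F)" if "b \<in> lin_gen S (pt \<one>\<^bsub>R\<^esub>) T E" for b
    using that
  proof induction
    case zero
    then show ?case by (simp add: slice_zero lin_gen.zero)
  next
    case (scale e s)
    then have e: "e \<in> carrier T" using E(2) by blast
    show ?case
    proof (intro conjI allI impI)
      show "pt \<one>\<^bsub>R\<^esub> s \<otimes>\<^bsub>T\<^esub> e \<in> carrier T" using scale e by simp
      fix g assume g: "functional g"
      note g' = S.functional_mult[OF g scale(2)]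
      have "slice (\<lambda>x. g (s \<otimes>\<^bsub>S\<^esub> x)) e \<in> lin_gen k \<phi> R F"
        using GE(3)[OF scale(1)] GF[OF scale(1)] g' unfolding slices_def by blast
      then show "slice g (pt \<one>\<^bsub>R\<^esub> s \<otimes>\<^bsub>T\<^esub> e) \<in> lin_gen k \<phi> R F"
        using slice_mult[OF g R.one_closed scale(2) e] slice_closed[OF g' e] by simp
    qed
  next
    case (add x y)
    then show ?case by (auto simp: slice_add intro: lin_gen.add)
  qed
  then have "\<And>b. b \<in> lin_gen S (pt \<one>\<^bsub>R\<^esub>) T E \<Longrightarrow> slices b \<subseteq> lin_gen k \<phi> R F" unfolding slices_def by blast
  moreover have "finite F" unfolding F_def using E(1) GE(1) by blast
  moreover have "F \<subseteq> (\<Union>e\<in>E. slices e)" unfolding F_def using GE(2) by blast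
  ultimately show ?thesis using that by blast
qed

end

context tensor_algebras
begin

lemma base_algebra:
  assumes "field S"
  shows "k_algebra S (pt \<one>\<^bsub>R\<^esub>) T"
proof -
  interpret field S by fact
  show ?thesis by unfold_locales (rule pt_r_hom)
qed

lemma lin_gen_base_change:
  assumes F: "F \<subseteq> carrier R" "carrier R \<subseteq> lin_gen k \<phi> R F"
  shows "carrier T \<subseteq> lin_gen S (pt \<one>\<^bsub>R\<^esub>) T ((\<lambda>f. pt f \<one>\<^bsub>S\<^esub>) ` F)"
proof
  fix z assume "z \<in> carrier T"
  then show "z \<in> lin_gen S (pt \<one>\<^bsub>R\<^esub>) T ((\<lambda>f. pt f \<one>\<^bsub>S\<^esub>) ` F)"
  proof (induction z rule: tensor_induct)
    case (pure a s)
    have "a \<in> lin_gen k \<phi> R F" using F(2) pure by blast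
    then have "a \<in> carrier R \<and> pt a s \<in> lin_gen S (pt \<one>\<^bsub>R\<^esub>) T ((\<lambda>f. pt f \<one>\<^bsub>S\<^esub>) ` F)"
    proof induction
      case zero
      then show ?case using pure by (simp add: lin_gen.zero)
    next
      case (scale f c)
      then have f: "f \<in> carrier R" using F(1) by blast
      have "pt (\<phi> c \<otimes>\<^bsub>R\<^esub> f) s = pt \<one>\<^bsub>R\<^esub> (\<psi> c \<otimes>\<^bsub>S\<^esub> s) \<otimes>\<^bsub>T\<^esub> pt f \<one>\<^bsub>S\<^esub>"
        using scale f pure by (simp add: pt_mult pt_scale)
      then show ?case using scale f pure by (auto intro!: lin_gen.scale)
    next
      case (add x y)
      then show ?case using pure by (simp add: pt_add lin_gen.add)
    qed
    then show ?case by blast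
  qed (rule lin_gen.add)
qed

end

text \<open>\<open>E\<close> consists of the nonzero idempotents on which
  \<open>A \<otimes> L\<close> acts through scalars. They are orthogonal, hence independent and
  finite in number. If their sum \<open>s\<close> were not 1, a character \<open>\<chi>\<close>
  vanishing at \<open>s\<close> would turn \<open>p\<close> into a member \<open>e\<close> of
  \<open>E\<close> with \<open>\<chi> e = 1\<close>, contradicting \<open>e = e s\<close>.\<close>

lemma split_of_separable:
  assumes L: "algebraically_closed L" and kL: "k_algebra k \<epsilon> L" and A: "k_algebra k \<phi> A"
    and sep: "separable_algebra k \<phi> A"
  shows "\<exists>n h. h \<in> ring_iso (tensor_ring k \<phi> A \<epsilon> L) (RDirProd_list (replicate n L)) \<and>
    (\<forall>l\<in>carrier L. h (pure_tensor k \<phi> A \<epsilon> L \<one>\<^bsub>A\<^esub> l) = replicate n l)"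
proof -
  interpret L: algebraically_closed L by fact
  interpret kL: k_algebra k \<epsilon> L by fact
  interpret A: k_algebra k \<phi> A by fact
  interpret AL: tensor_algebras k \<phi> A \<epsilon> L by unfold_locales
  interpret AA: tensor_algebras k \<phi> A \<phi> A by unfold_locales
  define \<rho> where "\<rho> = AL.pt \<one>\<^bsub>A\<^esub>"
  interpret N: k_algebra L \<rho> AL.T
    unfolding \<rho>_def by (rule AL.base_algebra[OF L.field_axioms])
  obtain p where p: "p \<in> carrier AA.T" "AA.lift A (\<lambda>a b. a \<otimes>\<^bsub>A\<^esub> b) p = \<one>\<^bsub>A\<^esub>"
    and comm: "\<And>a. a \<in> carrier A \<Longrightarrow> AA.pt a \<one>\<^bsub>A\<^esub> \<otimes>\<^bsub>AA.T\<^esub> p = AA.pt \<one>\<^bsub>A\<^esub> a \<otimes>\<^bsub>AA.T\<^esub> p"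
    using A.separableE[OF sep] by metis
  obtain F where F: "finite F" "F \<subseteq> carrier A" "carrier A \<subseteq> lin_gen k \<phi> A F"
    using A.separable_finite[OF sep] by metis
  define G where "G = (\<lambda>f. AL.pt f \<one>\<^bsub>L\<^esub>) ` F"
  have G: "finite G" "G \<subseteq> carrier AL.T" "carrier AL.T \<subseteq> lin_gen L \<rho> AL.T G"
    unfolding G_def \<rho>_def using F(1,2) AL.lin_gen_base_change[OF F(2,3)] by auto
  define E where "E = {e \<in> carrier AL.T. e \<noteq> \<zero>\<^bsub>AL.T\<^esub> \<and> e \<otimes>\<^bsub>AL.T\<^esub> e = e \<and>
    (\<forall>a\<in>carrier AL.T. \<exists>l\<in>carrier L. a \<otimes>\<^bsub>AL.T\<^esub> e = \<rho> l \<otimes>\<^bsub>AL.T\<^esub> e)}"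
  have Ec: "e \<in> carrier AL.T" "e \<noteq> \<zero>\<^bsub>AL.T\<^esub>" "e \<otimes>\<^bsub>AL.T\<^esub> e = e" if "e \<in> E" for e
    using that unfolding E_def by auto
  have Es: "\<exists>l\<in>carrier L. a \<otimes>\<^bsub>AL.T\<^esub> e = \<rho> l \<otimes>\<^bsub>AL.T\<^esub> e" if "e \<in> E" "a \<in> carrier AL.T" for a e
    using that unfolding E_def by blast
  \<comment> \<open>\<open>e e' = l e'\<close> for a scalar \<open>l\<close>, and multiplying once
    more by \<open>e\<close> changes nothing; so \<open>l = 0\<close> or \<open>e e' = e'\<close>.
    Exchanging the roles shows that distinct members are orthogonal.\<close>
  have absorb: "e \<otimes>\<^bsub>AL.T\<^esub> e' = \<zero>\<^bsub>AL.T\<^esub> \<or> e \<otimes>\<^bsub>AL.T\<^esub> e' = e'" if ee: "e \<in> E" "e' \<in> E" for e e'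
  proof -
    note c = Ec[OF ee(1)] Ec[OF ee(2)]
    obtain l where l: "l \<in> carrier L" "e \<otimes>\<^bsub>AL.T\<^esub> e' = \<rho> l \<otimes>\<^bsub>AL.T\<^esub> e'" using Es[OF ee(2) c(1)] by blast
    show ?thesis
    proof (cases "l = \<zero>\<^bsub>L\<^esub>")
      case True
      then show ?thesis using l c by simp
    next
      case False
      have "e \<otimes>\<^bsub>AL.T\<^esub> (e \<otimes>\<^bsub>AL.T\<^esub> e') = e \<otimes>\<^bsub>AL.T\<^esub> e'"
        using c by (simp add: AL.T.m_assoc[symmetric])
      then have "\<rho> l \<otimes>\<^bsub>AL.T\<^esub> (e \<otimes>\<^bsub>AL.T\<^esub> e') = \<rho> l \<otimes>\<^bsub>AL.T\<^esub> e'"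
        unfolding l(2)[symmetric] using l c AL.T.m_lcomm[of e "\<rho> l" e'] by simp
      then have "e \<otimes>\<^bsub>AL.T\<^esub> e' = e'"
        using N.scale_cancel[OF l(1) False, of e'] N.scale_cancel[OF l(1) False, of "e \<otimes>\<^bsub>AL.T\<^esub> e'"] c by simp
      then show ?thesis ..
    qed
  qed
  have orth: "e \<otimes>\<^bsub>AL.T\<^esub> e' = \<zero>\<^bsub>AL.T\<^esub>" if "e \<in> E" "e' \<in> E" "e \<noteq> e'" for e e'
    using absorb[OF that(1,2)] absorb[OF that(2,1)] that(3) AL.T.m_comm[OF Ec(1)[OF that(1)] Ec(1)[OF that(2)]] by auto
  have "finite E"
  proof (rule ccontr)
    assume inf: "infinite E"
    then obtain e where "e \<in> E" by (metis finite.emptyI ex_in_conv)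
    then have ne: "\<one>\<^bsub>AL.T\<^esub> \<noteq> \<zero>\<^bsub>AL.T\<^esub>" using Ec[of e] AL.T.one_zeroD by blast
    let ?K = "\<rho> ` carrier L"
    have "AL.T.finite_dimension ?K (carrier AL.T)"
      using N.finite_dimension_lin_gen[OF ne G(1,2)] G(3) N.lin_gen_closed[OF G(2)] by (simp add: subset_antisym)
    then obtain n where n: "AL.T.dimension n ?K (carrier AL.T)" unfolding AL.T.finite_dimension_def by blast
    obtain E' where E': "finite E'" "card E' = Suc n" "E' \<subseteq> E" using infinite_arbitrarily_large[OF inf] by metis
    obtain es where es: "set es = E'" "distinct es" using finite_distinct_list[OF E'(1)] by blast
    \<comment> \<open>Multiplication by \<open>e\<close> kills the span of the other members but not
      \<open>e\<close> itself.\<close>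
    have "AL.T.independent ?K es" if "set es \<subseteq> E" "distinct es" for es
      using that
    proof (induction es)
      case Nil
      then show ?case by simp
    next
      case (Cons e es)
      then have e: "e \<in> E" "e \<notin> set es" "set es \<subseteq> E" by auto
      have sc: "set es \<subseteq> carrier AL.T" using e Ec by blast
      have "x \<in> carrier AL.T \<and> e \<otimes>\<^bsub>AL.T\<^esub> x = \<zero>\<^bsub>AL.T\<^esub>" if "x \<in> lin_gen L \<rho> AL.T (set es)" for x
        using that
      proof induction
        case zero
        then show ?case using Ec(1)[OF e(1)] by simp
      next
        case (scale f l)
        then have f: "f \<in> carrier AL.T" "e \<otimes>\<^bsub>AL.T\<^esub> f = \<zero>\<^bsub>AL.T\<^esub>" using e sc orth[of e f] by auto
        then show ?case using Ec(1)[OF e(1)] scale(2) AL.T.m_lcomm[of e "\<rho> l" f] by simp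
      next
        case (add x y)
        then show ?case using Ec(1)[OF e(1)] by (simp add: AL.T.r_distr)
      qed
      then have "e \<notin> AL.T.Span ?K es"
        unfolding N.Span_eq_lin_gen[OF ne sc] using Ec[OF e(1)] by auto
      then show ?case using Cons e Ec(1)[OF e(1)] AL.T.li_Cons by auto
    qed
    from this[of es] have "length es \<le> n"
      using AL.T.independent_length_le_dimension[OF N.str_subfield[OF ne] n, of es] es E'(3) Ec(1) by auto
    then show False using es E'(2) distinct_card[OF es(2)] by simp
  qed
  define s where "s = (\<Oplus>\<^bsub>AL.T\<^esub>e\<in>E. e)"
  have Ef: "(\<lambda>e. e) \<in> E \<rightarrow> carrier AL.T" using Ec by blast
  have s: "s \<in> carrier AL.T" unfolding s_def using Ef by (rule AL.T.finsum_closed)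
  have es: "e \<otimes>\<^bsub>AL.T\<^esub> s = e" if e: "e \<in> E" for e
  proof -
    have "e \<otimes>\<^bsub>AL.T\<^esub> s = (\<Oplus>\<^bsub>AL.T\<^esub>x\<in>E. e \<otimes>\<^bsub>AL.T\<^esub> x)"
      unfolding s_def by (rule AL.T.finsum_rdistr[OF \<open>finite E\<close> Ec(1)[OF e] Ef])
    also have "\<dots> = (\<Oplus>\<^bsub>AL.T\<^esub>x\<in>E. if e = x then x else \<zero>\<^bsub>AL.T\<^esub>)"
      by (rule AL.T.finsum_cong') (use orth[OF e] Ec e in auto)
    also have "\<dots> = e" by (rule AL.T.finsum_singleton[OF e \<open>finite E\<close> Ef])
    finally show ?thesis .
  qed
  have ss: "s \<otimes>\<^bsub>AL.T\<^esub> s = s"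
  proof -
    have "s \<otimes>\<^bsub>AL.T\<^esub> s = (\<Oplus>\<^bsub>AL.T\<^esub>x\<in>E. x \<otimes>\<^bsub>AL.T\<^esub> s)"
      using AL.T.finsum_ldistr[OF \<open>finite E\<close> s Ef] unfolding s_def by simp
    also have "\<dots> = s" using es Ef unfolding s_def[symmetric] by (subst (2) s_def) (rule AL.T.finsum_cong', auto)
    finally show ?thesis .
  qed
  have s1: "s = \<one>\<^bsub>AL.T\<^esub>"
  proof (rule ccontr)
    assume "s \<noteq> \<one>\<^bsub>AL.T\<^esub>"
    let ?J = "PIdl\<^bsub>AL.T\<^esub> s"
    \<comment> \<open>An idempotent that is a unit equals 1, so the ideal generated by
      \<open>s\<close> is proper.\<close>
    have J1: "\<one>\<^bsub>AL.T\<^esub> \<notin> ?J"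
    proof
      assume "\<one>\<^bsub>AL.T\<^esub> \<in> ?J"
      then obtain r where r: "r \<in> carrier AL.T" "\<one>\<^bsub>AL.T\<^esub> = r \<otimes>\<^bsub>AL.T\<^esub> s" unfolding cgenideal_def by blast
      have "s = (r \<otimes>\<^bsub>AL.T\<^esub> s) \<otimes>\<^bsub>AL.T\<^esub> s" unfolding r(2)[symmetric] using s by simp
      also have "\<dots> = r \<otimes>\<^bsub>AL.T\<^esub> s" using r(1) s ss by (simp add: AL.T.m_assoc)
      finally show False using r(2) \<open>s \<noteq> \<one>\<^bsub>AL.T\<^esub>\<close> by simp
    qed
    obtain \<chi> where \<chi>: "\<chi> \<in> ring_hom AL.T L" "\<And>l. l \<in> carrier L \<Longrightarrow> \<chi> (\<rho> l) = l" "\<And>x. x \<in> ?J \<Longrightarrow> \<chi> x = \<zero>\<^bsub>L\<^esub>"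
      using character_exists[OF L N.k_algebra_axioms G AL.T.cgenideal_ideal[OF s] J1] by metis
    have \<chi>s: "\<chi> s = \<zero>\<^bsub>L\<^esub>" using \<chi>(3) AL.T.cgenideal_self[OF s] by blast
    define \<chi>' where "\<chi>' a = \<chi> (AL.pt a \<one>\<^bsub>L\<^esub>)" for a
    have \<chi>': "\<chi>' \<in> ring_hom A L"
      using ring_hom_trans[OF AL.pt_l_hom \<chi>(1)] unfolding \<chi>'_def comp_def .
    note [simp] = ring_hom_closed[OF \<chi>(1)] ring_hom_closed[OF \<chi>']
    have \<chi>'\<phi>: "\<chi>' (\<phi> c) = \<epsilon> c" if "c \<in> carrier k" for c
      unfolding \<chi>'_def AL.pt_str[OF that] \<rho>_def[symmetric] using \<chi>(2) that by simp
    have r: "(\<lambda>b. AL.pt \<one>\<^bsub>A\<^esub> (\<chi>' b)) \<in> ring_hom A AL.T"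
      using ring_hom_trans[OF \<chi>' AL.pt_r_hom] by (simp add: comp_def)
    have bal: "AL.pt (\<phi> c) \<one>\<^bsub>L\<^esub> = AL.pt \<one>\<^bsub>A\<^esub> (\<chi>' (\<phi> c))" if "c \<in> carrier k" for c
      using AL.pt_str[OF that] \<chi>'\<phi>[OF that] by simp
    \<comment> \<open>This is \<open>id \<otimes> \<chi>'\<close> for the restriction
      \<open>\<chi>'\<close> of \<open>\<chi>\<close> to \<open>A\<close>. It turns the commutation
      rule for \<open>p\<close> into the statement that \<open>a \<otimes> 1\<close> acts on
      \<open>e\<close> as the scalar \<open>\<chi>' a\<close>.\<close>
    define \<Phi> where "\<Phi> = AA.lift AL.T (\<lambda>a b. AL.pt a \<one>\<^bsub>L\<^esub> \<otimes>\<^bsub>AL.T\<^esub> AL.pt \<one>\<^bsub>A\<^esub> (\<chi>' b))"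
    have \<Phi>: "\<Phi> \<in> ring_hom AA.T AL.T"
      "\<And>a b. a \<in> carrier A \<Longrightarrow> b \<in> carrier A \<Longrightarrow> \<Phi> (AA.pt a b) = AL.pt a (\<chi>' b)"
      unfolding \<Phi>_def using AA.lift_ring_hom[OF AL.T.cring_axioms AL.pt_l_hom r bal] by (simp_all add: AL.pt_split)
    define e where "e = \<Phi> p"
    have e: "e \<in> carrier AL.T" unfolding e_def using ring_hom_closed[OF \<Phi>(1) p(1)] .
    have split: "\<chi> (AL.pt a l) = \<chi>' a \<otimes>\<^bsub>L\<^esub> l" if "a \<in> carrier A" "l \<in> carrier L" for a l
      using ring_hom_mult[OF \<chi>(1), of "AL.pt a \<one>\<^bsub>L\<^esub>" "\<rho> l"] that \<chi>(2)[of l] unfolding \<chi>'_def \<rho>_def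
      by (simp add: AL.pt_split)
    have \<chi>\<Phi>: "\<chi> (\<Phi> z) = \<chi>' (AA.lift A (\<lambda>a b. a \<otimes>\<^bsub>A\<^esub> b) z)" if "z \<in> carrier AA.T" for z
      using AA.ring_hom_eqI[OF ring_hom_trans[OF \<Phi>(1) \<chi>(1)] ring_hom_trans[OF A.mu_hom \<chi>'] _ that]
      by (simp add: \<Phi>(2) split A.mu_pt ring_hom_mult[OF \<chi>'])
    have \<chi>e: "\<chi> e = \<one>\<^bsub>L\<^esub>" unfolding e_def using \<chi>\<Phi>[OF p(1)] p(2) ring_hom_one[OF \<chi>'] by simp
    have ae: "AL.pt a \<one>\<^bsub>L\<^esub> \<otimes>\<^bsub>AL.T\<^esub> e = \<rho> (\<chi>' a) \<otimes>\<^bsub>AL.T\<^esub> e" if a: "a \<in> carrier A" for a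
    proof -
      have "\<Phi> (AA.pt a \<one>\<^bsub>A\<^esub> \<otimes>\<^bsub>AA.T\<^esub> p) = \<Phi> (AA.pt \<one>\<^bsub>A\<^esub> a \<otimes>\<^bsub>AA.T\<^esub> p)" using comm[OF a] by simp
      then show ?thesis
        using a p(1) unfolding \<rho>_def e_def
        by (simp add: ring_hom_mult[OF \<Phi>(1)] \<Phi>(2) ring_hom_one[OF \<chi>'])
    qed
    have xe: "x \<otimes>\<^bsub>AL.T\<^esub> e = \<rho> (\<chi> x) \<otimes>\<^bsub>AL.T\<^esub> e" if "x \<in> carrier AL.T" for x
      using that
    proof (induction x rule: AL.tensor_induct)
      case (pure a l)
      have "AL.pt a l \<otimes>\<^bsub>AL.T\<^esub> e = \<rho> l \<otimes>\<^bsub>AL.T\<^esub> (AL.pt a \<one>\<^bsub>L\<^esub> \<otimes>\<^bsub>AL.T\<^esub> e)"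
        using pure e unfolding \<rho>_def by (simp add: AL.T.m_assoc[symmetric] AL.pt_mult)
      also have "\<dots> = (\<rho> l \<otimes>\<^bsub>AL.T\<^esub> \<rho> (\<chi>' a)) \<otimes>\<^bsub>AL.T\<^esub> e" unfolding ae[OF pure(1)]
        using pure e by (simp add: AL.T.m_assoc del: N.str_simps)
      finally show ?case using split pure AL.T.m_comm[of "\<rho> l" "\<rho> (\<chi>' a)"] by simp
    next
      case (add x y)
      then show ?case using e by (simp add: AL.T.l_distr ring_hom_add[OF \<chi>(1)])
    qed
    have "\<chi> \<zero>\<^bsub>AL.T\<^esub> = \<zero>\<^bsub>L\<^esub>" using ring_hom_zero[OF \<chi>(1) AL.T.ring_axioms L.ring_axioms] .
    then have "e \<noteq> \<zero>\<^bsub>AL.T\<^esub>" using \<chi>e by auto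
    moreover have "e \<otimes>\<^bsub>AL.T\<^esub> e = e" using xe[OF e] \<chi>e e by simp
    ultimately have "e \<in> E" unfolding E_def using e xe ring_hom_closed[OF \<chi>(1)] by blast
    then have "\<chi> e = \<chi> e \<otimes>\<^bsub>L\<^esub> \<chi> s" using es[of e] ring_hom_mult[OF \<chi>(1) e s] by simp
    then show False using \<chi>e \<chi>s by simp
  qed
  obtain f where f: "bij_betw f {..<card E} E"
    using ex_bij_betw_nat_finite[OF \<open>finite E\<close>] by (auto simp: atLeast0LessThan)
  have fE: "f i \<in> E" if "i < card E" for i using f that by (auto simp: bij_betw_def)
  have "\<exists>h. h \<in> ring_iso AL.T (RDirProd_list (replicate (card E) L)) \<and>
    (\<forall>l\<in>carrier L. h (\<rho> l) = replicate (card E) l)"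
  proof (rule N.split_iso[of _ f])
    show "f i \<otimes>\<^bsub>AL.T\<^esub> f j = \<zero>\<^bsub>AL.T\<^esub>" if "i < card E" "j < card E" "i \<noteq> j" for i j
      using orth[OF fE[OF that(1)] fE[OF that(2)]] f that by (auto simp: bij_betw_def inj_on_def)
    have "(\<Oplus>\<^bsub>AL.T\<^esub>i\<in>{..<card E}. f i) = (\<Oplus>\<^bsub>AL.T\<^esub>x\<in>f ` {..<card E}. x)"
      by (rule AL.T.add.finprod_reindex[symmetric]) (use f fE Ec in \<open>auto simp: bij_betw_def\<close>)
    then show "(\<Oplus>\<^bsub>AL.T\<^esub>i\<in>{..<card E}. f i) = \<one>\<^bsub>AL.T\<^esub>" using f s1 unfolding s_def by (simp add: bij_betw_def)
  qed (use fE Ec Es in auto)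
  then show ?thesis unfolding \<rho>_def by blast
qed

text \<open>The coordinate idempotents show \<open>A \<otimes> L\<close> to be separable over
  \<open>L\<close>. \<open>separable_descent\<close> then applies with \<open>A \<otimes> L\<close>
  itself as \<open>B\<close> and the identity as embedding.\<close>

lemma separable_of_split:
  assumes L: "field L" and kL: "k_algebra k \<epsilon> L" and A: "k_algebra k \<phi> A"
    and h: "h \<in> ring_iso (tensor_ring k \<phi> A \<epsilon> L) (RDirProd_list (replicate n L))"
      "\<And>l. l \<in> carrier L \<Longrightarrow> h (pure_tensor k \<phi> A \<epsilon> L \<one>\<^bsub>A\<^esub> l) = replicate n l"
  shows "separable_algebra k \<phi> A"
proof -
  interpret L: field L by fact
  interpret kL: k_algebra k \<epsilon> L by fact
  interpret A: k_algebra k \<phi> A by fact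
  interpret AL: tensor_algebras k \<phi> A \<epsilon> L by unfold_locales
  let ?P = "RDirProd_list (replicate n L)"
  interpret P: cring ?P using RDirProd_replicate_cring[OF L.cring_axioms] .
  define \<rho> where "\<rho> = AL.pt \<one>\<^bsub>A\<^esub>"
  interpret N: k_algebra L \<rho> AL.T
    unfolding \<rho>_def by (rule AL.base_algebra[OF L])
  have hh: "h \<in> ring_hom AL.T ?P" and bij: "bij_betw h (carrier AL.T) (carrier ?P)"
    using h(1) unfolding ring_iso_def by auto
  interpret h: ring_hom_cring AL.T ?P h using hh by unfold_locales
  have inj: "inj_on h (carrier AL.T)" using bij by (simp add: bij_betw_def)
  define u where "u i = map (\<lambda>j. if i = j then \<one>\<^bsub>L\<^esub> else \<zero>\<^bsub>L\<^esub>) [0..<n]" for i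
  have u: "u i \<in> carrier ?P" for i unfolding u_def carrier_RDirProd_replicate by auto
  define e where "e i = inv_into (carrier AL.T) h (u i)" for i
  have e: "e i \<in> carrier AL.T" "h (e i) = u i" for i
    unfolding e_def using bij u[of i] by (auto simp: bij_betw_def f_inv_into_f inv_into_into)
  have nth: "ring_hom_cring ?P L (\<lambda>xs. xs ! j)" if "j < n" for j
    using nth_RDirProd_replicate_hom[OF that] by unfold_locales
  have sum: "(\<Oplus>\<^bsub>AL.T\<^esub>i\<in>{..<n}. e i) = \<one>\<^bsub>AL.T\<^esub>"
  proof (rule inj_onD[OF inj])
    have eP: "e \<in> {..<n} \<rightarrow> carrier AL.T" using e by auto
    have "h (\<Oplus>\<^bsub>AL.T\<^esub>i\<in>{..<n}. e i) = (\<Oplus>\<^bsub>?P\<^esub>i\<in>{..<n}. (h \<circ> e) i)"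
      by (rule h.hom_finsum[OF eP])
    also have "\<dots> = (\<Oplus>\<^bsub>?P\<^esub>i\<in>{..<n}. u i)" by (rule P.finsum_cong') (use e u in auto)
    also have "\<dots> = \<one>\<^bsub>?P\<^esub>"
    proof (rule nth_equalityI)
      have uP: "u \<in> {..<n} \<rightarrow> carrier ?P" using u by auto
      then have c: "(\<Oplus>\<^bsub>?P\<^esub>i\<in>{..<n}. u i) \<in> carrier ?P" by (rule P.finsum_closed)
      then show "length (\<Oplus>\<^bsub>?P\<^esub>i\<in>{..<n}. u i) = length \<one>\<^bsub>?P\<^esub>"
        by (simp add: carrier_RDirProd_replicate one_RDirProd_replicate)
      fix j assume "j < length (\<Oplus>\<^bsub>?P\<^esub>i\<in>{..<n}. u i)"
      then have j: "j < n" using c by (simp add: carrier_RDirProd_replicate)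
      have "(\<Oplus>\<^bsub>?P\<^esub>i\<in>{..<n}. u i) ! j = (\<Oplus>\<^bsub>L\<^esub>i\<in>{..<n}. ((\<lambda>xs. xs ! j) \<circ> u) i)"
        by (rule ring_hom_cring.hom_finsum[OF nth[OF j] uP])
      also have "\<dots> = (\<Oplus>\<^bsub>L\<^esub>i\<in>{..<n}. if j = i then \<one>\<^bsub>L\<^esub> else \<zero>\<^bsub>L\<^esub>)"
        by (rule L.finsum_cong') (use j in \<open>auto simp: u_def\<close>)
      also have "\<dots> = \<one>\<^bsub>L\<^esub>" by (rule L.finsum_singleton) (use j in auto)
      finally show "(\<Oplus>\<^bsub>?P\<^esub>i\<in>{..<n}. u i) ! j = \<one>\<^bsub>?P\<^esub> ! j" using j by (simp add: one_RDirProd_replicate)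
    qed
    finally show "h (\<Oplus>\<^bsub>AL.T\<^esub>i\<in>{..<n}. e i) = h \<one>\<^bsub>AL.T\<^esub>" by simp
    show "(\<Oplus>\<^bsub>AL.T\<^esub>i\<in>{..<n}. e i) \<in> carrier AL.T" using eP by (rule AL.T.finsum_closed)
  qed simp
  have idem: "e i \<otimes>\<^bsub>AL.T\<^esub> e i = e i" for i
  proof (rule inj_onD[OF inj])
    show "h (e i \<otimes>\<^bsub>AL.T\<^esub> e i) = h (e i)"
      using e[of i] RDirProd_replicate_ops(1)[OF u u, of i i] by (auto simp: u_def intro: nth_equalityI)
  qed (use e in auto)
  have scalar: "\<exists>l\<in>carrier L. a \<otimes>\<^bsub>AL.T\<^esub> e i = \<rho> l \<otimes>\<^bsub>AL.T\<^esub> e i" if a: "a \<in> carrier AL.T" and i: "i < n" for a i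
  proof
    have ha: "length (h a) = n" "set (h a) \<subseteq> carrier L" "h a \<in> carrier ?P"
      using h.hom_closed[OF a] by (auto simp: carrier_RDirProd_replicate)
    show l: "h a ! i \<in> carrier L" using ha i nth_mem[of i "h a"] by blast
    have hl: "h (\<rho> (h a ! i)) = replicate n (h a ! i)" unfolding \<rho>_def using h(2)[OF l] .
    have rc: "replicate n (h a ! i) \<in> carrier ?P" using l by (auto simp: carrier_RDirProd_replicate)
    show "a \<otimes>\<^bsub>AL.T\<^esub> e i = \<rho> (h a ! i) \<otimes>\<^bsub>AL.T\<^esub> e i"
    proof (rule inj_onD[OF inj])
      have "h a ! j \<in> carrier L" if "j < n" for j using ha that nth_mem[of j "h a"] by auto
      then have "map2 (\<lambda>x y. x \<otimes>\<^bsub>L\<^esub> y) (h a) (u i) = map2 (\<lambda>x y. x \<otimes>\<^bsub>L\<^esub> y) (replicate n (h a ! i)) (u i)"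
        using ha(1) i by (auto simp: u_def intro!: nth_equalityI)
      then show "h (a \<otimes>\<^bsub>AL.T\<^esub> e i) = h (\<rho> (h a ! i) \<otimes>\<^bsub>AL.T\<^esub> e i)"
        using a e[of i] l hl RDirProd_replicate_ops(1)[OF ha(3) u, of i] RDirProd_replicate_ops(1)[OF rc u, of i] by simp
    qed (use a e l in auto)
  qed
  have sepN: "separable_algebra L \<rho> AL.T" and gen: "carrier AL.T \<subseteq> lin_gen L \<rho> AL.T (e ` {..<n})"
    using N.separable_of_idempotents[of "{..<n}" e] e(1) sum idem scalar by auto
  obtain F where F: "finite F" "F \<subseteq> (\<Union>x\<in>e ` {..<n}. AL.slices x)"
    "\<And>b. b \<in> lin_gen L \<rho> AL.T (e ` {..<n}) \<Longrightarrow> AL.slices b \<subseteq> lin_gen k \<phi> A F"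
    unfolding \<rho>_def by (rule AL.slices_lin_gen[of "e ` {..<n}"]) (use e(1) in auto)
  have FA: "F \<subseteq> carrier A" using F(2) e(1) AL.slices_closed by blast
  \<comment> \<open>A functional with value 1 at 1 recovers \<open>a\<close> as a slice of
    \<open>a \<otimes> 1\<close>; so the slices in \<open>F\<close> span \<open>A\<close> and in
    particular generate it.\<close>
  obtain g where g: "AL.functional g" "g \<one>\<^bsub>L\<^esub> = \<one>\<^bsub>k\<^esub>" using kL.functional_exists[OF L.one_closed L.one_not_zero] by metis
  have "a \<in> alg_gen k \<phi> A F" if a: "a \<in> carrier A" for a
  proof -
    have "AL.slice g (AL.pt a \<one>\<^bsub>L\<^esub>) = a" using AL.slice_pt[OF g(1) a L.one_closed] g(2) a by simp
    then have "a \<in> AL.slices (AL.pt a \<one>\<^bsub>L\<^esub>)" unfolding AL.slices_def using g(1) by force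
    moreover have "AL.slices (AL.pt a \<one>\<^bsub>L\<^esub>) \<subseteq> lin_gen k \<phi> A F" using F(3) gen a by blast
    moreover have "lin_gen k \<phi> A F \<subseteq> alg_gen k \<phi> A F"
      by (rule A.lin_gen_least[OF A.lin_closed_subring[OF A.alg_gen_subring(1,2)[OF FA]] A.alg_gen_subring(3)[OF FA]])
    ultimately show ?thesis by (meson subsetD)
  qed
  then have agen: "carrier A \<subseteq> alg_gen k \<phi> A F" by (rule subsetI)
  show ?thesis
  proof (rule separable_descent[OF A kL N.k_algebra_axioms sepN _ _ F(1) _ agen])
    show "(\<lambda>x. x) \<in> ring_hom AL.T AL.T" by (rule ring_hom_memI) auto
    show "F \<subseteq> (\<Union>b\<in>carrier AL.T. AL.slices b)" using F(2) e(1) by auto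
  qed (simp add: \<rho>_def)
qed

theorem etale_iff_separable:
  assumes "k_algebra k \<phi> A"
  shows "etale_algebra k \<phi> A \<longleftrightarrow> separable_algebra k \<phi> A"
proof -
  interpret A: k_algebra k \<phi> A by fact
  interpret C: algebraic_closure "A.k.alg_closure" "A.k.indexed_const ` carrier k"
    by (rule A.k.alg_closureE(1))
  have kL: "k_algebra k A.k.indexed_const A.k.alg_closure"
    by unfold_locales (rule A.k.alg_closureE(2))
  show ?thesis
    unfolding etale_algebra_def Let_def
    using split_of_separable[OF C.algebraically_closed_axioms kL assms]
      separable_of_split[OF C.field_axioms kL assms] by blast
qed

section \<open>\<open>\<sigma>\<close>-separability of finite algebras\<close>

lemma difference_algebra_k_algebra: "difference_algebra k \<phi> R \<Longrightarrow> k_algebra k \<phi> R"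
  unfolding difference_algebra_def difference_field_def difference_ring_def k_algebra_def k_algebra_axioms_def
  by blast

text \<open>Besides the bound, equality detects independence, so that a spanning list of the right
  length is a base.\<close>

lemma (in ring) Span_dimension_le:
  assumes K: "subfield K R" and Us: "set Us \<subseteq> carrier R"
  shows "\<exists>d\<le>length Us. dimension d K (Span K Us) \<and> (d = length Us \<longrightarrow> independent K Us)"
  using Us
proof (induction Us)
  case Nil
  then show ?case using zero_dim by simp
next
  case (Cons u Us)
  then obtain d where d: "d \<le> length Us" "dimension d K (Span K Us)" "d = length Us \<longrightarrow> independent K Us" by auto
  show ?case
  proof (cases "u \<in> Span K Us")
    case True
    have "set Us \<subseteq> carrier R" using Cons.prems by simp
    then have "Span K (u # Us) = Span K Us"
      using mono_Span_subset[OF K, of "u # Us" Us] mono_Span[OF K, of Us u] Span_base_incl[OF K, of Us] True Cons.prems by auto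
    then show ?thesis using d by (intro exI[of _ d]) simp
  next
    case False
    then show ?thesis
      using d Suc_dim[of u "Span K Us" d K] li_Cons[of u K Us] Cons.prems by (intro exI[of _ "Suc d"]) auto
  qed
qed

section \<open>Spans and generated subalgebras under \<sigma>\<close>

context
  fixes k :: "('k, 'l) difference_ring_scheme" and \<phi> :: "'k \<Rightarrow> 'a" and R :: "('a, 'm) difference_ring_scheme"
  assumes dR: "difference_algebra k \<phi> R"
begin

interpretation R: k_algebra k \<phi> R
  using difference_algebra_k_algebra[OF dR] .

lemma sig_R_closed: "x \<in> carrier R \<Longrightarrow> sig R x \<in> carrier R"
  using ring_hom_closed[OF difference_algebraD(4)[OF dR]] .

lemma sig_lin_gen:
  assumes F: "F \<subseteq> carrier R" and x: "x \<in> lin_gen k \<phi> R F"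
  shows "sig R x \<in> lin_gen k \<phi> R (sig R ` F)"
proof -
  note d = difference_algebraD[OF dR]
  have "x \<in> carrier R \<and> sig R x \<in> lin_gen k \<phi> R (sig R ` F)"
    using x
  proof induction
    case zero
    then show ?case using ring_hom_zero[OF d(4) R.ring_axioms R.ring_axioms] by (simp add: lin_gen.zero)
  next
    case (scale f c)
    then have f: "f \<in> carrier R" using F by blast
    then have "sig R (\<phi> c \<otimes>\<^bsub>R\<^esub> f) = \<phi> (sig k c) \<otimes>\<^bsub>R\<^esub> sig R f"
      using ring_hom_mult[OF d(4), of "\<phi> c" f] d(5)[OF scale(2)] scale(2) by simp
    then show ?case using scale f d(6) by (simp add: lin_gen.scale)
  next
    case (add x y)
    then show ?case using ring_hom_add[OF d(4), of x y] by (simp add: lin_gen.add)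
  qed
  then show ?thesis by blast
qed

text \<open>\<sigma> is only semilinear, but the images of a base \<open>Us\<close> of the span
  \<open>V\<close> of \<open>F\<close> still generate the \<open>k\<close>-space spanned by
  \<sigma>(V), whose dimension is therefore at most that of \<open>V\<close>. As \<open>V\<close> is
  contained in it, the two spaces coincide.\<close>

lemma lin_gen_sig_stable:
  assumes F: "finite F" "F \<subseteq> carrier R" "F \<subseteq> lin_gen k \<phi> R (sig R ` F)"
  shows "sig R ` F \<subseteq> lin_gen k \<phi> R F"
proof (cases "\<one>\<^bsub>R\<^esub> = \<zero>\<^bsub>R\<^esub>")
  case True
  then have "carrier R = {\<zero>\<^bsub>R\<^esub>}" using R.one_zeroD by simp
  then show ?thesis using F(2) sig_R_closed lin_gen.zero[of R k \<phi> F] by fastforce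
next
  case False
  let ?K = "\<phi> ` carrier k"
  note s = R.str_subfield[OF False]
  obtain Fs where Fs: "set Fs = F" using finite_list[OF F(1)] by blast
  obtain Us where Us: "set Us \<subseteq> carrier R" "R.independent ?K Us" "R.Span ?K Us = R.Span ?K Fs"
    using R.filter_base[OF s, of Fs] F(2) Fs by metis
  have V: "lin_gen k \<phi> R (set Us) = lin_gen k \<phi> R F"
    using Us(3) R.Span_eq_lin_gen[OF False] Us(1) F(2) Fs by simp
  have sU: "set (map (sig R) Us) \<subseteq> carrier R" using Us(1) sig_R_closed by auto
  have W: "R.Span ?K (map (sig R) Us) = lin_gen k \<phi> R (sig R ` set Us)"
    using R.Span_eq_lin_gen[OF False sU] by simp
  have sF: "sig R ` F \<subseteq> lin_gen k \<phi> R (sig R ` set Us)"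
    using sig_lin_gen[OF Us(1)] R.lin_gen_incl[OF F(2)] V by blast
  have lc: "R.lin_closed (lin_gen k \<phi> R (sig R ` set Us))"
    using R.lin_closed_lin_gen sU by simp
  have "F \<subseteq> R.Span ?K (map (sig R) Us)"
    unfolding W using F(3) R.lin_gen_least[OF lc sF] by blast
  moreover have "set Us \<subseteq> lin_gen k \<phi> R F" using R.lin_gen_incl[OF Us(1)] V by simp
  ultimately have UW: "set Us \<subseteq> R.Span ?K (map (sig R) Us)"
    using R.lin_gen_least[OF lc] W by blast
  obtain d where d: "d \<le> length Us" "R.dimension d ?K (R.Span ?K (map (sig R) Us))"
    using R.Span_dimension_le[OF s sU] by auto
  have "length Us = d"
    using R.independent_length_le_dimension[OF s d(2) Us(2) UW] d(1) by simp
  then have "R.Span ?K Us = R.Span ?K (map (sig R) Us)"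
    using R.independent_length_eq_dimension[OF s d(2) Us(2) UW] by simp
  then show ?thesis using sF W V R.Span_eq_lin_gen[OF False Us(1)] by simp
qed

text \<open>The span of \<sigma>(A) contains the scalars and \<open>F\<close>, and it is closed
  under products because \<open>\<sigma>(a) \<sigma>(b) = \<sigma>(a b)\<close>. So a condition on
  the generators carries over to the whole algebra.\<close>

lemma alg_gen_sig_stable:
  assumes F: "F \<subseteq> carrier R" "sig R ` F \<subseteq> alg_gen k \<phi> R F"
    "F \<subseteq> lin_gen k \<phi> R (sig R ` alg_gen k \<phi> R F)"
  shows "difference_subalgebra (alg_gen k \<phi> R F) k \<phi> R"
    "alg_gen k \<phi> R F \<subseteq> lin_gen k \<phi> R (sig R ` alg_gen k \<phi> R F)"
proof -
  note d = difference_algebraD[OF dR]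
  let ?A = "alg_gen k \<phi> R F"
  note A = R.alg_gen_subring[OF F(1)]
  note Ac = subringE(1)[OF A(1)]
  have "sig R a \<in> ?A" if "a \<in> ?A" for a
    using that
  proof induction
    case (str c)
    then show ?case using d(5,6) by (simp add: alg_gen.str)
  next
    case (incl f)
    then show ?case using F(2) by blast
  next
    case (add x y)
    then have "x \<in> carrier R" "y \<in> carrier R" using Ac by blast+
    then show ?case using add by (simp add: ring_hom_add[OF d(4)] alg_gen.add)
  next
    case (mult x y)
    then have "x \<in> carrier R" "y \<in> carrier R" using Ac by blast+
    then show ?case using mult by (simp add: ring_hom_mult[OF d(4)] alg_gen.mult)
  qed
  then show "difference_subalgebra ?A k \<phi> R"
    unfolding difference_subalgebra_def using A by blast
  have sA: "sig R ` ?A \<subseteq> carrier R" using Ac sig_R_closed by auto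
  let ?W = "lin_gen k \<phi> R (sig R ` ?A)"
  have Wc: "?W \<subseteq> carrier R" using R.lin_gen_closed[OF sA] .
  have Wl: "\<phi> c \<otimes>\<^bsub>R\<^esub> x \<in> ?W" if "c \<in> carrier k" "x \<in> ?W" for c x
    using R.lin_closed_lin_gen[OF sA] that unfolding R.lin_closed_def by blast
  have Wm1: "sig R a \<otimes>\<^bsub>R\<^esub> x \<in> ?W" if "a \<in> ?A" "x \<in> ?W" for a x
    using that(2)
  proof induction
    case zero
    then show ?case using sig_R_closed[of a] that(1) Ac by (simp add: lin_gen.zero subset_iff)
  next
    case (scale f c)
    then obtain b where b: "b \<in> ?A" "f = sig R b" by blast
    have ab: "a \<in> carrier R" "b \<in> carrier R" using b that(1) Ac by auto
    have "sig R a \<otimes>\<^bsub>R\<^esub> (\<phi> c \<otimes>\<^bsub>R\<^esub> f) = \<phi> c \<otimes>\<^bsub>R\<^esub> sig R (a \<otimes>\<^bsub>R\<^esub> b)"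
      using ab scale(2) sig_R_closed unfolding b(2) by (simp add: ring_hom_mult[OF d(4)] R.m_lcomm)
    moreover have "sig R (a \<otimes>\<^bsub>R\<^esub> b) \<in> sig R ` ?A" using alg_gen.mult[OF that(1) b(1)] by blast
    ultimately show ?case using scale(2) by (simp add: lin_gen.scale)
  next
    case (add x y)
    then have "x \<in> carrier R" "y \<in> carrier R" using Wc by blast+
    moreover have "sig R a \<in> carrier R" using sig_R_closed that(1) Ac by blast
    ultimately show ?case using add by (simp add: R.r_distr lin_gen.add)
  qed
  have Wm: "x \<otimes>\<^bsub>R\<^esub> y \<in> ?W" if "x \<in> ?W" "y \<in> ?W" for x y
    using that(1)
  proof induction
    case zero
    then show ?case using that(2) Wc by (simp add: lin_gen.zero subset_iff)
  next
    case (scale f c)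
    then obtain b where b: "b \<in> ?A" "f = sig R b" by blast
    have "b \<in> carrier R" "y \<in> carrier R" using b Ac that(2) Wc by auto
    then have "\<phi> c \<otimes>\<^bsub>R\<^esub> f \<otimes>\<^bsub>R\<^esub> y = \<phi> c \<otimes>\<^bsub>R\<^esub> (sig R b \<otimes>\<^bsub>R\<^esub> y)"
      using scale(2) sig_R_closed unfolding b(2) by (simp add: R.m_assoc)
    then show ?case using Wl[OF scale(2) Wm1[OF b(1) that(2)]] by simp
  next
    case (add x x')
    then have "x \<in> carrier R" "x' \<in> carrier R" "y \<in> carrier R" using Wc that(2) by auto
    then show ?case using add by (simp add: R.l_distr lin_gen.add)
  qed
  have Wk: "\<phi> c \<in> ?W" if c: "c \<in> carrier k" for c
  proof -
    have "\<one>\<^bsub>R\<^esub> \<in> sig R ` ?A" using ring_hom_one[OF d(4)] subringE(3)[OF A(1)] by force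
    from lin_gen.scale[where \<phi> = \<phi> and R = R, OF this c] show ?thesis using c by simp
  qed
  show "?A \<subseteq> ?W"
  proof (intro subsetI)
    fix x assume "x \<in> ?A"
    then show "x \<in> ?W"
    proof induction
      case (incl f)
      then show ?case using F(3) by blast
    qed (use Wk Wm in \<open>simp_all add: lin_gen.add\<close>)
  qed
qed

section \<open>Coordinates in \<open>R \<otimes> K\<close> and the action of \<sigma> on
  them\<close>

context
  fixes \<iota> :: "'k \<Rightarrow> 'b" and K :: "('b, 'n) difference_ring_scheme"
  assumes dK: "difference_field_extension k \<iota> K"
begin

interpretation K: k_algebra k \<iota> K
  using difference_algebra_k_algebra dK unfolding difference_field_extension_def by blast

interpretation K: field K
  using dK unfolding difference_field_extension_def difference_field_def by blast

interpretation RK: tensor_algebras k \<phi> R \<iota> K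
  by unfold_locales

lemma sig_tensor_hom: "sig (tensor k \<phi> R \<iota> K) \<in> ring_hom RK.T RK.T"
  using difference_algebraD(4)[OF tensor_base_change[OF dR dK]]
  unfolding ring_hom_def tensor_simps tensor_carrier(2) .

lemma sig_tensor_pt:
  "r \<in> carrier R \<Longrightarrow> s \<in> carrier K \<Longrightarrow> sig (tensor k \<phi> R \<iota> K) (RK.pt r s) = RK.pt (sig R r) (sig K s)"
  using sig_tensor[OF dR, of \<iota> K "frag_of (r, s)"] dK
  unfolding difference_field_extension_def pure_tensor_def by (simp add: keys_frag_of)

text \<open>The tensor with coefficients \<open>ss\<close> along the vectors \<open>us\<close>; the
  surplus of the longer list is dropped.\<close>

fun pure_sum :: "'a list \<Rightarrow> 'b list \<Rightarrow> ('a \<times> 'b \<Rightarrow>\<^sub>0 int) set"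
  where "pure_sum (u # us) (s # ss) = RK.pt u s \<oplus>\<^bsub>RK.T\<^esub> pure_sum us ss"
  | "pure_sum us ss = \<zero>\<^bsub>RK.T\<^esub>"

lemma pure_sum_closed: "set us \<subseteq> carrier R \<Longrightarrow> set ss \<subseteq> carrier K \<Longrightarrow> pure_sum us ss \<in> carrier RK.T"
  by (induction us ss rule: pure_sum.induct) auto

lemma sig_pure_sum:
  "set us \<subseteq> carrier R \<Longrightarrow> set ss \<subseteq> carrier K \<Longrightarrow>
    sig (tensor k \<phi> R \<iota> K) (pure_sum us ss) = pure_sum (map (sig R) us) (map (sig K) ss)"
proof (induction us ss rule: pure_sum.induct)
  case (1 u us s ss)
  then show ?case
    using ring_hom_add[OF sig_tensor_hom, of "RK.pt u s" "pure_sum us ss"] sig_tensor_pt[of u s] pure_sum_closed[of us ss] by simp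
qed (use ring_hom_zero[OF sig_tensor_hom RK.T.ring_axioms RK.T.ring_axioms] in auto)

lemma slice_pure_sum:
  assumes g: "RK.functional g"
  shows "set us \<subseteq> carrier R \<Longrightarrow> set ss \<subseteq> carrier K \<Longrightarrow>
    RK.slice g (pure_sum us ss) = R.combine (map (\<lambda>s. \<phi> (g s)) ss) us"
  by (induction us ss rule: pure_sum.induct)
    (auto simp: RK.slice_add[OF g] RK.slice_pt[OF g] pure_sum_closed RK.slice_zero[OF g])

text \<open>A nonzero coefficient is detected by a functional \<open>g\<close>, and slicing by
  \<open>g\<close> would give a nontrivial relation among \<open>us\<close> over
  \<open>k\<close>.\<close>

lemma pure_sum_independent:
  assumes us: "R.independent (\<phi> ` carrier k) us" "\<one>\<^bsub>R\<^esub> \<noteq> \<zero>\<^bsub>R\<^esub>" and ss: "set ss \<subseteq> carrier K" "length ss = length us"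
    and zero: "pure_sum us ss = \<zero>\<^bsub>RK.T\<^esub>"
  shows "set ss \<subseteq> {\<zero>\<^bsub>K\<^esub>}"
proof
  fix s assume s: "s \<in> set ss"
  note sf = R.str_subfield[OF us(2)]
  show "s \<in> {\<zero>\<^bsub>K\<^esub>}"
  proof (rule ccontr)
    assume "s \<notin> {\<zero>\<^bsub>K\<^esub>}"
    then obtain g where g: "RK.functional g" "g s = \<one>\<^bsub>k\<^esub>"
      using K.functional_exists[of s] s ss(1) by auto
    have "R.combine (map (\<lambda>s. \<phi> (g s)) ss) us = \<zero>\<^bsub>R\<^esub>"
      using slice_pure_sum[OF g(1) R.independent_in_carrier[OF us(1)] ss(1)] zero RK.slice_zero[OF g(1)] by simp
    moreover have "set (map (\<lambda>s. \<phi> (g s)) ss) \<subseteq> \<phi> ` carrier k"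
      using ss(1) linear_functionalD(1)[OF g(1)] by auto
    ultimately have "set (take (length us) (map (\<lambda>s. \<phi> (g s)) ss)) \<subseteq> {\<zero>\<^bsub>R\<^esub>}"
      using R.independent_imp_trivial_combine[OF sf us(1)] by blast
    then have "\<phi> (g s) = \<zero>\<^bsub>R\<^esub>" using s ss(2) by auto
    then show False using g(2) us(2) by simp
  qed
qed

lemma pure_sum_exists:
  assumes us: "set us \<subseteq> carrier R" "R.Span (\<phi> ` carrier k) us = carrier R" "\<one>\<^bsub>R\<^esub> \<noteq> \<zero>\<^bsub>R\<^esub>" and z: "z \<in> carrier RK.T"
  shows "\<exists>ss. set ss \<subseteq> carrier K \<and> length ss = length us \<and> z = pure_sum us ss"
  using z
proof (induction z rule: RK.tensor_induct)
  case (pure a s)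
  note sf = R.str_subfield[OF us(3)]
  have "a \<in> R.Span (\<phi> ` carrier k) us" using us(2) pure by simp
  then obtain Ks where Ks: "set Ks \<subseteq> \<phi> ` carrier k" "length Ks = length us" "a = R.combine Ks us"
    using R.Span_mem_iff_length_version[OF sf us(1)] by blast
  have "\<exists>ss. set ss \<subseteq> carrier K \<and> length ss = length us \<and> RK.pt (R.combine Ks us) s = pure_sum us ss"
    using Ks(2,1) us(1)
  proof (induction Ks us rule: list_induct2)
    case Nil
    then show ?case using pure by simp
  next
    case (Cons x xs u us)
    then obtain ss where ss: "set ss \<subseteq> carrier K" "length ss = length us" "RK.pt (R.combine xs us) s = pure_sum us ss"
      by auto
    obtain c where c: "c \<in> carrier k" "x = \<phi> c" using Cons.prems by auto
    have "R.combine xs us \<in> carrier R" using Cons.prems by (intro R.combine_in_carrier) auto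
    then have "RK.pt (R.combine (x # xs) (u # us)) s = pure_sum (u # us) (\<iota> c \<otimes>\<^bsub>K\<^esub> s # ss)"
      using c Cons.prems pure ss(3) by (simp add: RK.pt_add RK.pt_scale)
    then show ?case using ss c pure by (intro exI[of _ "\<iota> c \<otimes>\<^bsub>K\<^esub> s # ss"]) auto
  qed
  then show ?case using Ks(3) by simp
next
  case (add x y)
  then obtain ss ts where *: "set ss \<subseteq> carrier K" "length ss = length us" "x = pure_sum us ss"
    "set ts \<subseteq> carrier K" "length ts = length us" "y = pure_sum us ts" by blast
  have "pure_sum us ss \<oplus>\<^bsub>RK.T\<^esub> pure_sum us ts = pure_sum us (map2 (\<lambda>a b. a \<oplus>\<^bsub>K\<^esub> b) ss ts)"
    using *(2) *(5)[symmetric] *(1,4) us(1)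
  proof (induction ss us ts rule: list_induct3)
    case (Cons s ss u us t ts)
    have "pure_sum (u # us) (s # ss) \<oplus>\<^bsub>RK.T\<^esub> pure_sum (u # us) (t # ts) =
        (RK.pt u s \<oplus>\<^bsub>RK.T\<^esub> RK.pt u t) \<oplus>\<^bsub>RK.T\<^esub> (pure_sum us ss \<oplus>\<^bsub>RK.T\<^esub> pure_sum us ts)"
      using Cons.prems by (simp add: pure_sum_closed RK.T.a_ac)
    then show ?case using Cons by (simp add: RK.pt_add)
  qed simp
  moreover have "set (map2 (\<lambda>a b. a \<oplus>\<^bsub>K\<^esub> b) ss ts) \<subseteq> carrier K"
    using *(1,4) by (auto dest: set_zip_leftD set_zip_rightD)
  ultimately show ?case using * by (intro exI[of _ "map2 (\<lambda>a b. a \<oplus>\<^bsub>K\<^esub> b) ss ts"]) simp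
qed

end

end

text \<open>One extension decides: \<open>K = k\<close> with \<sigma> as structure map. There
  \<open>\<phi> c v \<otimes> 1 = v \<otimes> \<sigma>(c)\<close>, so a relation with coefficients
  \<open>cs\<close> among the \<sigma>-images of a base says that \<sigma> kills the tensor with
  coordinates \<open>cs\<close> along that base. Injectivity makes the relation trivial, and
  \<sigma> sends a base to a base.\<close>

lemma difference_separable_imp_span:
  fixes k :: "('k, 'l) difference_ring_scheme"
  assumes dR: "difference_algebra k \<phi> R" and F: "finite F" "F \<subseteq> carrier R" "carrier R \<subseteq> lin_gen k \<phi> R F"
    and sep: "difference_separable k \<phi> R"
  shows "carrier R \<subseteq> lin_gen k \<phi> R (sig R ` carrier R)"
proof (cases "\<one>\<^bsub>R\<^esub> = \<zero>\<^bsub>R\<^esub>")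
  case True
  interpret R: k_algebra k \<phi> R using difference_algebra_k_algebra[OF dR] .
  show ?thesis using True R.one_zeroD by (auto simp: lin_gen.zero)
next
  case False
  interpret R: k_algebra k \<phi> R using difference_algebra_k_algebra[OF dR] .
  have dk: "difference_field k" using dR unfolding difference_algebra_def by blast
  have sk: "sig k \<in> ring_hom k k"
    using dk unfolding difference_field_def difference_ring_def difference_ring_axioms_def by blast
  have ext: "difference_field_extension k (sig k) k"
    using dk sk unfolding difference_field_extension_def difference_algebra_def difference_field_def by blast
  interpret k: k_algebra k "sig k" k by unfold_locales (rule sk)
  interpret RK: tensor_algebras k \<phi> R "sig k" k by unfold_locales
  let ?K = "\<phi> ` carrier k"
  note s = R.str_subfield[OF False]
  \<comment> \<open>The extension lives on the type \<open>'k\<close> and not on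
    \<open>'k list\<close>, hence the appeal to
    \<open>difference_separable_extension\<close>.\<close>
  have inj: "inj_on (sig (tensor k \<phi> R (sig k) k)) (carrier RK.T)"
    using difference_separable_extension[OF dR sep ext] unfolding tensor_carrier(2) .
  have "R.finite_dimension ?K (carrier R)"
    using R.finite_dimension_lin_gen[OF False F(1,2)] F(3) R.lin_gen_closed[OF F(2)] by (simp add: subset_antisym)
  then obtain n where n: "R.dimension n ?K (carrier R)" unfolding R.finite_dimension_def by blast
  obtain us where us: "set us \<subseteq> carrier R" "R.independent ?K us" "length us = n" "R.Span ?K us = carrier R"
    using R.exists_base[OF s n] by blast
  have sus: "set (map (sig R) us) \<subseteq> carrier R" using us(1) sig_R_closed[OF dR] by auto
  have comb: "RK.pt (R.combine (map \<phi> cs) vs) \<one>\<^bsub>k\<^esub> = pure_sum k \<phi> R (sig k) k vs (map (sig k) cs)"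
    if "set cs \<subseteq> carrier k" "set vs \<subseteq> carrier R" for cs vs
    using that
  proof (induction vs cs rule: pure_sum.induct[OF dR ext])
    case (1 u us s ss)
    then have "R.combine (map \<phi> ss) us \<in> carrier R" by (intro R.combine_in_carrier) auto
    then show ?case
      using 1 RK.pt_scale[of s u "\<one>\<^bsub>k\<^esub>"] RK.pt_add(1)[of "\<phi> s \<otimes>\<^bsub>R\<^esub> u" "R.combine (map \<phi> ss) us" "\<one>\<^bsub>k\<^esub>"]
      by (simp add: pure_sum.simps[OF dR ext])
  qed (auto simp: pure_sum.simps[OF dR ext])
  have "R.independent ?K (map (sig R) us)"
  proof (rule ccontr)
    assume dep: "\<not> ?thesis"
    obtain Ks where Ks: "length Ks = length us" "R.combine Ks (map (sig R) us) = \<zero>\<^bsub>R\<^esub>" "set Ks \<subseteq> ?K" "set Ks \<noteq> {\<zero>\<^bsub>R\<^esub>}"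
      using R.dependent_imp_non_trivial_combine[OF s sus dep] by auto
    define cs where "cs = map (inv_into (carrier k) \<phi>) Ks"
    have cs: "set cs \<subseteq> carrier k" "map \<phi> cs = Ks"
      unfolding cs_def using Ks(3) by (auto simp: inv_into_into f_inv_into_f subset_iff intro!: map_idI)
    have lcs: "length cs = length us" unfolding cs_def using Ks(1) by simp
    have "sig (tensor k \<phi> R (sig k) k) (pure_sum k \<phi> R (sig k) k us cs) = RK.pt (R.combine (map \<phi> cs) (map (sig R) us)) \<one>\<^bsub>k\<^esub>"
      using sig_pure_sum[OF dR ext us(1) cs(1)] comb[OF cs(1) sus] by simp
    also have "\<dots> = \<zero>\<^bsub>RK.T\<^esub>" using Ks(2) cs(2) by simp
    also have "\<dots> = sig (tensor k \<phi> R (sig k) k) \<zero>\<^bsub>RK.T\<^esub>"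
      using ring_hom_zero[OF sig_tensor_hom[OF dR ext] RK.T.ring_axioms RK.T.ring_axioms] by simp
    finally have "pure_sum k \<phi> R (sig k) k us cs = \<zero>\<^bsub>RK.T\<^esub>"
      using inj_onD[OF inj _ pure_sum_closed[OF dR ext us(1) cs(1)]] by simp
    then have "set cs \<subseteq> {\<zero>\<^bsub>k\<^esub>}"
      using pure_sum_independent[OF dR ext us(2) False cs(1) lcs] by blast
    then have "set Ks \<subseteq> {\<zero>\<^bsub>R\<^esub>}" using cs(2)[symmetric] by auto
    then have "Ks = []" using Ks(4) by (cases Ks) auto
    then have "us = []" using Ks(1) by simp
    then show False using dep by simp
  qed
  then have "R.Span ?K (map (sig R) us) = carrier R"
    using R.independent_length_eq_dimension[OF s n _ sus] us(3) by simp
  then have "carrier R = lin_gen k \<phi> R (sig R ` set us)" using R.Span_eq_lin_gen[OF False sus] by simp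
  also have "\<dots> \<subseteq> lin_gen k \<phi> R (sig R ` carrier R)"
    by (rule R.lin_gen_least[OF R.lin_closed_lin_gen subset_trans[OF _ R.lin_gen_incl]])
      (use sig_R_closed[OF dR] us(1) in auto)
  finally show ?thesis .
qed

text \<open>If \<sigma>(R) spans \<open>R\<close>, the images of a base form a base by counting. In
  these coordinates \<sigma> acts on \<open>R \<otimes> K\<close> through \<sigma> of
  \<open>K\<close>, which is injective because \<open>K\<close> is a field.\<close>

lemma span_imp_difference_separable:
  fixes k :: "('k, 'l) difference_ring_scheme"
  assumes dR: "difference_algebra k \<phi> R" and F: "finite F" "F \<subseteq> carrier R" "carrier R \<subseteq> lin_gen k \<phi> R F"
    and span: "carrier R \<subseteq> lin_gen k \<phi> R (sig R ` carrier R)"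
  shows "difference_separable k \<phi> R"
  unfolding difference_separable_def
proof (intro allI impI)
  fix K :: "'k list difference_ring" and \<iota>
  assume ext: "difference_field_extension k \<iota> K"
  interpret R: k_algebra k \<phi> R using difference_algebra_k_algebra[OF dR] .
  interpret K: k_algebra k \<iota> K
    using difference_algebra_k_algebra ext unfolding difference_field_extension_def by blast
  interpret Kf: field K
    using ext unfolding difference_field_extension_def difference_field_def by blast
  interpret RK: tensor_algebras k \<phi> R \<iota> K by unfold_locales
  let ?s = "sig (tensor k \<phi> R \<iota> K)"
  note hom = sig_tensor_hom[OF dR ext]
  interpret s: ring_hom_ring RK.T RK.T ?s using hom by (intro ring_hom_ringI2) unfold_locales
  have sK: "sig K \<in> ring_hom K K"
    using ext unfolding difference_field_extension_def difference_field_def difference_ring_def difference_ring_axioms_def by blast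
  interpret sK: ring_hom_ring K K "sig K" using sK by (intro ring_hom_ringI2) unfold_locales
  have sK_inj: "inj_on (sig K) (carrier K)" using sK.img_is_subfield(1)[OF Kf.carrier_is_subfield] by simp
  have ker: "z = \<zero>\<^bsub>RK.T\<^esub>" if z: "z \<in> carrier RK.T" "?s z = \<zero>\<^bsub>RK.T\<^esub>" for z
  proof (cases "\<one>\<^bsub>R\<^esub> = \<zero>\<^bsub>R\<^esub>")
    case True
    then have R0: "carrier R = {\<zero>\<^bsub>R\<^esub>}" using R.one_zeroD by simp
    show ?thesis using z(1) by (induction z rule: RK.tensor_induct) (auto simp: R0)
  next
    case False
    let ?K = "\<phi> ` carrier k"
    note s = R.str_subfield[OF False]
    have "R.finite_dimension ?K (carrier R)"
      using R.finite_dimension_lin_gen[OF False F(1,2)] F(3) R.lin_gen_closed[OF F(2)] by (simp add: subset_antisym)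
    then obtain n where n: "R.dimension n ?K (carrier R)" unfolding R.finite_dimension_def by blast
    obtain us where us: "set us \<subseteq> carrier R" "R.independent ?K us" "length us = n" "R.Span ?K us = carrier R"
      using R.exists_base[OF s n] by blast
    have sus: "set (map (sig R) us) \<subseteq> carrier R" using us(1) sig_R_closed[OF dR] by auto
    have "sig R ` carrier R \<subseteq> lin_gen k \<phi> R (sig R ` set us)"
      using sig_lin_gen[OF dR us(1)] us(4) R.Span_eq_lin_gen[OF False us(1)] by auto
    then have "carrier R \<subseteq> lin_gen k \<phi> R (sig R ` set us)"
      using span R.lin_gen_least[OF R.lin_closed_lin_gen] sus by (metis set_map subset_trans)
    then have sp: "R.Span ?K (map (sig R) us) = carrier R"
      using R.Span_eq_lin_gen[OF False sus] R.lin_gen_closed[of "sig R ` set us"] sus by auto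
    obtain d where "d \<le> length us" "R.dimension d ?K (carrier R)" "d = length us \<longrightarrow> R.independent ?K (map (sig R) us)"
      using R.Span_dimension_le[OF s sus] unfolding sp by auto
    then have ind: "R.independent ?K (map (sig R) us)"
      using R.dimension_is_inj[OF s n] us(3) by blast
    obtain ss where ss: "set ss \<subseteq> carrier K" "length ss = length us" "z = pure_sum k \<phi> R \<iota> K us ss"
      using pure_sum_exists[OF dR ext us(1,4) False z(1)] by blast
    have sss: "set (map (sig K) ss) \<subseteq> carrier K" using ss(1) ring_hom_closed[OF sK] by auto
    have "pure_sum k \<phi> R \<iota> K (map (sig R) us) (map (sig K) ss) = \<zero>\<^bsub>RK.T\<^esub>"
      using sig_pure_sum[OF dR ext us(1) ss(1)] z(2) ss(3) by simp
    then have "set (map (sig K) ss) \<subseteq> {\<zero>\<^bsub>K\<^esub>}"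
      using pure_sum_independent[OF dR ext ind False sss] ss(2) by simp
    then have "sig K s = sig K \<zero>\<^bsub>K\<^esub>" if "s \<in> set ss" for s using that by auto
    then have "s = \<zero>\<^bsub>K\<^esub>" if "s \<in> set ss" for s
      using inj_onD[OF sK_inj, of s "\<zero>\<^bsub>K\<^esub>"] that ss(1) by blast
    then have "set ss \<subseteq> {\<zero>\<^bsub>K\<^esub>}" by blast
    then have "pure_sum k \<phi> R \<iota> K us ss = \<zero>\<^bsub>RK.T\<^esub>"
      using us(1)
      by (induction us ss rule: pure_sum.induct[OF dR ext]) (auto simp: pure_sum.simps[OF dR ext])
    then show ?thesis using ss(3) by simp
  qed
  have "a_kernel RK.T RK.T ?s = {\<zero>\<^bsub>RK.T\<^esub>}"
    unfolding a_kernel_def' by (intro equalityI subsetI) (simp_all add: ker)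
  then show "inj_on ?s (carrier (tensor k \<phi> R \<iota> K))"
    unfolding tensor_carrier(2) by (rule s.trivial_ker_imp_inj)
qed

text \<open>Separability supplies the finite dimension on which the spanning criterion depends.
  Extensions no longer occur on the right-hand side.\<close>

theorem strongly_etale_iff:
  assumes dR: "difference_algebra k \<phi> R"
  shows "strongly_etale k \<phi> R \<longleftrightarrow> separable_algebra k \<phi> R \<and> carrier R \<subseteq> lin_gen k \<phi> R (sig R ` carrier R)"
proof -
  interpret R: k_algebra k \<phi> R using difference_algebra_k_algebra[OF dR] .
  have "difference_separable k \<phi> R \<longleftrightarrow> carrier R \<subseteq> lin_gen k \<phi> R (sig R ` carrier R)"
    if sep: "separable_algebra k \<phi> R"
  proof -
    obtain F where F: "finite F" "F \<subseteq> carrier R" "carrier R \<subseteq> lin_gen k \<phi> R F"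
      using R.separable_finite[OF sep] by metis
    show ?thesis
      using difference_separable_imp_span[OF dR F] span_imp_difference_separable[OF dR F] by blast
  qed
  then show ?thesis
    unfolding strongly_etale_def etale_iff_separable[OF R.k_algebra_axioms] by blast
qed

section \<open>The strong core and base change\<close>

text \<open>The criterion \<open>strongly_etale_iff\<close> for \<open>A\<close>; the span may be
  taken in \<open>R\<close> since \<open>lin_gen\<close> does not depend on the carrier.\<close>

definition strongly_etale_subalgebra ::
    "'a set \<Rightarrow> ('k, 'm) difference_ring_scheme \<Rightarrow> ('k \<Rightarrow> 'a) \<Rightarrow> ('a, 'n) difference_ring_scheme \<Rightarrow> bool"
  where "strongly_etale_subalgebra A k \<phi> R \<longleftrightarrow> difference_subalgebra A k \<phi> R \<and>
    separable_algebra k \<phi> (R\<lparr>carrier := A\<rparr>) \<and> A \<subseteq> lin_gen k \<phi> R (sig R ` A)"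

lemma difference_subalgebra_algebra:
  assumes R: "difference_algebra k \<phi> R" and A: "difference_subalgebra A k \<phi> R"
  shows "difference_algebra k \<phi> (R\<lparr>carrier := A\<rparr>)"
proof -
  interpret R: k_algebra k \<phi> R using difference_algebra_k_algebra[OF R] .
  note d = difference_algebraD[OF R]
  have A': "subring A R" "\<phi> ` carrier k \<subseteq> A" "sig R ` A \<subseteq> A" using A unfolding difference_subalgebra_def by auto
  interpret A: k_algebra k \<phi> "R\<lparr>carrier := A\<rparr>" using R.k_subalgebra[OF A'(1,2)] .
  have "sig R \<in> ring_hom (R\<lparr>carrier := A\<rparr>) (R\<lparr>carrier := A\<rparr>)"
    by (rule ring_hom_memI)
      (use A' subringE(1)[OF A'(1)] ring_hom_add[OF d(4)] ring_hom_mult[OF d(4)] ring_hom_one[OF d(4)] in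
        \<open>auto simp: image_subset_iff subset_iff\<close>)
  then have "difference_ring (R\<lparr>carrier := A\<rparr>)"
    unfolding difference_ring_def difference_ring_axioms_def using A.cring_axioms by simp
  then show ?thesis
    using R A.str_hom unfolding difference_algebra_def by simp
qed

lemma strong_core_eq:
  assumes R: "difference_algebra k \<phi> R"
  shows "strong_core k \<phi> R = \<Union>{A. strongly_etale_subalgebra A k \<phi> R}"
  unfolding strong_core_def strongly_etale_subalgebra_def
  using strongly_etale_iff[OF difference_subalgebra_algebra[OF R]]
  by (intro arg_cong[where f = Union] Collect_cong) auto

section \<open>The strong core as a directed union\<close>

context
  fixes k :: "('k, 'l) difference_ring_scheme" and \<phi> :: "'k \<Rightarrow> 'a" and R :: "('a, 'm) difference_ring_scheme"
  assumes dR: "difference_algebra k \<phi> R"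
begin

interpretation R: k_algebra k \<phi> R
  using difference_algebra_k_algebra[OF dR] .

lemma subalgebraD:
  assumes "strongly_etale_subalgebra A k \<phi> R"
  shows "subring A R" "\<phi> ` carrier k \<subseteq> A" "sig R ` A \<subseteq> A" "A \<subseteq> carrier R"
    "separable_algebra k \<phi> (R\<lparr>carrier := A\<rparr>)" "A \<subseteq> lin_gen k \<phi> R (sig R ` A)"
    "k_algebra k \<phi> (R\<lparr>carrier := A\<rparr>)"
  using assms R.k_subalgebra subringE(1)
  unfolding strongly_etale_subalgebra_def difference_subalgebra_def by auto

text \<open>The idempotent is \<open>1 \<otimes> 1\<close>. This subalgebra puts the scalars, and in
  particular 1, into the core.\<close>

lemma strongly_etale_base: "strongly_etale_subalgebra (\<phi> ` carrier k) k \<phi> R"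
proof -
  note d = difference_algebraD[OF dR]
  interpret h: ring_hom_ring k R \<phi> using R.str_hom by (intro ring_hom_ringI2) unfold_locales
  let ?A = "\<phi> ` carrier k"
  have A: "subring ?A R" using h.img_is_subring[OF R.k.carrier_is_subring] by simp
  then interpret A: k_algebra k \<phi> "R\<lparr>carrier := ?A\<rparr>" using R.k_subalgebra by blast
  interpret AA: tensor_algebras k \<phi> "R\<lparr>carrier := ?A\<rparr>" \<phi> "R\<lparr>carrier := ?A\<rparr>" by unfold_locales
  have "separable_algebra k \<phi> (R\<lparr>carrier := ?A\<rparr>)"
    by (rule A.separableI[where F = "{}", OF AA.T.one_closed])
      (use ring_hom_one[OF A.mu_hom] in \<open>auto intro: alg_gen.str\<close>)
  moreover have "?A \<subseteq> lin_gen k \<phi> R (sig R ` ?A)"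
  proof
    fix x assume "x \<in> ?A"
    then obtain c where c: "c \<in> carrier k" "x = \<phi> c" by blast
    have "\<one>\<^bsub>R\<^esub> \<in> sig R ` ?A" using ring_hom_one[OF d(4)] subringE(3)[OF A] by force
    from lin_gen.scale[where \<phi> = \<phi> and R = R, OF this c(1)] show "x \<in> lin_gen k \<phi> R (sig R ` ?A)" using c by simp
  qed
  moreover have "sig R ` ?A \<subseteq> ?A" using d(5,6) by auto
  ultimately show ?thesis
    unfolding strongly_etale_subalgebra_def difference_subalgebra_def using A by blast
qed

text \<open>Composita make the family of strongly \<sigma>-etale subalgebras directed, so the core
  is closed under sums and products.\<close>

lemma strongly_etale_compositum:
  assumes A: "strongly_etale_subalgebra A k \<phi> R" and B: "strongly_etale_subalgebra B k \<phi> R"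
  shows "strongly_etale_subalgebra (alg_gen k \<phi> R (A \<union> B)) k \<phi> R"
proof -
  note a = subalgebraD[OF A] and b = subalgebraD[OF B]
  let ?C = "alg_gen k \<phi> R (A \<union> B)"
  have F: "A \<union> B \<subseteq> carrier R" using a(4) b(4) by blast
  note C = R.alg_gen_subring[OF F]
  interpret C: k_algebra k \<phi> "R\<lparr>carrier := ?C\<rparr>" using R.k_subalgebra[OF C(1,2)] .
  have sC: "sig R ` ?C \<subseteq> carrier R" using subringE(1)[OF C(1)] sig_R_closed[OF dR] by auto
  have inc: "sig R ` A \<subseteq> lin_gen k \<phi> R (sig R ` ?C)" "sig R ` B \<subseteq> lin_gen k \<phi> R (sig R ` ?C)"
    using R.lin_gen_incl[OF sC] C(3) by blast+
  have "A \<union> B \<subseteq> lin_gen k \<phi> R (sig R ` ?C)"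
    using a(6) b(6) R.lin_gen_least[OF R.lin_closed_lin_gen[OF sC] inc(1)]
      R.lin_gen_least[OF R.lin_closed_lin_gen[OF sC] inc(2)] by blast
  moreover have "sig R ` (A \<union> B) \<subseteq> ?C" using a(3) b(3) C(3) by blast
  moreover have "separable_algebra k \<phi> (R\<lparr>carrier := ?C\<rparr>)"
  proof (rule separable_compositum[OF a(7) b(7) C.k_algebra_axioms _ _ _ _ a(5) b(5)])
    show "(\<lambda>x. x) \<in> ring_hom (R\<lparr>carrier := A\<rparr>) (R\<lparr>carrier := ?C\<rparr>)"
      "(\<lambda>x. x) \<in> ring_hom (R\<lparr>carrier := B\<rparr>) (R\<lparr>carrier := ?C\<rparr>)"
      using C(3) by (auto simp: ring_hom_def)
  qed simp_all
  ultimately show ?thesis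
    unfolding strongly_etale_subalgebra_def using alg_gen_sig_stable[OF dR F] by blast
qed

lemma strong_core_subring:
  shows "subring (strong_core k \<phi> R) R" "\<phi> ` carrier k \<subseteq> strong_core k \<phi> R"
proof -
  let ?C = "strong_core k \<phi> R"
  note C = strong_core_eq[OF dR]
  have in_C: "A \<subseteq> ?C" if "strongly_etale_subalgebra A k \<phi> R" for A unfolding C using that by blast
  show k: "\<phi> ` carrier k \<subseteq> ?C" by (rule in_C[OF strongly_etale_base])
  have two: "\<exists>A. strongly_etale_subalgebra A k \<phi> R \<and> x \<in> A \<and> y \<in> A" if xy: "x \<in> ?C" "y \<in> ?C" for x y
  proof -
    obtain A B where AB: "strongly_etale_subalgebra A k \<phi> R" "x \<in> A" "strongly_etale_subalgebra B k \<phi> R" "y \<in> B"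
      using xy unfolding C by blast
    have "A \<union> B \<subseteq> alg_gen k \<phi> R (A \<union> B)" using alg_gen.incl[of _ "A \<union> B"] by blast
    then show ?thesis using strongly_etale_compositum[OF AB(1,3)] AB(2,4) by blast
  qed
  show "subring ?C R"
  proof (rule R.subringI)
    show "?C \<subseteq> carrier R" unfolding C using subalgebraD(4) by blast
    show "\<one>\<^bsub>R\<^esub> \<in> ?C" using k R.str_simps(3) R.k.one_closed by force
    show "\<ominus>\<^bsub>R\<^esub> x \<in> ?C" if x: "x \<in> ?C" for x
    proof -
      obtain A where A: "strongly_etale_subalgebra A k \<phi> R" "x \<in> A" using two[OF x x] by blast
      show ?thesis using subringE(5)[OF subalgebraD(1)[OF A(1)] A(2)] in_C[OF A(1)] by blast
    qed
    show "x \<otimes>\<^bsub>R\<^esub> y \<in> ?C" "x \<oplus>\<^bsub>R\<^esub> y \<in> ?C" if xy: "x \<in> ?C" "y \<in> ?C" for x y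
    proof -
      obtain A where A: "strongly_etale_subalgebra A k \<phi> R" "x \<in> A" "y \<in> A" using two[OF xy] by blast
      show "x \<otimes>\<^bsub>R\<^esub> y \<in> ?C" "x \<oplus>\<^bsub>R\<^esub> y \<in> ?C"
        using subringE(6,7)[OF subalgebraD(1)[OF A(1)] A(2,3)] in_C[OF A(1)] by blast+
    qed
  qed
qed

section \<open>Base change and descent of strongly \<sigma>-etale subalgebras\<close>

context
  fixes \<iota> :: "'k \<Rightarrow> 'b" and K :: "('b, 'n) difference_ring_scheme"
  assumes dK: "difference_field_extension k \<iota> K"
begin

interpretation K: k_algebra k \<iota> K
  using difference_algebra_k_algebra dK unfolding difference_field_extension_def by blast

interpretation Kf: field K
  using dK unfolding difference_field_extension_def difference_field_def by blast

interpretation RK: tensor_algebras k \<phi> R \<iota> K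
  by unfold_locales

abbreviation (input) "TK \<equiv> tensor k \<phi> R \<iota> K"
abbreviation (input) "\<rho> \<equiv> pure_tensor k \<phi> R \<iota> K \<one>\<^bsub>R\<^esub>"

lemma dT: "difference_algebra K \<rho> TK"
  by (rule tensor_base_change[OF dR dK])

interpretation T: k_algebra K \<rho> TK
  using difference_algebra_k_algebra[OF dT] .

lemma pt_l_base_change: "f \<in> lin_gen k \<phi> R F \<Longrightarrow> F \<subseteq> carrier R \<Longrightarrow> RK.pt f \<one>\<^bsub>K\<^esub> \<in> lin_gen K \<rho> TK ((\<lambda>f. RK.pt f \<one>\<^bsub>K\<^esub>) ` F)"
proof -
  assume f: "f \<in> lin_gen k \<phi> R F" and F: "F \<subseteq> carrier R"
  from f have "f \<in> carrier R \<and> RK.pt f \<one>\<^bsub>K\<^esub> \<in> lin_gen K \<rho> TK ((\<lambda>f. RK.pt f \<one>\<^bsub>K\<^esub>) ` F)"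
  proof induction
    case zero
    have "\<zero>\<^bsub>TK\<^esub> \<in> lin_gen K \<rho> TK ((\<lambda>f. RK.pt f \<one>\<^bsub>K\<^esub>) ` F)" by (rule lin_gen.zero)
    then show ?case by (simp add: tensor_simps)
  next
    case (scale f c)
    then have f: "f \<in> carrier R" using F by blast
    have "\<rho> (\<iota> c) \<otimes>\<^bsub>TK\<^esub> RK.pt f \<one>\<^bsub>K\<^esub> \<in> lin_gen K \<rho> TK ((\<lambda>f. RK.pt f \<one>\<^bsub>K\<^esub>) ` F)"
      by (rule lin_gen.scale) (use scale in auto)
    then show ?case using f scale(2) by (simp add: tensor_simps RK.pt_mult RK.pt_scale)
  next
    case (add x y)
    then have "RK.pt x \<one>\<^bsub>K\<^esub> \<oplus>\<^bsub>TK\<^esub> RK.pt y \<one>\<^bsub>K\<^esub> \<in> lin_gen K \<rho> TK ((\<lambda>f. RK.pt f \<one>\<^bsub>K\<^esub>) ` F)"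
      by (intro lin_gen.add) auto
    then show ?case using add by (simp add: tensor_simps RK.pt_add)
  qed
  then show ?thesis by blast
qed

text \<open>The \<open>K\<close>-algebra generated by \<open>A\<close> stands for
  \<open>A \<otimes> K\<close>. It inherits the idempotent because the image of \<open>A\<close>
  generates it, and the spanning condition because
  \<open>\<sigma>(a \<otimes> 1) = \<sigma>(a) \<otimes> 1\<close>.\<close>

lemma strongly_etale_base_change:
  assumes A: "strongly_etale_subalgebra A k \<phi> R"
  shows "strongly_etale_subalgebra (alg_gen K \<rho> TK ((\<lambda>a. RK.pt a \<one>\<^bsub>K\<^esub>) ` A)) K \<rho> TK"
proof -
  note a = subalgebraD[OF A]
  let ?F = "(\<lambda>a. RK.pt a \<one>\<^bsub>K\<^esub>) ` A"
  let ?B = "alg_gen K \<rho> TK ?F"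
  have sK1: "sig K \<one>\<^bsub>K\<^esub> = \<one>\<^bsub>K\<^esub>"
    using ring_hom_one dK unfolding difference_field_extension_def difference_algebra_def difference_ring_def difference_ring_axioms_def by blast
  have F: "?F \<subseteq> carrier TK" using a(4) by (auto simp: tensor_carrier(2))
  note B = T.alg_gen_subring[OF F]
  interpret B: k_algebra K \<rho> "TK\<lparr>carrier := ?B\<rparr>" using T.k_subalgebra[OF B(1,2)] .
  have sF: "sig TK (RK.pt x \<one>\<^bsub>K\<^esub>) = RK.pt (sig R x) \<one>\<^bsub>K\<^esub>" if "x \<in> A" for x
    using sig_tensor_pt[OF dR dK, of x "\<one>\<^bsub>K\<^esub>"] that a(4) sK1 by auto
  have sFB: "sig TK ` ?F \<subseteq> ?F"
    using a(3) by (auto simp: sF)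
  have sB: "sig TK ` ?B \<subseteq> carrier TK"
    using subringE(1)[OF B(1)] sig_R_closed[OF dT] by auto
  have "?F \<subseteq> lin_gen K \<rho> TK ((\<lambda>f. RK.pt f \<one>\<^bsub>K\<^esub>) ` (sig R ` A))"
    using a(3,4,6) pt_l_base_change[of _ "sig R ` A"] by blast
  also have "(\<lambda>f. RK.pt f \<one>\<^bsub>K\<^esub>) ` (sig R ` A) = sig TK ` ?F"
    using sF by (auto simp: image_iff)
  also have "lin_gen K \<rho> TK (sig TK ` ?F) \<subseteq> lin_gen K \<rho> TK (sig TK ` ?B)"
    by (rule T.lin_gen_least[OF T.lin_closed_lin_gen[OF sB]]) (use B(3) T.lin_gen_incl[OF sB] in blast)
  finally have FB: "?F \<subseteq> lin_gen K \<rho> TK (sig TK ` ?B)" .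
  have "separable_algebra K \<rho> (TK\<lparr>carrier := ?B\<rparr>)"
  proof (rule separable_base_change[OF a(7) B.k_algebra_axioms _ _ _ a(5)])
    show "(\<lambda>a. RK.pt a \<one>\<^bsub>K\<^esub>) \<in> ring_hom (R\<lparr>carrier := A\<rparr>) (TK\<lparr>carrier := ?B\<rparr>)"
      by (rule ring_hom_memI) (use B(3) a(4) in \<open>auto simp: tensor_simps RK.pt_mult RK.pt_add RK.pt_one subset_iff\<close>)
    show "RK.pt (\<phi> c) \<one>\<^bsub>K\<^esub> = \<rho> (\<iota> c)" if "c \<in> carrier k" for c using RK.pt_str[OF that] .
  qed simp_all
  then show ?thesis
    unfolding strongly_etale_subalgebra_def
    using alg_gen_sig_stable[OF dT F _ FB] sFB B(3) by blast
qed

text \<open>The slices of \<open>B\<close> span a finite-dimensional space \<open>V\<close> with \<open>V \<subseteq> k \<sigma>(V)\<close>, since \<open>B \<subseteq> K \<sigma>(B)\<close>;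
  comparing dimensions gives \<open>\<sigma>(V) \<subseteq> V\<close>. The algebra \<open>A\<close> is generated by \<open>V\<close>.\<close>

lemma strongly_etale_descent:
  assumes B: "strongly_etale_subalgebra B K \<rho> TK"
  obtains A where "strongly_etale_subalgebra A k \<phi> R" "\<And>b. b \<in> B \<Longrightarrow> RK.slices b \<subseteq> A"
proof -
  have b: "subring B TK" "\<rho> ` carrier K \<subseteq> B" "sig TK ` B \<subseteq> B" "B \<subseteq> carrier TK"
    "separable_algebra K \<rho> (TK\<lparr>carrier := B\<rparr>)" "B \<subseteq> lin_gen K \<rho> TK (sig TK ` B)"
    using B T.k_subalgebra subringE(1)
    unfolding strongly_etale_subalgebra_def difference_subalgebra_def by auto
  interpret B: k_algebra K \<rho> "TK\<lparr>carrier := B\<rparr>" using T.k_subalgebra[OF b(1,2)] .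
  have BT: "x \<in> carrier RK.T" if "x \<in> B" for x using b(4) that by (auto simp: tensor_carrier(2))
  have lin_T: "lin_gen K \<rho> TK E = lin_gen K \<rho> RK.T E" for E
    by (intro equalityI lin_gen_mono_ops) (simp_all add: tensor_simps)
  obtain E where E: "finite E" "E \<subseteq> B" "B \<subseteq> lin_gen K \<rho> RK.T E"
    using B.separable_finite[OF b(5)] lin_T by auto
  have ET: "E \<subseteq> carrier RK.T" using E(2) BT by blast
  obtain F where F: "finite F" "F \<subseteq> (\<Union>e\<in>E. RK.slices e)"
    "\<And>z. z \<in> lin_gen K \<rho> RK.T E \<Longrightarrow> RK.slices z \<subseteq> lin_gen k \<phi> R F"
    using RK.slices_lin_gen[OF E(1) ET] by blast
  have FR: "F \<subseteq> carrier R" using F(2) ET RK.slices_closed by blast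
  have slB: "RK.slices z \<subseteq> lin_gen k \<phi> R F" if "z \<in> B" for z using F(3) E(3) that by blast
  let ?W = "lin_gen k \<phi> R (sig R ` F)"
  have sFR: "sig R ` F \<subseteq> carrier R" using FR sig_R_closed[OF dR] by auto
  have sK: "sig K s \<in> carrier K" if "s \<in> carrier K" for s
    using difference_algebraD(6)[OF dT] that .
  note hom = sig_tensor_hom[OF dR dK]
  \<comment> \<open>\<sigma> sends \<open>s \<otimes> y\<close> to
    \<open>\<sigma>(s) \<otimes> \<sigma>(y)\<close>, so a slice of \<sigma>(z) is a combination of
    \<sigma>-images of slices of \<open>z\<close>.\<close>
  have sl_sig: "RK.slice g (sig TK z) \<in> ?W" if z: "z \<in> B" and g: "RK.functional g" for z g
    using BT[OF z]
  proof (induction rule: RK.slices_induct)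
    case zero
    show ?case
      using ring_hom_zero[OF hom RK.T.ring_axioms RK.T.ring_axioms] RK.slice_zero[OF g] by (simp add: lin_gen.zero)
  next
    case (pure s y)
    then have "s \<in> lin_gen k \<phi> R F" using slB[OF z] by blast
    then have s: "sig R s \<in> ?W" "s \<in> carrier R" using sig_lin_gen[OF dR FR] R.lin_gen_closed[OF FR] by auto
    have "RK.slice g (sig TK (RK.pt s y)) = \<phi> (g (sig K y)) \<otimes>\<^bsub>R\<^esub> sig R s"
      using sig_tensor_pt[OF dR dK s(2) pure(2)] RK.slice_pt[OF g sig_R_closed[OF dR s(2)] sK[OF pure(2)]] by simp
    then show ?case
      using s(1) R.lin_closed_lin_gen[OF sFR] linear_functionalD(1)[OF g sK[OF pure(2)]] unfolding R.lin_closed_def by auto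
  next
    case (add x y)
    then show ?case
      using ring_hom_closed[OF hom] by (simp add: ring_hom_add[OF hom] RK.slice_add[OF g] lin_gen.add)
  qed
  \<comment> \<open>Each element of \<open>E\<close> is a \<open>K\<close>-combination of elements
    of \<sigma>(B), and the coefficients from \<open>K\<close> are absorbed by the
    functionals.\<close>
  have FW: "F \<subseteq> ?W"
  proof
    fix f assume "f \<in> F"
    then obtain e g where e: "e \<in> E" and g: "RK.functional g" "f = RK.slice g e"
      using F(2) unfolding RK.slices_def by blast
    have "e \<in> lin_gen K \<rho> RK.T (sig TK ` B)" using e E(2) b(6) lin_T by blast
    then have "e \<in> carrier RK.T \<and> (\<forall>g. RK.functional g \<longrightarrow> RK.slice g e \<in> ?W)"
    proof induction
      case zero
      then show ?case by (simp add: RK.slice_zero lin_gen.zero)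
    next
      case (scale f c)
      then obtain z where z: "z \<in> B" "f = sig TK z" by blast
      have f: "f \<in> carrier RK.T" unfolding z(2) using ring_hom_closed[OF hom BT[OF z(1)]] .
      show ?case
      proof (intro conjI allI impI)
        show "\<rho> c \<otimes>\<^bsub>RK.T\<^esub> f \<in> carrier RK.T" using scale f by simp
        fix g assume g: "RK.functional g"
        note g' = K.functional_mult[OF g scale(2)]
        show "RK.slice g (\<rho> c \<otimes>\<^bsub>RK.T\<^esub> f) \<in> ?W"
          using RK.slice_mult[OF g R.one_closed scale(2) f] RK.slice_closed[OF g' f] sl_sig[OF z(1) g'] z(2) by simp
      qed
    next
      case (add x y)
      then show ?case by (simp add: RK.slice_add lin_gen.add)
    qed
    then show "f \<in> ?W" using g by blast
  qed
  have sFV: "sig R ` F \<subseteq> lin_gen k \<phi> R F" using lin_gen_sig_stable[OF dR F(1) FR FW] .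
  let ?A = "alg_gen k \<phi> R F"
  note A = R.alg_gen_subring[OF FR]
  have VA: "lin_gen k \<phi> R F \<subseteq> ?A"
    by (rule R.lin_gen_least[OF R.lin_closed_subring[OF A(1,2)] A(3)])
  have sAR: "sig R ` ?A \<subseteq> carrier R" using subringE(1)[OF A(1)] sig_R_closed[OF dR] by auto
  have "?W \<subseteq> lin_gen k \<phi> R (sig R ` ?A)"
    by (rule R.lin_gen_least[OF R.lin_closed_lin_gen[OF sAR]]) (use A(3) R.lin_gen_incl[OF sAR] in blast)
  then have FA: "F \<subseteq> lin_gen k \<phi> R (sig R ` ?A)" using FW by blast
  interpret A: k_algebra k \<phi> "R\<lparr>carrier := ?A\<rparr>" using R.k_subalgebra[OF A(1,2)] .
  interpret AK: tensor_algebras k \<phi> "R\<lparr>carrier := ?A\<rparr>" \<iota> K by unfold_locales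
  have Ac: "a \<in> carrier R" if "a \<in> ?A" for a using subringE(1)[OF A(1)] that by blast
  have l: "(\<lambda>a. RK.pt a \<one>\<^bsub>K\<^esub>) \<in> ring_hom (R\<lparr>carrier := ?A\<rparr>) RK.T"
    using RK.pt_l_hom Ac by (auto simp: ring_hom_def)
  \<comment> \<open>Tensors over \<open>A\<close> and over \<open>R\<close> are classes in different
    quotients, so \<open>A \<otimes> K\<close> is related to \<open>R \<otimes> K\<close> by a map
    and not by an inclusion of sets.\<close>
  define inc where "inc = AK.lift RK.T (\<lambda>a s. RK.pt a \<one>\<^bsub>K\<^esub> \<otimes>\<^bsub>RK.T\<^esub> RK.pt \<one>\<^bsub>R\<^esub> s)"
  have inc: "inc \<in> ring_hom AK.T RK.T" "\<And>a s. a \<in> ?A \<Longrightarrow> s \<in> carrier K \<Longrightarrow> inc (AK.pt a s) = RK.pt a s"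
    unfolding inc_def using AK.lift_ring_hom[OF RK.T.cring_axioms l RK.pt_r_hom] RK.pt_str Ac by (simp_all add: RK.pt_split)
  note [simp] = ring_hom_closed[OF inc(1)]
  have slinc: "RK.slice g (inc z) = AK.slice g z" if g: "RK.functional g" and z: "z \<in> carrier AK.T" for g z
    by (rule AK.additive_eqI[where P = "\<lambda>x y. x \<oplus>\<^bsub>R\<^esub> y", OF _ _ _ z])
      (use Ac in \<open>simp_all add: ring_hom_add[OF inc(1)] RK.slice_add[OF g] AK.slice_add[OF g] inc(2)
        RK.slice_pt[OF g] AK.slice_pt[OF g]\<close>)
  \<comment> \<open>\<open>inc\<close> preserves slices, and a tensor all of whose slices vanish is
    zero.\<close>
  have inj: "inj_on inc (carrier AK.T)"
  proof -
    interpret inc: ring_hom_ring AK.T RK.T inc using inc(1) by (intro ring_hom_ringI2) unfold_locales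
    have "z = \<zero>\<^bsub>AK.T\<^esub>" if z: "z \<in> carrier AK.T" "inc z = \<zero>\<^bsub>RK.T\<^esub>" for z
      by (rule AK.slices_zero_imp[OF z(1)]) (use slinc[OF _ z(1)] z(2) RK.slice_zero in simp)
    then have "a_kernel AK.T RK.T inc = {\<zero>\<^bsub>AK.T\<^esub>}"
      unfolding a_kernel_def' by (intro equalityI subsetI) simp_all
    then show ?thesis by (rule inc.trivial_ker_imp_inj)
  qed
  \<comment> \<open>The slices of \<open>B\<close> lie in \<open>A\<close>, so \<open>B\<close> lies
    in the image of \<open>inc\<close>; \<open>j\<close> is the resulting embedding of
    \<open>B\<close> into \<open>A \<otimes> K\<close>.\<close>
  define j where "j = inv_into (carrier AK.T) inc"
  have jinc: "j (inc z) = z" if "z \<in> carrier AK.T" for z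
    unfolding j_def using inv_into_f_f[OF inj that] .
  have incj: "inc (j z) = z" "j z \<in> carrier AK.T" if z: "z \<in> B" for z
  proof -
    have "z \<in> inc ` carrier AK.T"
      using BT[OF z]
    proof (induction rule: RK.slices_induct)
      case zero
      show ?case
        using ring_hom_zero[OF inc(1) AK.T.ring_axioms RK.T.ring_axioms] AK.T.zero_closed by force
    next
      case (pure s y)
      then have "s \<in> ?A" using slB[OF z] VA by blast
      then show ?case
        using inc(2)[of s y, symmetric] pure(2) by (intro image_eqI[of _ _ "AK.pt s y"]) auto
    next
      case (add x y)
      then obtain u v where "u \<in> carrier AK.T" "v \<in> carrier AK.T" "x = inc u" "y = inc v" by blast
      then show ?case
        by (intro image_eqI[of _ _ "u \<oplus>\<^bsub>AK.T\<^esub> v"]) (simp_all add: ring_hom_add[OF inc(1)])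
    qed
    then show "inc (j z) = z" "j z \<in> carrier AK.T" using jinc by auto
  qed
  have Bc: "x \<otimes>\<^bsub>RK.T\<^esub> y \<in> B" "x \<oplus>\<^bsub>RK.T\<^esub> y \<in> B" if "x \<in> B" "y \<in> B" for x y
    using subringE(6,7)[OF b(1) that] by (simp_all add: tensor_simps)
  have B1: "\<one>\<^bsub>RK.T\<^esub> \<in> B" using subringE(3)[OF b(1)] by (simp add: tensor_simps)
  have j: "j \<in> ring_hom (TK\<lparr>carrier := B\<rparr>) AK.T"
  proof (rule ring_hom_memI)
    fix x y assume "x \<in> carrier (TK\<lparr>carrier := B\<rparr>)" "y \<in> carrier (TK\<lparr>carrier := B\<rparr>)"
    then have xy: "x \<in> B" "y \<in> B" by auto
    note i = incj[OF xy(1)] incj[OF xy(2)]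
    have "j (x \<otimes>\<^bsub>RK.T\<^esub> y) = j x \<otimes>\<^bsub>AK.T\<^esub> j y" "j (x \<oplus>\<^bsub>RK.T\<^esub> y) = j x \<oplus>\<^bsub>AK.T\<^esub> j y"
      using jinc[of "j x \<otimes>\<^bsub>AK.T\<^esub> j y"] jinc[of "j x \<oplus>\<^bsub>AK.T\<^esub> j y"] i
      by (simp_all add: ring_hom_mult[OF inc(1)] ring_hom_add[OF inc(1)])
    then show "j (x \<otimes>\<^bsub>TK\<lparr>carrier := B\<rparr>\<^esub> y) = j x \<otimes>\<^bsub>AK.T\<^esub> j y" "j (x \<oplus>\<^bsub>TK\<lparr>carrier := B\<rparr>\<^esub> y) = j x \<oplus>\<^bsub>AK.T\<^esub> j y"
      by (simp_all add: tensor_simps)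
  next
    show "j \<one>\<^bsub>TK\<lparr>carrier := B\<rparr>\<^esub> = \<one>\<^bsub>AK.T\<^esub>"
      using jinc[OF AK.T.one_closed] ring_hom_one[OF inc(1)] by (simp add: tensor_simps)
  qed (use incj in simp)
  have "separable_algebra k \<phi> (R\<lparr>carrier := ?A\<rparr>)"
  proof (rule separable_descent[OF A.k_algebra_axioms K.k_algebra_axioms B.k_algebra_axioms b(5) j _ F(1)])
    show "j (\<rho> c) = AK.pt \<one>\<^bsub>R\<lparr>carrier := ?A\<rparr>\<^esub> c" if "c \<in> carrier K" for c
      using jinc[of "AK.pt \<one>\<^bsub>R\<^esub> c"] inc(2)[of "\<one>\<^bsub>R\<^esub>" c] that subringE(3)[OF A(1)]
        AK.pt_closed[of "\<one>\<^bsub>R\<^esub>" c] by simp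
    show "F \<subseteq> (\<Union>b\<in>carrier (TK\<lparr>carrier := B\<rparr>). AK.slices (j b))"
    proof
      fix f assume "f \<in> F"
      then obtain e g where e: "e \<in> B" and g: "RK.functional g" "f = RK.slice g e"
        using F(2) E(2) unfolding RK.slices_def by blast
      have "f = AK.slice g (j e)" using slinc[OF g(1) incj(2)[OF e]] incj(1)[OF e] g(2) by simp
      then have "f \<in> AK.slices (j e)" unfolding AK.slices_def using g(1) by blast
      then show "f \<in> (\<Union>b\<in>carrier (TK\<lparr>carrier := B\<rparr>). AK.slices (j b))" using e by auto
    qed
  qed simp
  moreover have "sig R ` F \<subseteq> ?A" using sFV VA by blast
  ultimately have "strongly_etale_subalgebra ?A k \<phi> R"
    unfolding strongly_etale_subalgebra_def using alg_gen_sig_stable[OF dR FR _ FA] by blast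
  moreover have "RK.slices z \<subseteq> ?A" if "z \<in> B" for z using slB[OF that] VA by blast
  ultimately show ?thesis by (rule that)
qed

end

end

text \<open>Tensors over the core and over \<open>R\<close> are cosets of different ideals. The
  canonical map \<open>tensor_map\<close> with two identities therefore expresses how the former sit
  inside \<open>R \<otimes> K\<close>.\<close>

theorem lemma1p24:
  fixes k :: "'k difference_ring" and R :: "'r difference_ring" and K :: "'l difference_ring"
    and \<phi> :: "'k \<Rightarrow> 'r" and \<iota> :: "'k \<Rightarrow> 'l"
  assumes "difference_field k"
    and "difference_algebra k \<phi> R"
    and "difference_field_extension k \<iota> K"
  shows "strong_core K (pure_tensor k \<phi> R \<iota> K \<one>\<^bsub>R\<^esub>) (tensor k \<phi> R \<iota> K) =
    tensor_map k \<phi> R \<iota> K id id ` carrier (tensor k \<phi> (R\<lparr>carrier := strong_core k \<phi> R\<rparr>) \<iota> K)"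
proof -
  note dR = assms(2) and dK = assms(3)
  interpret R: k_algebra k \<phi> R using difference_algebra_k_algebra[OF dR] .
  interpret K: k_algebra k \<iota> K
    using difference_algebra_k_algebra dK unfolding difference_field_extension_def by blast
  interpret RK: tensor_algebras k \<phi> R \<iota> K by unfold_locales
  let ?C = "strong_core k \<phi> R" and ?TK = "tensor k \<phi> R \<iota> K" and ?\<rho> = "pure_tensor k \<phi> R \<iota> K \<one>\<^bsub>R\<^esub>"
  note C = strong_core_subring[OF dR]
  have CR: "?C \<subseteq> carrier R" using subringE(1)[OF C(1)] .
  interpret C: k_algebra k \<phi> "R\<lparr>carrier := ?C\<rparr>" using R.k_subalgebra[OF C] .
  interpret CK: tensor_algebras k \<phi> "R\<lparr>carrier := ?C\<rparr>" \<iota> K by unfold_locales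
  note dT = tensor_base_change[OF dR dK]
  define H where "H = tensor_map k \<phi> R \<iota> K id id"
  have free_id: "free_map id id p = p" for p
    unfolding free_map_def using frag_expansion[of p] by (simp add: case_prod_unfold)
  have id: "id \<in> ring_hom (R\<lparr>carrier := ?C\<rparr>) R" "id \<in> ring_hom K K"
    using CR by (auto simp: ring_hom_def)
  have H_cl: "H (CK.cl p) = RK.cl p" if "Poly_Mapping.keys p \<subseteq> ?C \<times> carrier K" for p
    unfolding H_def using tensor_map_class[OF CK.hyps RK.hyps id, of "\<lambda>c. c" p] that by (simp add: free_id)
  have H_pt: "H (CK.pt a s) = RK.pt a s" if "a \<in> ?C" "s \<in> carrier K" for a s
    unfolding pure_tensor_def using H_cl[of "frag_of (a, s)"] that by (simp add: keys_frag_of)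
  have H_add: "H (x \<oplus>\<^bsub>CK.T\<^esub> y) = H x \<oplus>\<^bsub>RK.T\<^esub> H y" if xy: "x \<in> carrier CK.T" "y \<in> carrier CK.T" for x y
  proof -
    obtain p q where pq: "Poly_Mapping.keys p \<subseteq> ?C \<times> carrier K" "x = CK.cl p"
      "Poly_Mapping.keys q \<subseteq> ?C \<times> carrier K" "y = CK.cl q"
      using CK.carrier_cl[OF xy(1)] CK.carrier_cl[OF xy(2)] by auto
    have pq': "Poly_Mapping.keys (p + q) \<subseteq> ?C \<times> carrier K" using Poly_Mapping.keys_add[of p q] pq by blast
    have sub: "?C \<times> carrier K \<subseteq> carrier R \<times> carrier K" using CR by blast
    have "x \<oplus>\<^bsub>CK.T\<^esub> y = CK.cl (p + q)" using CK.cl_add[of p q] pq by simp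
    then show ?thesis
      using RK.cl_add[OF subset_trans[OF pq(1) sub] subset_trans[OF pq(3) sub]] H_cl[OF pq'] H_cl[OF pq(1)] H_cl[OF pq(3)] pq(2,4)
      by simp
  qed
  show ?thesis
    unfolding H_def[symmetric]
  proof
    show "strong_core K ?\<rho> ?TK \<subseteq> H ` carrier (tensor k \<phi> (R\<lparr>carrier := ?C\<rparr>) \<iota> K)"
    proof
      fix b assume "b \<in> strong_core K ?\<rho> ?TK"
      then obtain B where B: "strongly_etale_subalgebra B K ?\<rho> ?TK" "b \<in> B"
        unfolding strong_core_eq[OF dT] by blast
      obtain A where A: "strongly_etale_subalgebra A k \<phi> R" "\<And>b. b \<in> B \<Longrightarrow> RK.slices b \<subseteq> A"
        using strongly_etale_descent[OF dR dK B(1)] by metis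
      have AC: "A \<subseteq> ?C" unfolding strong_core_eq[OF dR] using A(1) by blast
      have b: "b \<in> carrier RK.T"
        using subalgebraD(4)[OF dT B(1)] B(2) by (auto simp: tensor_carrier(2))
      have pt_H: "RK.pt s y \<in> H ` carrier CK.T" if "s \<in> ?C" "y \<in> carrier K" for s y
        using H_pt[OF that, symmetric] that by (intro image_eqI[of _ _ "CK.pt s y"]) auto
      \<comment> \<open>\<open>b\<close> is a sum of tensors \<open>s \<otimes> y\<close> with
        \<open>s\<close> a slice of \<open>b\<close>, and such slices lie in a strongly
        \<sigma>-etale subalgebra of \<open>R\<close>.\<close>
      have "b \<in> H ` carrier CK.T"
        using b
      proof (induction rule: RK.slices_induct)
        case zero
        have "\<zero>\<^bsub>R\<^esub> \<in> ?C" using subringE(2)[OF C(1)] .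
        from pt_H[OF this K.zero_closed] show ?case unfolding RK.pt_zero(1)[OF K.zero_closed] .
      next
        case (pure s y)
        then show ?case using pt_H A(2)[OF B(2)] AC by blast
      next
        case (add x y)
        then obtain u v where "u \<in> carrier CK.T" "v \<in> carrier CK.T" "x = H u" "y = H v" by blast
        then show ?case
          by (intro image_eqI[of _ _ "u \<oplus>\<^bsub>CK.T\<^esub> v"]) (simp_all add: H_add)
      qed
      then show "b \<in> H ` carrier (tensor k \<phi> (R\<lparr>carrier := ?C\<rparr>) \<iota> K)" unfolding tensor_carrier(2) .
    qed
  next
    \<comment> \<open>The core over \<open>K\<close> is closed under addition, so pure tensors
      \<open>a \<otimes> s\<close> suffice. These lie in the \<open>K\<close>-algebra generated by a
      strongly \<sigma>-etale subalgebra containing \<open>a\<close>.\<close>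
    have "H z \<in> strong_core K ?\<rho> ?TK" if "z \<in> carrier CK.T" for z
      using that
    proof (induction z rule: CK.tensor_induct)
      case (pure a s)
      then obtain A where A: "strongly_etale_subalgebra A k \<phi> R" "a \<in> A"
        unfolding strong_core_eq[OF dR] by auto
      let ?B = "alg_gen K ?\<rho> ?TK ((\<lambda>a. RK.pt a \<one>\<^bsub>K\<^esub>) ` A)"
      have aR: "a \<in> carrier R" using pure CR by auto
      have "?\<rho> s \<otimes>\<^bsub>?TK\<^esub> RK.pt a \<one>\<^bsub>K\<^esub> \<in> ?B"
        by (intro alg_gen.mult alg_gen.str alg_gen.incl) (use pure A(2) in auto)
      then have "RK.pt a s \<in> ?B" using pure aR by (simp add: tensor_simps RK.pt_mult)
      moreover have "H (CK.pt a s) = RK.pt a s" by (rule H_pt) (use pure in simp_all)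
      ultimately have "H (CK.pt a s) \<in> ?B" by (simp only:)
      then show ?case
        unfolding strong_core_eq[OF dT] using strongly_etale_base_change[OF dR dK A(1)] by blast
    next
      case (add x y)
      show ?case
        unfolding H_add[OF add(1,2)]
        using subringE(7)[OF strong_core_subring(1)[OF dT] add(3,4)] by (simp only: tensor_simps)
    qed
    then show "H ` carrier (tensor k \<phi> (R\<lparr>carrier := ?C\<rparr>) \<iota> K) \<subseteq> strong_core K ?\<rho> ?TK"
      unfolding tensor_carrier(2) by blast
  qed
qed

end
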